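(* Let $\bar A=(A_0,A_1)$ be a compatible couple of (quasi-)Banach spaces with $A_0\cap A_1\neq\{0\}$. Let $0<q_1,r_1\le\infty$ and $a_1,b_1\in SV$ be such that $\|s^{-1/r_1}b_1(s)\|_{r_1,(1,\infty)}<\infty$ and $\left\|s^{-1/r_1}b_1(s)\|u^{-1/q_1}a_1(u)\|_{q_1,(0,s)}\right\|_{r_1,(0,1)}<\infty$, and put $$\chi_1(t)=\left\|s^{-1/r_1}b_1(s)\|u^{-1/q_1}a_1(u)\|_{q_1,(0,s)}\right\|_{r_1,(0,t)}+\|s^{-1/r_1}b_1(s)\|_{r_1,(t,\infty)}\|u^{-1/q_1}a_1(u)\|_{q_1,(0,t)}.$$ Let $0<\theta_0<1$, $0<r_0,q_0\le\infty$, $a_0,b_0\in SV$, and $\|s^{-1/r_0}b_0(s)\|_{r_0,(1,\infty)}<\infty$. Put $\chi_0(t)=a_0(t)\|s^{-1/r_0}b_0(s)\|_{r_0,(t,\infty)}$ and $\rho(t)=t^{1-\theta_0}\frac{\chi_0(t)}{\chi_1(t)}$. Then, for all $f\in\bar A^{\mathcal L}_{\theta_0,r_0,b_0,q_0,a_0}+\bar A^{\mathcal L}_{1,r_1,b_1,q_1,a_1}$ and $t>0$, $$\begin{aligned}K\left(\rho(t),f;\bar A^{\mathcal L}_{\theta_0,r_0,b_0,q_0,a_0},\bar A^{\mathcal L}_{1,r_1,b_1,q_1,a_1}\right)\approx{}&\left\|s^{-1/r_0}b_0(s)\|u^{-\theta_0-1/q_0}a_0(u)K(u,f)\|_{q_0,(0,s)}\right\|_{r_0,(0,t)}\\&+\|s^{-1/r_0}b_0(s)\|_{r_0,(t,\infty)}\|u^{-\theta_0-1/q_0}a_0(u)K(u,f)\|_{q_0,(0,t)}\\&+\rho(t)\left\|s^{-1/r_1}b_1(s)\|u^{-1-1/q_1}a_1(u)K(u,f)\|_{q_1,(t,s)}\right\|_{r_1,(t,\infty)},\end{aligned}$$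 with equivalence constants independent of $f$ and $t$.
   Context: Conventions: $1/\infty=0$; $\|\cdot\|_{q,(a,b)}$ is the usual (quasi-)norm of $L_q$ on the interval $(a,b)$, $0<q\le\infty$. $F\approx G$ means $C^{-1}G\le F\le CG$ for some constant $C>0$ independent of all significant quantities. $b\in SV$ (slowly varying) means that $b$ is a positive Lebesgue measurable function on $(0,\infty)$ such that for each $\varepsilon>0$ the function $t^{\varepsilon}b(t)$ is equivalent ($\approx$) to an increasing function and $t^{-\varepsilon}b(t)$ is equivalent to a decreasing function. For a compatible couple $(X_0,X_1)$ of (quasi-)normed spaces, $K(t,f;X_0,X_1)=\inf\{\|f_0\|_{X_0}+t\|f_1\|_{X_1}: f=f_0+f_1,\ f_i\in X_i\}$ for $f\in X_0+X_1$, $t>0$; $K(t,f):=K(t,f;A_0,A_1)$. For $0\le\theta\le1$, $0<r,q\le\infty$, $a,b\in SV$, $\bar A^{\mathcal L}_{\theta,r,b,q,a}$ is the space of all $f\in A_0+A_1$ with finite (quasi-)norm $\left\|t^{-1/r}b(t)\|u^{-\theta-1/q}a(u)K(u,f)\|_{q,(0,t)}\right\|_{r,(0,\infty)}$. Standing assumption: none of the spaces under consideration is $\{0\}$. *)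

theory Defs
  imports "HOL-Analysis.Analysis" "HOL-Probability.Essential_Supremum"
begin

section \<open>Lebesgue quasi-norms\<close>

text \<open>
  Powers of extended nonnegative reals with positive real exponent, and the quasi-norm of
  \<open>L\<^sub>q(I)\<close>, \<open>0 < q \<le> \<infinity>\<close>, evaluated at a nonnegative extended function (the value may be \<open>\<infinity>\<close>).
  Exponents live in \<^typ>\<open>ennreal\<close>, so \<open>\<infinity>\<close> is allowed, and \<open>rexp q\<close> is \<open>1/q\<close> with \<open>1/\<infinity> = 0\<close>.
\<close>

definition ennpowr :: "ennreal \<Rightarrow> real \<Rightarrow> ennreal" where
  "ennpowr x p = (if x = \<infinity> then \<infinity> else ennreal (enn2real x powr p))"

definition rexp :: "ennreal \<Rightarrow> real" where
  "rexp q = enn2real (1 / q)"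

definition Lnorm :: "ennreal \<Rightarrow> real set \<Rightarrow> (real \<Rightarrow> ennreal) \<Rightarrow> ennreal" where
  "Lnorm q I g =
     (if q = \<infinity> then esssup (lebesgue_on I) g
      else ennpowr (\<integral>\<^sup>+ x. ennpowr (g x) (enn2real q) \<partial>lebesgue_on I) (1 / enn2real q))"

section \<open>Slowly varying functions\<close>

definition equivalent_on :: "real set \<Rightarrow> (real \<Rightarrow> real) \<Rightarrow> (real \<Rightarrow> real) \<Rightarrow> bool" where
  "equivalent_on S F G \<longleftrightarrow> (\<exists>C>0. \<forall>t\<in>S. inverse C * G t \<le> F t \<and> F t \<le> C * G t)"

definition slowly_varying :: "(real \<Rightarrow> real) \<Rightarrow> bool" where
  "slowly_varying b \<longleftrightarrow>
     b \<in> borel_measurable (lebesgue_on {0<..}) \<and> (\<forall>t>0. 0 < b t) \<and>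
     (\<forall>\<epsilon>>0.
        (\<exists>g. monotone_on {0<..} (\<le>) (\<le>) g \<and> equivalent_on {0<..} (\<lambda>t. t powr \<epsilon> * b t) g) \<and>
        (\<exists>h. monotone_on {0<..} (\<le>) (\<ge>) h \<and> equivalent_on {0<..} (\<lambda>t. t powr (- \<epsilon>) * b t) h))"

section \<open>Quasi-normed spaces and compatible couples\<close>

text \<open>
  A space is a set of vectors of an ambient vector space together with a functional on it;
  only the values of \<open>qnorm\<close> on the carrier matter. Scalars are real; a complex space is
  covered by restriction of scalars, since the \<open>K\<close>-functional does not see the scalar field.
\<close>

record 'v qspace =
  qcarrier :: "'v set"
  qnorm :: "'v \<Rightarrow> real"

definition quasi_normed :: "'v::real_vector qspace \<Rightarrow> bool" where
  "quasi_normed X \<longleftrightarrow>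
     subspace (qcarrier X) \<and>
     (\<forall>x\<in>qcarrier X. 0 \<le> qnorm X x \<and> (qnorm X x = 0 \<longleftrightarrow> x = 0)) \<and>
     (\<forall>x\<in>qcarrier X. \<forall>c. qnorm X (c *\<^sub>R x) = \<bar>c\<bar> * qnorm X x) \<and>
     (\<exists>C\<ge>1. \<forall>x\<in>qcarrier X. \<forall>y\<in>qcarrier X. qnorm X (x + y) \<le> C * (qnorm X x + qnorm X y))"

definition quasi_banach :: "'v::real_vector qspace \<Rightarrow> bool" where
  "quasi_banach X \<longleftrightarrow>
     quasi_normed X \<and>
     (\<forall>x. (\<forall>n. x n \<in> qcarrier X) \<longrightarrow>
          (\<forall>e>0. \<exists>M. \<forall>m\<ge>M. \<forall>n\<ge>M. qnorm X (x m - x n) < e) \<longrightarrow>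
          (\<exists>l\<in>qcarrier X. (\<lambda>n. qnorm X (x n - l)) \<longlonglongrightarrow> 0))"

text \<open>
  Compatibility: both spaces embed continuously into one Hausdorff topological vector space,
  here the ambient type. By linearity, continuity of an embedding need only be required at \<open>0\<close>.
\<close>

definition embedded :: "'v::{real_vector, topological_space} qspace \<Rightarrow> bool" where
  "embedded X \<longleftrightarrow>
     (\<forall>U. open U \<longrightarrow> 0 \<in> U \<longrightarrow> (\<exists>\<delta>>0. \<forall>x\<in>qcarrier X. qnorm X x < \<delta> \<longrightarrow> x \<in> U))"

definition compatible_couple ::
  "'v::{real_vector, topological_ab_group_add, t2_space} qspace \<Rightarrow> 'v qspace \<Rightarrow> bool" where
  "compatible_couple X0 X1 \<longleftrightarrow>
     continuous_on UNIV (\<lambda>(c::real, x::'v). c *\<^sub>R x) \<and> embedded X0 \<and> embedded X1"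

definition sum_space :: "'v::real_vector qspace \<Rightarrow> 'v qspace \<Rightarrow> 'v set" where
  "sum_space X0 X1 = {f0 + f1 | f0 f1. f0 \<in> qcarrier X0 \<and> f1 \<in> qcarrier X1}"

definition Kfun :: "'v::real_vector qspace \<Rightarrow> 'v qspace \<Rightarrow> real \<Rightarrow> 'v \<Rightarrow> real" where
  "Kfun X0 X1 t f =
     Inf {qnorm X0 f0 + t * qnorm X1 f1 | f0 f1.
            f0 \<in> qcarrier X0 \<and> f1 \<in> qcarrier X1 \<and> f = f0 + f1}"

section \<open>The interpolation spaces\<close>

definition wgt :: "real \<Rightarrow> ennreal \<Rightarrow> (real \<Rightarrow> real) \<Rightarrow> real \<Rightarrow> ennreal" where
  "wgt \<theta> q a u = ennreal (u powr (- \<theta> - rexp q) * a u)"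

definition LL_norm :: "'v::real_vector qspace \<Rightarrow> 'v qspace \<Rightarrow> real \<Rightarrow>
    ennreal \<Rightarrow> (real \<Rightarrow> real) \<Rightarrow> ennreal \<Rightarrow> (real \<Rightarrow> real) \<Rightarrow> 'v \<Rightarrow> ennreal" where
  "LL_norm A0 A1 \<theta> r b q a f =
     Lnorm r {0<..} (\<lambda>t. wgt 0 r b t *
       Lnorm q {0<..<t} (\<lambda>u. wgt \<theta> q a u * ennreal (Kfun A0 A1 u f)))"

definition LL_space :: "'v::real_vector qspace \<Rightarrow> 'v qspace \<Rightarrow> real \<Rightarrow>
    ennreal \<Rightarrow> (real \<Rightarrow> real) \<Rightarrow> ennreal \<Rightarrow> (real \<Rightarrow> real) \<Rightarrow> 'v qspace" where
  "LL_space A0 A1 \<theta> r b q a =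
     \<lparr>qcarrier = {f \<in> sum_space A0 A1. LL_norm A0 A1 \<theta> r b q a f < \<infinity>},
      qnorm = (\<lambda>f. enn2real (LL_norm A0 A1 \<theta> r b q a f))\<rparr>"

section \<open>The auxiliary functions\<close>

definition chi0 :: "ennreal \<Rightarrow> (real \<Rightarrow> real) \<Rightarrow> (real \<Rightarrow> real) \<Rightarrow> real \<Rightarrow> ennreal" where
  "chi0 r b a t = ennreal (a t) * Lnorm r {t<..} (wgt 0 r b)"

definition chi1 :: "ennreal \<Rightarrow> (real \<Rightarrow> real) \<Rightarrow> ennreal \<Rightarrow> (real \<Rightarrow> real) \<Rightarrow> real \<Rightarrow> ennreal" where
  "chi1 r b q a t =
     Lnorm r {0<..<t} (\<lambda>s. wgt 0 r b s * Lnorm q {0<..<s} (wgt 0 q a)) +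
     Lnorm r {t<..} (wgt 0 r b) * Lnorm q {0<..<t} (wgt 0 q a)"

text \<open>
  Under the integrability hypotheses on the weights both \<open>\<chi>\<close>-functions are finite and positive, so
  their conversion to \<^typ>\<open>real\<close> loses nothing.
\<close>

definition rho :: "real \<Rightarrow> ennreal \<Rightarrow> (real \<Rightarrow> real) \<Rightarrow> (real \<Rightarrow> real) \<Rightarrow>
    ennreal \<Rightarrow> (real \<Rightarrow> real) \<Rightarrow> ennreal \<Rightarrow> (real \<Rightarrow> real) \<Rightarrow> real \<Rightarrow> real" where
  "rho \<theta>0 r0 b0 a0 r1 b1 q1 a1 t =
     t powr (1 - \<theta>0) * enn2real (chi0 r0 b0 a0 t) / enn2real (chi1 r1 b1 q1 a1 t)"

end

theory Submission
  imports Defs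
begin

text \<open>
  The couple enters only through the functions \<open>k(u) = K(u, f; A0, A1)\<close>. Each of them is
  increasing while \<open>k(u) / u\<close> is decreasing; the norm of either space is a double weighted norm of
  \<open>k\<close>, and so is the right-hand side \<open>K_estimate\<close> of the theorem. Both inequalities are therefore
  statements about nested weighted norms of such quasi-concave functions.

  For the upper bound, split \<open>f = f0 + f1\<close> nearly optimally at the level \<open>t\<close>. Then \<open>K(u, f0)\<close> is
  controlled by \<open>K(min u t, f)\<close>: it follows \<open>K(u, f)\<close> up to \<open>t\<close> and is constant afterwards; and
  \<open>K(u, f1)\<close> is linear with slope \<open>K(t, f) / t\<close> up to \<open>t\<close> and follows \<open>K(u, f)\<close> afterwards.
  Inserting these profiles in the two norms gives the three terms of the estimate, plus two terms
  containing only the number \<open>K(t, f)\<close>. The latter are absorbed because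
  \<open>t powr -\<theta>0 * a0 t * K(t, f)\<close> is bounded by the norm of \<open>K(u, f)\<close> over \<open>0 < u < t\<close>. This is
  \<open>totals_le_K_estimate\<close>.

  For the lower bound, take any \<open>f = f0 + f1\<close>. The estimate is quasi-subadditive in \<open>f\<close>, so it
  suffices to bound it at \<open>f0\<close> by the first norm and at \<open>f1\<close> by \<open>\<rho>(t)\<close> times the second. Where the
  terms belong to the matching space they are parts of its norm. The crossed terms come from
  pointwise bounds: finiteness of the two norms forces \<open>\<chi>0(u) K(u, f0)\<close> to be at most of order
  \<open>u powr \<theta>0\<close> and \<open>\<chi>1(u) K(u, f1)\<close> at most of order \<open>u\<close>. As \<open>\<chi>0\<close> and \<open>\<chi>1\<close> vary slowly, they
  may be replaced by their values at \<open>t\<close> at the price of a small power of \<open>u / t\<close>, and because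
  \<open>0 < \<theta>0 < 1\<close> the remaining power integrals converge on \<open>u > t\<close> and on \<open>u < t\<close> respectively. The
  factors \<open>\<chi>0(t)\<close> and \<open>\<chi>1(t)\<close> combine to \<open>\<rho>(t)\<close>; see \<open>tail1_le_total0\<close>, \<open>head0_le_total1\<close> and
  \<open>K_estimate_le_totals\<close>.

  Since norms may be infinite, \<open>t\<close>, \<open>\<chi>0(t)\<close> and \<open>\<chi>1(t)\<close> are carried along as factors; they are positive
  and finite, and are cancelled at the end of each estimate.
\<close>

section \<open>Lebesgue quasi-norms on the half-line\<close>

lemma ennpowr_ennreal: "0 \<le> x \<Longrightarrow> ennpowr (ennreal x) p = ennreal (x powr p)"
  by (simp add: ennpowr_def)

lemma ennpowr_top [simp]: "ennpowr \<infinity> p = \<infinity>" "ennpowr top p = top"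
  by (simp_all add: ennpowr_def)

lemma ennpowr_zero [simp]: "ennpowr 0 p = 0"
  by (simp add: ennpowr_def)

lemma ennpowr_one [simp]: "ennpowr x 1 = x"
  by (cases x) (simp_all add: ennpowr_ennreal)

lemma ennpowr_mono: "x \<le> y \<Longrightarrow> 0 \<le> p \<Longrightarrow> ennpowr x p \<le> ennpowr y p"
  by (cases x; cases y) (auto simp: ennpowr_ennreal powr_mono2 top_unique intro!: ennreal_leI)

lemma ennpowr_ennpowr: "ennpowr (ennpowr x p) s = ennpowr x (p * s)"
  by (cases x) (simp_all add: ennpowr_ennreal powr_powr)

lemma ennpowr_mult:
  assumes "0 < p"
  shows "ennpowr (x * y) p = ennpowr x p * ennpowr y p"
proof (cases x; cases y)
  fix a b assume "x = ennreal a" "y = ennreal b" "0 \<le> a" "0 \<le> b"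
  then show ?thesis
    by (simp add: ennpowr_ennreal powr_mult flip: ennreal_mult)
next
  fix a assume "x = ennreal a" "0 \<le> a" "y = top"
  then show ?thesis
    by (cases "a = 0") (auto simp: ennpowr_ennreal ennreal_mult_top ennreal_eq_0_iff)
next
  fix a assume "x = top" "y = ennreal a" "0 \<le> a"
  then show ?thesis
    by (cases "a = 0") (auto simp: ennpowr_ennreal ennreal_top_mult ennreal_eq_0_iff)
qed simp

lemma ennpowr_add_le:
  assumes "0 < p"
  shows "ennpowr (x + y) p \<le> ennreal (2 powr p) * (ennpowr x p + ennpowr y p)"
proof -
  have "ennpowr (x + y) p \<le> ennpowr (ennreal 2 * max x y) p"
    by (rule ennpowr_mono) (use assms in \<open>auto simp: mult_2 intro!: add_mono\<close>)
  also have "\<dots> = ennreal (2 powr p) * ennpowr (max x y) p"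
    using assms ennpowr_ennreal[of 2 p] by (subst ennpowr_mult) simp_all
  also have "\<dots> \<le> ennreal (2 powr p) * (ennpowr x p + ennpowr y p)"
    by (rule mult_left_mono) (auto simp: max_def add_increasing)
  finally show ?thesis .
qed

lemma measurable_ennpowr [measurable]: "(\<lambda>x. ennpowr x p) \<in> borel_measurable borel"
  unfolding ennpowr_def by measurable

lemma rexp_infinity [simp]: "rexp \<infinity> = 0" "rexp top = 0"
  by (simp_all add: rexp_def)

lemma rexp_finite:
  assumes "q \<noteq> \<infinity>"
  shows "rexp q = 1 / enn2real q"
proof (cases q)
  case (real r)
  then show ?thesis
    using divide_ennreal[of 1 r] by (cases "r = 0") (simp_all add: rexp_def)
qed (use assms in simp)

lemma rexp_nonneg [simp]: "0 \<le> rexp q"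
  by (simp add: rexp_def)

lemma enn2real_pos: "0 < q \<Longrightarrow> q \<noteq> \<infinity> \<Longrightarrow> 0 < enn2real q"
  by (simp add: enn2real_positive_iff top.not_eq_extremum)

text \<open>
  Norms over different sets become integrals over one measure space, where they can be compared and
  added.
\<close>

lemma Lnorm_finite:
  assumes "q \<noteq> \<infinity>" "I \<in> sets lebesgue"
  shows "Lnorm q I g = ennpowr (\<integral>\<^sup>+ x. ennpowr (g x) (enn2real q) * indicator I x \<partial>lebesgue) (rexp q)"
  using assms by (simp add: Lnorm_def rexp_finite nn_integral_restrict_space)

lemma Lnorm_mono:
  assumes "I \<subseteq> J" "I \<in> sets lebesgue" "J \<in> sets lebesgue"
    and "g \<in> borel_measurable (lebesgue_on I)"
    and "\<And>u. u \<in> I \<Longrightarrow> g u \<le> h u"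
  shows "Lnorm q I g \<le> Lnorm q J h"
proof (cases "q = \<infinity>")
  case True
  have "AE u in lebesgue_on J. h u \<le> esssup (lebesgue_on J) h"
    by (rule esssup_AE)
  then have "AE u in lebesgue. u \<in> J \<longrightarrow> h u \<le> esssup (lebesgue_on J) h"
    using assms by (simp add: AE_restrict_space_iff)
  then have "AE u in lebesgue. u \<in> I \<longrightarrow> g u \<le> esssup (lebesgue_on J) h"
    by (rule eventually_mono) (meson assms(1,5) order_trans subsetD)
  then have "esssup (lebesgue_on I) g \<le> esssup (lebesgue_on J) h"
    using assms by (intro esssup_I) (simp_all add: AE_restrict_space_iff)
  with True show ?thesis by (simp add: Lnorm_def)
next
  case False
  have "(\<integral>\<^sup>+ x. ennpowr (g x) (enn2real q) * indicator I x \<partial>lebesgue)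
     \<le> (\<integral>\<^sup>+ x. ennpowr (h x) (enn2real q) * indicator J x \<partial>lebesgue)"
    using assms by (intro nn_integral_mono) (auto simp: indicator_def intro!: ennpowr_mono)
  with False assms show ?thesis
    by (simp add: Lnorm_finite ennpowr_mono)
qed

lemma esssup_cmult_ennreal:
  fixes g :: "'a \<Rightarrow> ennreal"
  assumes [measurable]: "g \<in> borel_measurable M"
  shows "esssup M (\<lambda>x. c * g x) = c * esssup M g"
proof (rule antisym)
  have "AE x in M. c * g x \<le> c * esssup M g"
    using esssup_AE[of g M] by (rule eventually_mono) (simp add: mult_left_mono)
  then show "esssup M (\<lambda>x. c * g x) \<le> c * esssup M g"
    by (intro esssup_I) simp_all
next
  define z where "z = esssup M (\<lambda>x. c * g x)"
  have z: "AE x in M. c * g x \<le> z"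
    unfolding z_def by (rule esssup_AE)
  show "c * esssup M g \<le> z"
  proof (cases "c = 0 \<or> z = top")
    case True then show ?thesis by auto
  next
    case nz: False
    show ?thesis
    proof (cases "c = top")
      case True
      \<comment> \<open>With an infinite factor, a finite bound forces the function to vanish almost everywhere.\<close>
      have "AE x in M. g x \<le> 0"
        using z by (rule eventually_mono)
            (use nz True in \<open>auto simp: ennreal_top_mult top_unique split: if_splits\<close>)
      then have "esssup M g \<le> 0" by (intro esssup_I) simp_all
      then show ?thesis by simp
    next
      case False
      have "AE x in M. g x \<le> z / c"
        using z by (rule eventually_mono)
          (use nz False in \<open>metis ennreal_mult_le_mult_iff ennreal_times_divide infinity_ennreal_def mult.commute mult_divide_eq_ennreal\<close>)
      then have "esssup M g \<le> z / c" by (intro esssup_I) simp_all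
      then have "c * esssup M g \<le> c * (z / c)" by (rule mult_left_mono) simp
      also have "\<dots> = z"
        using nz False by (metis ennreal_times_divide infinity_ennreal_def mult.commute mult_divide_eq_ennreal)
      finally show ?thesis .
    qed
  qed
qed

lemma Lnorm_cmult:
  assumes "0 < q" "I \<in> sets lebesgue" and g: "g \<in> borel_measurable (lebesgue_on I)"
  shows "Lnorm q I (\<lambda>u. c * g u) = c * Lnorm q I g"
proof (cases "q = \<infinity>")
  case True
  then show ?thesis using g by (simp add: Lnorm_def esssup_cmult_ennreal)
next
  case False
  then have p: "0 < enn2real q" using assms by (simp add: enn2real_pos)
  have "(\<integral>\<^sup>+ x. ennpowr (c * g x) (enn2real q) \<partial>lebesgue_on I)
      = ennpowr c (enn2real q) * (\<integral>\<^sup>+ x. ennpowr (g x) (enn2real q) \<partial>lebesgue_on I)"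
    using g p by (simp add: ennpowr_mult nn_integral_cmult)
  with False p show ?thesis
    by (simp add: Lnorm_def ennpowr_mult ennpowr_ennpowr)
qed

text \<open>
  Monotonicity in the set, splitting an interval at a point and the quasi-triangle inequality are all
  cases of this comparison: \<open>q\<close>-th powers of integrands add up, and the \<open>1/q\<close>-th root of a sum costs
  the factor \<open>2 powr (1/q)\<close>. The hypothesis is only almost everywhere, so that a splitting point may be
  left out.
\<close>

lemma Lnorm_union_le:
  assumes "0 < q" and sets: "I \<in> sets lebesgue" "J \<in> sets lebesgue" "K \<in> sets lebesgue"
    and meas: "g \<in> borel_measurable (lebesgue_on I)" "h1 \<in> borel_measurable (lebesgue_on J)"
      "h2 \<in> borel_measurable (lebesgue_on K)"
    and le: "AE u in lebesgue. u \<in> I \<longrightarrow> u \<in> J \<and> g u \<le> h1 u \<or> u \<in> K \<and> g u \<le> h2 u"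
  shows "Lnorm q I g \<le> ennreal (2 powr rexp q) * (Lnorm q J h1 + Lnorm q K h2)"
proof (cases "q = \<infinity>")
  case True
  have 1: "AE u in lebesgue. u \<in> J \<longrightarrow> h1 u \<le> esssup (lebesgue_on J) h1"
    using esssup_AE[of h1 "lebesgue_on J"] sets by (simp add: AE_restrict_space_iff)
  have 2: "AE u in lebesgue. u \<in> K \<longrightarrow> h2 u \<le> esssup (lebesgue_on K) h2"
    using esssup_AE[of h2 "lebesgue_on K"] sets by (simp add: AE_restrict_space_iff)
  have "AE u in lebesgue. u \<in> I \<longrightarrow> g u \<le> esssup (lebesgue_on J) h1 + esssup (lebesgue_on K) h2"
    using le 1 2
    by eventually_elim (meson add_increasing add_increasing2 order_trans zero_le)
  then have "esssup (lebesgue_on I) g \<le> esssup (lebesgue_on J) h1 + esssup (lebesgue_on K) h2"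
    using sets meas by (intro esssup_I) (simp_all add: AE_restrict_space_iff)
  with True show ?thesis by (simp add: Lnorm_def)
next
  case False
  then have p: "0 < enn2real q" using assms by (simp add: enn2real_pos)
  have m: "(\<lambda>x. ennpowr (h x) (enn2real q) * indicator L x) \<in> borel_measurable lebesgue"
    if "h \<in> borel_measurable (lebesgue_on L)" "L \<in> sets lebesgue" for h L
    using that by (subst borel_measurable_restrict_space_iff_ennreal[symmetric]) simp_all
  have le_sum: "ennpowr x (enn2real q) \<le> ennpowr y (enn2real q) + ennpowr z (enn2real q)"
    if "x \<le> y \<or> x \<le> z" for x y z
    using that p by (metis add_increasing add_increasing2 ennpowr_mono less_imp_le zero_le)
  have "(\<integral>\<^sup>+ x. ennpowr (g x) (enn2real q) * indicator I x \<partial>lebesgue)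
     \<le> (\<integral>\<^sup>+ x. ennpowr (h1 x) (enn2real q) * indicator J x
         + ennpowr (h2 x) (enn2real q) * indicator K x \<partial>lebesgue)"
    using le by (intro nn_integral_mono_AE, eventually_elim)
      (use le_sum p in \<open>auto simp: indicator_def intro: ennpowr_mono\<close>)
  also have "\<dots> = (\<integral>\<^sup>+ x. ennpowr (h1 x) (enn2real q) * indicator J x \<partial>lebesgue)
       + (\<integral>\<^sup>+ x. ennpowr (h2 x) (enn2real q) * indicator K x \<partial>lebesgue)"
    using m meas sets by (intro nn_integral_add) auto
  finally have "Lnorm q I g \<le> ennpowr ((\<integral>\<^sup>+ x. ennpowr (h1 x) (enn2real q) * indicator J x \<partial>lebesgue)
       + (\<integral>\<^sup>+ x. ennpowr (h2 x) (enn2real q) * indicator K x \<partial>lebesgue)) (rexp q)"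
    using False sets by (simp add: Lnorm_finite ennpowr_mono)
  also have "\<dots> \<le> ennreal (2 powr rexp q) * (Lnorm q J h1 + Lnorm q K h2)"
    using False p sets by (auto simp: Lnorm_finite rexp_finite intro!: ennpowr_add_le)
  finally show ?thesis .
qed

lemma Lnorm_const:
  assumes "0 < q" "x < y"
  shows "Lnorm q {x<..<y} (\<lambda>_. c) = c * ennreal ((y - x) powr rexp q)"
proof (cases "q = \<infinity>")
  case True
  have "emeasure (lebesgue_on {x<..<y}) {x<..<y} \<noteq> 0"
    using assms by (simp add: emeasure_restrict_space ennreal_eq_0_iff)
  then have "esssup (lebesgue_on {x<..<y}) (\<lambda>_. c) = c"
    by (intro esssup_const) simp
  with True assms show ?thesis by (simp add: Lnorm_def)
next
  case False
  then have p: "0 < enn2real q" using assms by (simp add: enn2real_pos)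
  have "(\<integral>\<^sup>+ u. ennpowr c (enn2real q) * indicator {x<..<y} u \<partial>lebesgue)
      = ennpowr c (enn2real q) * ennreal (y - x)"
    using assms by (subst nn_integral_cmult_indicator) simp_all
  with False p assms show ?thesis
    by (simp add: Lnorm_finite ennpowr_mult ennpowr_ennpowr ennpowr_ennreal rexp_finite)
qed

lemma borel_imp_lebesgue_on_measurable:
  "h \<in> borel_measurable borel \<Longrightarrow> h \<in> borel_measurable (lebesgue_on S)"
  by (intro measurable_restrict_space1 measurable_completion) simp

lemma nn_integral_powr_Ioi:
  assumes "\<beta> < 0" "0 < t"
  shows "(\<integral>\<^sup>+ u. ennreal (u powr (\<beta> - 1)) * indicator {t<..} u \<partial>lebesgue) \<le> ennreal (t powr \<beta> / - \<beta>)"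
proof -
  have "((\<lambda>u. u powr (\<beta> - 1)) has_integral - (t powr (\<beta> - 1 + 1)) / (\<beta> - 1 + 1)) {t..}"
    using assms by (intro has_integral_powr_to_inf) auto
  from nn_integral_has_integral_lebesgue[OF _ this]
  have "(\<integral>\<^sup>+ u. ennreal (indicator {t..} u * u powr (\<beta> - 1)) \<partial>lborel) = ennreal (t powr \<beta> / - \<beta>)"
    by simp
  moreover have "(\<integral>\<^sup>+ u. ennreal (u powr (\<beta> - 1)) * indicator {t<..} u \<partial>lborel) 
     \<le> (\<integral>\<^sup>+ u. ennreal (indicator {t..} u * u powr (\<beta> - 1)) \<partial>lborel)"
    by (intro nn_integral_mono) (auto simp: indicator_def)
  ultimately show ?thesis
    by (simp add: nn_integral_completion)
qed

lemma nn_integral_powr_Ioo: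
  assumes "\<beta> > 0" "0 < t"
  shows "(\<integral>\<^sup>+ u. ennreal (u powr (\<beta> - 1)) * indicator {0<..<t} u \<partial>lebesgue) \<le> ennreal (t powr \<beta> / \<beta>)"
proof -
  have "((\<lambda>u. u powr (\<beta> - 1)) has_integral (t powr (\<beta> - 1 + 1)) / (\<beta> - 1 + 1)) {0..t}"
    using assms by (intro has_integral_powr_from_0) auto
  from nn_integral_has_integral_lebesgue[OF _ this]
  have "(\<integral>\<^sup>+ u. ennreal (indicator {0..t} u * u powr (\<beta> - 1)) \<partial>lborel) = ennreal (t powr \<beta> / \<beta>)"
    by simp
  moreover have "(\<integral>\<^sup>+ u. ennreal (u powr (\<beta> - 1)) * indicator {0<..<t} u \<partial>lborel) 
     \<le> (\<integral>\<^sup>+ u. ennreal (indicator {0..t} u * u powr (\<beta> - 1)) \<partial>lborel)"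
    by (intro nn_integral_mono) (auto simp: indicator_def)
  ultimately show ?thesis
    by (simp add: nn_integral_completion)
qed

text \<open>
  With \<open>1/q\<close> subtracted from the exponent, the norm is taken with respect to \<open>du/u\<close> up to the power
  \<open>u powr -\<alpha>\<close>, so the result has the same form for all \<open>q\<close>, including \<open>q = \<infinity>\<close>.
\<close>

lemma Lnorm_powr_Ioi:
  assumes "0 < q" "0 < \<alpha>"
  shows "\<exists>C>0. \<forall>t>0. Lnorm q {t<..} (\<lambda>u. ennreal (u powr (- \<alpha> - rexp q))) \<le> ennreal (C * t powr (- \<alpha>))"
proof (cases "q = \<infinity>")
  case True
  have "esssup (lebesgue_on {t<..}) (\<lambda>u. ennreal (u powr (- \<alpha>)))
      \<le> ennreal (t powr (- \<alpha>))" if "0 < t" for t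
  proof (rule esssup_I)
    have "AE u in lebesgue. u \<in> {t<..} \<longrightarrow> ennreal (u powr (- \<alpha>)) \<le> ennreal (t powr (- \<alpha>))"
      using that assms by (intro AE_I2) (auto intro!: ennreal_leI powr_mono2')
    then show "AE u in lebesgue_on {t<..}. ennreal (u powr (- \<alpha>)) \<le> ennreal (t powr (- \<alpha>))"
      by (simp add: AE_restrict_space_iff)
  qed (rule borel_imp_lebesgue_on_measurable, measurable)
  with True show ?thesis by (intro exI[of _ 1]) (simp add: Lnorm_def)
next
  case False
  define p where "p = enn2real q"
  have p: "0 < p" and r: "rexp q = 1 / p"
    using False assms by (simp_all add: enn2real_pos rexp_finite p_def)
  have "Lnorm q {t<..} (\<lambda>u. ennreal (u powr (- \<alpha> - rexp q)))
      \<le> ennreal ((1 / (\<alpha> * p)) powr (1 / p) * t powr (- \<alpha>))"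
    if t: "0 < t" for t
  proof -
    have e: "(- \<alpha> - rexp q) * p = - (\<alpha> * p) - 1" using p by (simp add: r field_simps)
    have "(\<integral>\<^sup>+ u. ennpowr (ennreal (u powr (- \<alpha> - rexp q))) p * indicator {t<..} u \<partial>lebesgue)
      = (\<integral>\<^sup>+ u. ennreal (u powr (- (\<alpha> * p) - 1)) * indicator {t<..} u \<partial>lebesgue)"
      by (simp add: ennpowr_ennreal powr_powr e)
    also have "\<dots> \<le> ennreal (t powr (- (\<alpha> * p)) / (\<alpha> * p))"
      using nn_integral_powr_Ioi[of "- (\<alpha> * p)" t] assms p t by simp
    finally have "Lnorm q {t<..} (\<lambda>u. ennreal (u powr (- \<alpha> - rexp q)))
       \<le> ennpowr (ennreal (t powr (- (\<alpha> * p)) / (\<alpha> * p))) (rexp q)"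
      using False by (simp add: Lnorm_finite ennpowr_mono p_def)
    also have "\<dots> = ennreal ((1 / (\<alpha> * p)) powr (1 / p) * t powr (- \<alpha>))"
      using assms p by (simp add: ennpowr_ennreal powr_divide powr_powr r)
    finally show ?thesis .
  qed
  then show ?thesis
    using assms p by (intro exI[of _ "(1 / (\<alpha> * p)) powr (1 / p)"]) simp
qed

lemma Lnorm_powr_Ioo:
  assumes "0 < q" "0 < \<alpha>"
  shows "\<exists>C>0. \<forall>t>0. Lnorm q {0<..<t} (\<lambda>u. ennreal (u powr (\<alpha> - rexp q))) \<le> ennreal (C * t powr \<alpha>)"
proof (cases "q = \<infinity>")
  case True
  have "esssup (lebesgue_on {0<..<t}) (\<lambda>u. ennreal (u powr \<alpha>)) \<le> ennreal (t powr \<alpha>)" if "0 < t" for t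
  proof (rule esssup_I)
    have "AE u in lebesgue. u \<in> {0<..<t} \<longrightarrow> ennreal (u powr \<alpha>) \<le> ennreal (t powr \<alpha>)"
      using that assms by (intro AE_I2) (auto intro!: ennreal_leI powr_mono2)
    then show "AE u in lebesgue_on {0<..<t}. ennreal (u powr \<alpha>) \<le> ennreal (t powr \<alpha>)"
      by (simp add: AE_restrict_space_iff)
  qed (rule borel_imp_lebesgue_on_measurable, measurable)
  with True show ?thesis by (intro exI[of _ 1]) (simp add: Lnorm_def)
next
  case False
  define p where "p = enn2real q"
  have p: "0 < p" and r: "rexp q = 1 / p"
    using False assms by (simp_all add: enn2real_pos rexp_finite p_def)
  have "Lnorm q {0<..<t} (\<lambda>u. ennreal (u powr (\<alpha> - rexp q)))
      \<le> ennreal ((1 / (\<alpha> * p)) powr (1 / p) * t powr \<alpha>)"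
    if t: "0 < t" for t
  proof -
    have e: "(\<alpha> - rexp q) * p = \<alpha> * p - 1" using p by (simp add: r field_simps)
    have "(\<integral>\<^sup>+ u. ennpowr (ennreal (u powr (\<alpha> - rexp q))) p * indicator {0<..<t} u \<partial>lebesgue)
      = (\<integral>\<^sup>+ u. ennreal (u powr (\<alpha> * p - 1)) * indicator {0<..<t} u \<partial>lebesgue)"
      by (simp add: ennpowr_ennreal powr_powr e)
    also have "\<dots> \<le> ennreal (t powr (\<alpha> * p) / (\<alpha> * p))"
      using nn_integral_powr_Ioo[of "\<alpha> * p" t] assms p t by simp
    finally have "Lnorm q {0<..<t} (\<lambda>u. ennreal (u powr (\<alpha> - rexp q)))
       \<le> ennpowr (ennreal (t powr (\<alpha> * p) / (\<alpha> * p))) (rexp q)"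
      using False by (simp add: Lnorm_finite ennpowr_mono p_def)
    also have "\<dots> = ennreal ((1 / (\<alpha> * p)) powr (1 / p) * t powr \<alpha>)"
      using assms p by (simp add: ennpowr_ennreal powr_divide powr_powr r)
    finally show ?thesis .
  qed
  then show ?thesis
    using assms p by (intro exI[of _ "(1 / (\<alpha> * p)) powr (1 / p)"]) simp
qed

abbreviation halfline_measurable :: "(real \<Rightarrow> ennreal) \<Rightarrow> bool" where
  "halfline_measurable g \<equiv> g \<in> borel_measurable (lebesgue_on {0<..})"

text \<open>
  Superlevel sets of an increasing function are half-lines. This makes \<open>K(u, f)\<close> measurable, and also the
  inner norm over \<open>(0, s)\<close> as a function of \<open>s\<close>; both are increasing.
\<close>

lemma mono_imp_halfline_measurable:
  assumes mono: "\<And>u v. 0 < u \<Longrightarrow> u \<le> v \<Longrightarrow> g u \<le> g v"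
  shows "halfline_measurable g"
proof (rule borel_measurableI_greater)
  fix y
  define U where "U = {x \<in> {0<..}. y < g x}"
  have up: "v \<in> U" if "u \<in> U" "u \<le> v" for u v
    using that mono[of u v] by (auto simp: U_def)
  have "U \<in> sets borel"
  proof (cases "U = {}")
    case False
    have bdd: "bdd_below U" by (rule bdd_belowI[of _ 0]) (auto simp: U_def)
    have "{Inf U<..} \<subseteq> U"
      using up cInf_less_iff[OF False bdd] by (force intro: less_imp_le)
    moreover have "U \<subseteq> {Inf U..}"
      using bdd by (auto intro: cInf_lower)
    ultimately have "U = {Inf U<..} \<or> U = {Inf U..}"
      by (force simp: less_le)
    then show ?thesis by (metis atLeast_borel greaterThan_borel)
  qed simp
  then have "U \<in> sets lebesgue" by simp
  then show "{x \<in> space (lebesgue_on {0<..}). y < g x} \<in> sets (lebesgue_on {0<..})"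
    by (auto simp: sets_restrict_space_iff U_def)
qed

lemma halfline_measurable_restrict:
  "halfline_measurable g \<Longrightarrow> I \<subseteq> {0<..} \<Longrightarrow> g \<in> borel_measurable (lebesgue_on I)"
  by (rule measurable_restrict_mono)

lemma open_lebesgue: "open I \<Longrightarrow> I \<in> sets (lebesgue :: real measure)"
  by simp

lemma Lnorm_mono_halfline:
  assumes "I \<subseteq> J" "J \<subseteq> {0<..}" "open I" "open J" "halfline_measurable g"
    and "\<And>u. u \<in> I \<Longrightarrow> g u \<le> h u"
  shows "Lnorm q I g \<le> Lnorm q J h"
  by (rule Lnorm_mono[OF assms(1) open_lebesgue[OF assms(3)] open_lebesgue[OF assms(4)]
        halfline_measurable_restrict[OF assms(5) order_trans[OF assms(1,2)]] assms(6)])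

lemma Lnorm_cmult_halfline:
  assumes "0 < q" "open I" "I \<subseteq> {0<..}" "halfline_measurable g"
  shows "Lnorm q I (\<lambda>u. c * g u) = c * Lnorm q I g"
  using assms by (simp add: Lnorm_cmult open_lebesgue halfline_measurable_restrict)

lemma Lnorm_split:
  assumes "0 < q" "open I" "open J" "open K" "I \<subseteq> {0<..}" "J \<subseteq> {0<..}" "K \<subseteq> {0<..}"
    and "I \<subseteq> insert t (J \<union> K)" and "halfline_measurable g"
  shows "Lnorm q I g \<le> ennreal (2 powr rexp q) * (Lnorm q J g + Lnorm q K g)"
proof (rule Lnorm_union_le)
  have "AE u in lebesgue. u \<noteq> t"
    using AE_lborel_singleton[of t] by (rule AE_completion)
  then show "AE u in lebesgue. u \<in> I \<longrightarrow> u \<in> J \<and> g u \<le> g u \<or> u \<in> K \<and> g u \<le> g u"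
    by eventually_elim (use assms in auto)
qed (rule assms open_lebesgue halfline_measurable_restrict)+

text \<open>
  Pointwise \<open>g + h\<close> is at most twice the larger summand, which reduces the claim to a union of two
  conditions and treats \<open>q < 1\<close> and \<open>q \<ge> 1\<close> alike.
\<close>

lemma Lnorm_add_le:
  assumes "0 < q" "open I" "I \<subseteq> {0<..}" "halfline_measurable g" "halfline_measurable h"
  shows "Lnorm q I (\<lambda>u. g u + h u) \<le> ennreal (2 * 2 powr rexp q) * (Lnorm q I g + Lnorm q I h)"
proof -
  have m: "g \<in> borel_measurable (lebesgue_on I)" "h \<in> borel_measurable (lebesgue_on I)"
    using assms by (simp_all add: halfline_measurable_restrict)
  have "Lnorm q I (\<lambda>u. g u + h u) \<le> ennreal (2 powr rexp q) * (Lnorm q I (\<lambda>u. 2 * g u)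
      + Lnorm q I (\<lambda>u. 2 * h u))"
  proof (rule Lnorm_union_le)
    have "x + y \<le> 2 * x \<or> x + y \<le> 2 * y" for x y :: ennreal
      using linear[of x y] by (auto simp: mult_2 intro: add_mono)
    then show "AE u in lebesgue. u \<in> I \<longrightarrow> u \<in> I \<and> g u + h u \<le> 2 * g u \<or> u \<in> I \<and> g u + h u \<le> 2 * h u"
      by auto
  qed (rule assms borel_measurable_add borel_measurable_times_ennreal borel_measurable_const m open_lebesgue)+
  also have "\<dots> = ennreal (2 powr rexp q) * (2 * (Lnorm q I g + Lnorm q I h))"
    using assms m by (simp add: Lnorm_cmult open_lebesgue distrib_left)
  also have "\<dots> = ennreal (2 * 2 powr rexp q) * (Lnorm q I g + Lnorm q I h)"
    by (simp add: ennreal_mult distrib_left mult_ac)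
  finally show ?thesis .
qed

lemma Lnorm_nested_measurable:
  assumes "halfline_measurable g" "0 \<le> t"
  shows "halfline_measurable (\<lambda>s. Lnorm q {t<..<s} g)"
  by (rule mono_imp_halfline_measurable, rule Lnorm_mono_halfline) (use assms in auto)

text \<open>
  A constant on each side makes it possible to carry factors such as \<open>\<chi>0(t)\<close> or \<open>t\<close>, which will only be
  cancelled in the end, through the inner and the outer norm.
\<close>

lemma Lnorm_scaled_mono:
  assumes "0 < q" "I \<subseteq> J" "J \<subseteq> {0<..}" "open I" "open J" "halfline_measurable g" "halfline_measurable h"
    and le: "\<And>u. u \<in> I \<Longrightarrow> d * g u \<le> c * h u"
  shows "d * Lnorm q I g \<le> c * Lnorm q J h"
proof -
  have "d * Lnorm q I g = Lnorm q I (\<lambda>u. d * g u)"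
    by (rule Lnorm_cmult_halfline[symmetric]) (use assms in auto)
  also have "\<dots> \<le> Lnorm q J (\<lambda>u. c * h u)"
    by (rule Lnorm_mono_halfline) (use assms in \<open>auto intro!: borel_measurable_times_ennreal\<close>)
  also have "\<dots> = c * Lnorm q J h"
    by (rule Lnorm_cmult_halfline) (use assms in auto)
  finally show ?thesis .
qed

lemma scaled_mult_left: "d * x \<le> c * y \<Longrightarrow> d * (w * x) \<le> c * (w * y)" for d x c y w :: ennreal
  by (metis mult.left_commute mult_left_mono zero_le)

section \<open>Slowly varying weights\<close>

text \<open>
  The two one-sided comparisons in the definition of slow variation, with the auxiliary monotone functions
  eliminated. These are the bounds of Potter for regularly varying functions. In this form they are
  visibly stable under products.
\<close>

definition potter_bounds :: "(real \<Rightarrow> real) \<Rightarrow> bool" where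
  "potter_bounds b \<longleftrightarrow> b \<in> borel_measurable (lebesgue_on {0<..}) \<and> (\<forall>t>0. 0 < b t) \<and>
     (\<forall>\<epsilon>>0. \<exists>C>0. \<forall>s>0. \<forall>t\<ge>s. b s \<le> C * (t / s) powr \<epsilon> * b t \<and> b t \<le> C * (t / s) powr \<epsilon> * b s)"

lemma potter_boundsE:
  assumes "potter_bounds b" "0 < \<epsilon>"
  obtains C where "0 < C" "\<And>s t. 0 < s \<Longrightarrow> s \<le> t \<Longrightarrow> b s \<le> C * (t / s) powr \<epsilon> * b t"
    "\<And>s t. 0 < s \<Longrightarrow> s \<le> t \<Longrightarrow> b t \<le> C * (t / s) powr \<epsilon> * b s"
  using assms unfolding potter_bounds_def by metis

lemma potter_pos: "potter_bounds b \<Longrightarrow> 0 < t \<Longrightarrow> 0 < b t"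
  by (simp add: potter_bounds_def)

lemma equivalent_on_almost_mono:
  assumes "equivalent_on S F G" "\<And>x. x \<in> S \<Longrightarrow> 0 < F x"
  obtains C where "0 < C" "\<And>x y. x \<in> S \<Longrightarrow> y \<in> S \<Longrightarrow> G x \<le> G y \<Longrightarrow> F x \<le> C * F y"
proof -
  obtain C where C: "C > 0" "\<And>x. x \<in> S \<Longrightarrow> inverse C * G x \<le> F x" "\<And>x. x \<in> S \<Longrightarrow> F x \<le> C * G x"
    using assms by (auto simp: equivalent_on_def)
  have "F x \<le> (C * C) * F y" if "x \<in> S" "y \<in> S" "G x \<le> G y" for x y
  proof -
    have "F x \<le> C * G y" using C(1) C(3)[OF that(1)] that(3)
        by (meson mult_left_mono less_imp_le order_trans)
    also have "\<dots> \<le> C * (C * F y)" using C(1) C(2)[OF that(2)]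
        by (intro mult_left_mono) (simp_all add: field_simps)
    finally show ?thesis by simp
  qed
  with C(1) that[of "C * C"] show thesis by simp
qed

lemma slowly_varying_imp_potter:
  assumes "slowly_varying b"
  shows "potter_bounds b"
  unfolding potter_bounds_def
proof (intro conjI allI impI)
  show "b \<in> borel_measurable (lebesgue_on {0<..})" "\<And>t. 0 < t \<Longrightarrow> 0 < b t"
    using assms by (auto simp: slowly_varying_def)
  note pos = this(2)
  fix \<epsilon> :: real assume e: "0 < \<epsilon>"
  obtain g h where g: "monotone_on {0<..} (\<le>) (\<le>) g" "equivalent_on {0<..} (\<lambda>t. t powr \<epsilon> * b t) g"
    and h: "monotone_on {0<..} (\<le>) (\<ge>) h" "equivalent_on {0<..} (\<lambda>t. t powr (- \<epsilon>) * b t) h"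
    using assms e unfolding slowly_varying_def by metis
  obtain C1 where C1: "0 < C1" "\<And>s t. 0 < s \<Longrightarrow> 0 < t \<Longrightarrow> g s \<le> g t \<Longrightarrow> s powr \<epsilon> * b s \<le> C1 * (t powr \<epsilon> * b t)"
    using equivalent_on_almost_mono[OF g(2)] pos
        by (metis greaterThan_iff mult_pos_pos powr_gt_zero less_irrefl)
  obtain C2 where C2: "0 < C2" "\<And>s t. 0 < s \<Longrightarrow> 0 < t \<Longrightarrow> h s \<le> h t \<Longrightarrow>
      s powr (-\<epsilon>) * b s \<le> C2 * (t powr (-\<epsilon>) * b t)"
    using equivalent_on_almost_mono[OF h(2)] pos
        by (metis greaterThan_iff mult_pos_pos powr_gt_zero less_irrefl)
  show "\<exists>C>0. \<forall>s>0. \<forall>t\<ge>s. b s \<le> C * (t / s) powr \<epsilon> * b t \<and> b t \<le> C * (t / s) powr \<epsilon> * b s"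
  proof (intro exI[of _ "max C1 C2"] conjI allI impI)
    fix s t :: real assume st: "0 < s" "s \<le> t"
    have "s powr \<epsilon> * b s \<le> C1 * (t powr \<epsilon> * b t)"
      using st g(1) by (intro C1) (auto simp: monotone_on_def)
    then have "b s \<le> C1 * ((t / s) powr \<epsilon> * b t)"
      using st by (simp add: powr_divide field_simps)
    also have "\<dots> \<le> max C1 C2 * ((t / s) powr \<epsilon> * b t)"
      using st pos[of t] by (intro mult_right_mono) auto
    finally show "b s \<le> max C1 C2 * (t / s) powr \<epsilon> * b t" by (simp add: mult_ac)
    have "t powr (-\<epsilon>) * b t \<le> C2 * (s powr (-\<epsilon>) * b s)"
      using st h(1) by (intro C2) (auto simp: monotone_on_def)
    then have "b t \<le> C2 * ((t / s) powr \<epsilon> * b s)"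
      using st by (simp add: powr_divide powr_minus field_simps)
    also have "\<dots> \<le> max C1 C2 * ((t / s) powr \<epsilon> * b s)"
      using st pos[of s] by (intro mult_right_mono) auto
    finally show "b t \<le> max C1 C2 * (t / s) powr \<epsilon> * b s" by (simp add: mult_ac)
  qed (use C1 C2 in auto)
qed

lemma potter_mult:
  assumes a: "potter_bounds a" and b: "potter_bounds b"
  shows "potter_bounds (\<lambda>t. a t * b t)"
  unfolding potter_bounds_def
proof (intro conjI allI impI)
  show "(\<lambda>t. a t * b t) \<in> borel_measurable (lebesgue_on {0<..})"
    using a b by (intro borel_measurable_times) (auto simp: potter_bounds_def)
  show "0 < a t * b t" if "0 < t" for t
    using that a b by (simp add: potter_pos)
  fix \<epsilon> :: real assume e: "0 < \<epsilon>"
  obtain C where C: "0 < C" "\<And>s t. 0 < s \<Longrightarrow> s \<le> t \<Longrightarrow> a s \<le> C * (t / s) powr (\<epsilon>/2) * a t"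
    "\<And>s t. 0 < s \<Longrightarrow> s \<le> t \<Longrightarrow> a t \<le> C * (t / s) powr (\<epsilon>/2) * a s"
    using potter_boundsE[OF a, of "\<epsilon>/2"] e by (metis half_gt_zero)
  obtain D where D: "0 < D" "\<And>s t. 0 < s \<Longrightarrow> s \<le> t \<Longrightarrow> b s \<le> D * (t / s) powr (\<epsilon>/2) * b t"
    "\<And>s t. 0 < s \<Longrightarrow> s \<le> t \<Longrightarrow> b t \<le> D * (t / s) powr (\<epsilon>/2) * b s"
    using potter_boundsE[OF b, of "\<epsilon>/2"] e by (metis half_gt_zero)
  have half: "x powr (\<epsilon>/2) * x powr (\<epsilon>/2) = x powr \<epsilon>" for x :: real
    by (simp flip: powr_add)
  show "\<exists>C>0. \<forall>s>0. \<forall>t\<ge>s. a s * b s \<le> C * (t / s) powr \<epsilon> * (a t * b t)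
      \<and> a t * b t \<le> C * (t / s) powr \<epsilon> * (a s * b s)"
  proof (intro exI[of _ "C * D"] conjI allI impI)
    fix s t :: real assume st: "0 < s" "s \<le> t"
    have p: "0 < a s" "0 < a t" "0 < b s" "0 < b t" using st a b by (simp_all add: potter_pos)
    have "a s * b s \<le> (C * (t / s) powr (\<epsilon>/2) * a t) * (D * (t / s) powr (\<epsilon>/2) * b t)"
      using C D st p by (intro mult_mono) auto
    then show "a s * b s \<le> C * D * (t / s) powr \<epsilon> * (a t * b t)"
      by (simp add: mult_ac half)
    have "a t * b t \<le> (C * (t / s) powr (\<epsilon>/2) * a s) * (D * (t / s) powr (\<epsilon>/2) * b s)"
      using C D st p by (intro mult_mono) auto
    then show "a t * b t \<le> C * D * (t / s) powr \<epsilon> * (a s * b s)"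
      by (simp add: mult_ac half)
  qed (use C D in auto)
qed

lemma measurable_wgt:
  assumes "potter_bounds a"
  shows "halfline_measurable (wgt \<theta> q a)"
proof -
  have [measurable]: "(\<lambda>u::real. u powr (- \<theta> - rexp q)) \<in> borel_measurable (lebesgue_on {0<..})"
    by (rule borel_imp_lebesgue_on_measurable) measurable
  have [measurable]: "a \<in> borel_measurable (lebesgue_on {0<..})"
    using assms by (simp add: potter_bounds_def)
  show ?thesis unfolding wgt_def[abs_def] by measurable
qed

lemma measurable_ennreal_powr: "halfline_measurable (\<lambda>u. ennreal (u powr x))"
  by (rule borel_imp_lebesgue_on_measurable) measurable

text \<open>
  Half of the exponent \<open>\<alpha>\<close> pays for replacing \<open>a(u)\<close> by \<open>a(t)\<close>, and the other half keeps the power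
  integral convergent.
\<close>

lemma Lnorm_wgt_Ioi_le:
  assumes "0 < q" "0 < \<alpha>" "potter_bounds a"
  shows "\<exists>C>0. \<forall>t>0. Lnorm q {t<..} (wgt \<alpha> q a) \<le> ennreal (C * t powr (- \<alpha>) * a t)"
proof -
  obtain C where C: "0 < C" "\<And>s t. 0 < s \<Longrightarrow> s \<le> t \<Longrightarrow> a t \<le> C * (t / s) powr (\<alpha>/2) * a s"
    using potter_boundsE[OF assms(3), of "\<alpha>/2"] assms by (metis half_gt_zero)
  obtain D where D: "0 < D" "\<And>t. 0 < t \<Longrightarrow>
      Lnorm q {t<..} (\<lambda>u. ennreal (u powr (- (\<alpha>/2) - rexp q))) \<le> ennreal (D * t powr (- (\<alpha>/2)))"
    using Lnorm_powr_Ioi[of q "\<alpha>/2"] assms by (metis half_gt_zero)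
  have "Lnorm q {t<..} (wgt \<alpha> q a) \<le> ennreal (C * D * t powr (- \<alpha>) * a t)" if t: "0 < t" for t
  proof -
    have "Lnorm q {t<..} (wgt \<alpha> q a)
        \<le> Lnorm q {t<..} (\<lambda>u. ennreal (C * t powr (- (\<alpha>/2)) * a t) * ennreal (u powr (-
        (\<alpha>/2) - rexp q)))"
    proof (rule Lnorm_mono_halfline)
      fix u assume "u \<in> {t<..}"
      then have u: "0 < u" "t \<le> u" using t by auto
      have "u powr (- \<alpha> - rexp q) * a u \<le> u powr (- \<alpha> - rexp q) * (C * (u / t) powr (\<alpha>/2) * a t)"
        using C(2)[OF t u(2)] by (intro mult_left_mono) auto
      also have "\<dots> = C * t powr (- (\<alpha>/2)) * a t * (u powr (\<alpha>/2) * u powr (- \<alpha> - rexp q))"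
        using t u by (simp add: powr_divide powr_minus field_simps)
      also have "u powr (\<alpha>/2) * u powr (- \<alpha> - rexp q) = u powr (- (\<alpha>/2) - rexp q)"
        by (simp flip: powr_add add: field_simps)
      finally show "wgt \<alpha> q a u \<le> ennreal (C * t powr (- (\<alpha>/2)) * a t) * ennreal (u powr (-
          (\<alpha>/2) - rexp q))"
        using C(1) potter_pos[OF assms(3) t] by (simp add: wgt_def ennreal_leI flip: ennreal_mult)
    qed (use t assms measurable_wgt in auto)
    also have "\<dots> \<le> ennreal (C * t powr (- (\<alpha>/2)) * a t) * ennreal (D * t powr (- (\<alpha>/2)))"
      using D(2)[OF t] assms t measurable_ennreal_powr
          by (subst Lnorm_cmult_halfline) (auto intro: mult_left_mono)
    also have "\<dots> = ennreal (C * D * (t powr (- (\<alpha>/2)) * t powr (- (\<alpha>/2))) * a t)"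
      using C(1) D(1) potter_pos[OF assms(3) t] by (simp add: mult_ac flip: ennreal_mult)
    also have "t powr (- (\<alpha>/2)) * t powr (- (\<alpha>/2)) = t powr (- \<alpha>)"
      by (simp flip: powr_add)
    finally show ?thesis .
  qed
  with C D show ?thesis by (intro exI[of _ "C * D"]) simp
qed

text \<open>
  The mirror image of \<open>Lnorm_wgt_Ioi_le\<close>: near \<open>0\<close> the power has to be positive.
\<close>

lemma Lnorm_wgt_Ioo_le:
  assumes "0 < q" "0 < \<alpha>" "potter_bounds a"
  shows "\<exists>C>0. \<forall>t>0. Lnorm q {0<..<t} (wgt (- \<alpha>) q a) \<le> ennreal (C * t powr \<alpha> * a t)"
proof -
  obtain C where C: "0 < C" "\<And>s t. 0 < s \<Longrightarrow> s \<le> t \<Longrightarrow> a s \<le> C * (t / s) powr (\<alpha>/2) * a t"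
    using potter_boundsE[OF assms(3), of "\<alpha>/2"] assms by (metis half_gt_zero)
  obtain D where D: "0 < D" "\<And>t. 0 < t \<Longrightarrow>
      Lnorm q {0<..<t} (\<lambda>u. ennreal (u powr (\<alpha>/2 - rexp q))) \<le> ennreal (D * t powr (\<alpha>/2))"
    using Lnorm_powr_Ioo[of q "\<alpha>/2"] assms by (metis half_gt_zero)
  have "Lnorm q {0<..<t} (wgt (- \<alpha>) q a) \<le> ennreal (C * D * t powr \<alpha> * a t)" if t: "0 < t" for t
  proof -
    have "Lnorm q {0<..<t} (wgt (- \<alpha>) q a)
        \<le> Lnorm q {0<..<t} (\<lambda>u. ennreal (C * t powr (\<alpha>/2) * a t) * ennreal (u powr (\<alpha>/2 - rexp q)))"
    proof (rule Lnorm_mono_halfline)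
      fix u assume "u \<in> {0<..<t}"
      then have u: "0 < u" "u \<le> t" by auto
      have "u powr (\<alpha> - rexp q) * a u \<le> u powr (\<alpha> - rexp q) * (C * (t / u) powr (\<alpha>/2) * a t)"
        using C(2)[OF u] by (intro mult_left_mono) auto
      also have "\<dots> = C * t powr (\<alpha>/2) * a t * (u powr (- (\<alpha>/2)) * u powr (\<alpha> - rexp q))"
        using t u by (simp add: powr_divide powr_minus field_simps)
      also have "u powr (- (\<alpha>/2)) * u powr (\<alpha> - rexp q) = u powr (\<alpha>/2 - rexp q)"
        by (simp flip: powr_add add: field_simps)
      finally show "wgt (- \<alpha>) q a u \<le> ennreal (C * t powr (\<alpha>/2) * a t) * ennreal (u powr (\<alpha>/2 - rexp q))"
        using C(1) potter_pos[OF assms(3) t] by (simp add: wgt_def ennreal_leI flip: ennreal_mult)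
    qed (use t assms measurable_wgt in auto)
    also have "\<dots> \<le> ennreal (C * t powr (\<alpha>/2) * a t) * ennreal (D * t powr (\<alpha>/2))"
      using D(2)[OF t] assms t measurable_ennreal_powr
          by (subst Lnorm_cmult_halfline) (auto intro: mult_left_mono)
    also have "\<dots> = ennreal (C * D * (t powr (\<alpha>/2) * t powr (\<alpha>/2)) * a t)"
      using C(1) D(1) potter_pos[OF assms(3) t] by (simp add: mult_ac flip: ennreal_mult)
    also have "t powr (\<alpha>/2) * t powr (\<alpha>/2) = t powr \<alpha>"
      by (simp flip: powr_add)
    finally show ?thesis .
  qed
  with C D show ?thesis by (intro exI[of _ "C * D"]) simp
qed

text \<open>
  The two properties of \<open>k = K(\<cdot>, f)\<close> on which all estimates rest. Monotonicity of \<open>k(u) / u\<close> is written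
  as a product because \<open>k\<close> may take the value \<open>\<infinity>\<close>.
\<close>

definition quasi_concave :: "(real \<Rightarrow> ennreal) \<Rightarrow> bool" where
  "quasi_concave k \<longleftrightarrow> (\<forall>u>0. \<forall>v\<ge>u. k u \<le> k v \<and> ennreal u * k v \<le> ennreal v * k u)"

lemma quasi_concaveD:
  assumes "quasi_concave k" "0 < u" "u \<le> v"
  shows "k u \<le> k v" "ennreal u * k v \<le> ennreal v * k u"
  using assms by (auto simp: quasi_concave_def)

lemma quasi_concave_measurable: "quasi_concave k \<Longrightarrow> halfline_measurable k"
  by (rule mono_imp_halfline_measurable) (rule quasi_concaveD)

lemma quasi_concave_one: "quasi_concave (\<lambda>_. 1)"
  by (auto simp: quasi_concave_def intro: ennreal_leI)

lemma quasi_concave_half: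
  assumes "quasi_concave k" "0 < u" "u \<le> t" "t \<le> 2 * u"
  shows "k t \<le> 2 * k u"
proof -
  have "ennreal u * k t \<le> ennreal t * k u"
    using assms by (intro quasi_concaveD)
  also have "\<dots> \<le> ennreal (2 * u) * k u"
    using assms by (intro mult_right_mono ennreal_leI) auto
  also have "\<dots> = ennreal u * (2 * k u)"
    using assms by (simp add: ennreal_mult mult_ac)
  finally show ?thesis
    using assms by (simp add: ennreal_mult_le_mult_iff)
qed

lemma Lnorm_ge_const:
  assumes "0 < q" "0 < x" "x < y" "{x<..<y} \<subseteq> J" "open J" "J \<subseteq> {0<..}"
    and "\<And>u. x < u \<Longrightarrow> u < y \<Longrightarrow> c \<le> g u"
  shows "c * ennreal ((y - x) powr rexp q) \<le> Lnorm q J g"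
proof -
  have "c * ennreal ((y - x) powr rexp q) = Lnorm q {x<..<y} (\<lambda>_. c)"
    using assms(1,3) by (simp add: Lnorm_const)
  also have "\<dots> \<le> Lnorm q J g"
    by (rule Lnorm_mono_halfline[OF assms(4,6) _ assms(5)]) (simp_all add: assms(7))
  finally show ?thesis .
qed

text \<open>
  On \<open>(t/2, t)\<close> the power, the weight and \<open>k\<close> all agree with their values at \<open>t\<close> up to a constant, and the
  norm of a constant over this interval is of order \<open>t powr (1/q)\<close>.
\<close>

lemma le_Lnorm_wgt_quasi_concave:
  assumes "0 < q" "0 \<le> \<theta>" "potter_bounds a"
  shows "\<exists>C>0. \<forall>k. quasi_concave k \<longrightarrow> (\<forall>t>0. ennreal (t powr (- \<theta>) * a t) * k t
      \<le> ennreal C * Lnorm q {0<..<t} (\<lambda>u. wgt \<theta> q a u * k u))"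
proof -
  obtain C where C: "0 < C" "\<And>s t. 0 < s \<Longrightarrow> s \<le> t \<Longrightarrow> a t \<le> C * (t / s) powr 1 * a s"
    using potter_boundsE[OF assms(3), of 1] by (metis zero_less_one)
  have four: "2 * ennreal (2 * C) = ennreal (4 * C)"
    using C(1) by (subst ennreal_numeral[symmetric], subst ennreal_mult[symmetric]) auto
  define D where "D = 4 * C * 2 powr rexp q"
  have "ennreal (t powr (- \<theta>) * a t) * k t \<le> ennreal D * Lnorm q {0<..<t} (\<lambda>u. wgt \<theta> q a u * k u)"
    if k: "quasi_concave k" and t: "0 < t" for k t
  proof -
    have m: "halfline_measurable (\<lambda>u. wgt \<theta> q a u * k u)"
      using k assms by (intro borel_measurable_times_ennreal measurable_wgt quasi_concave_measurable)
    have at: "0 < a t" using t assms by (simp add: potter_pos)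
    have "(ennreal (t powr (- \<theta> - rexp q) * a t) * k t) * ennreal ((t - t / 2) powr rexp q)
       \<le> Lnorm q {0<..<t} (\<lambda>u. ennreal (4 * C) * (wgt \<theta> q a u * k u))"
    proof (rule Lnorm_ge_const)
      fix u assume "t / 2 < u" "u < t"
      then have u: "0 < u" "u \<le> t" "t \<le> 2 * u" using t by auto
      have "t powr (- \<theta> - rexp q) * a t \<le> u powr (- \<theta> - rexp q) * (2 * C * a u)"
      proof (intro mult_mono)
        show "t powr (- \<theta> - rexp q) \<le> u powr (- \<theta> - rexp q)"
          using u assms(2) rexp_nonneg[of q] by (intro powr_mono2') linarith+
        have "a t \<le> C * (t / u) * a u" using C(2)[OF u(1,2)] u by simp
        also have "\<dots> \<le> C * 2 * a u"
          using u C potter_pos[OF assms(3) u(1)] by (intro mult_mono) (auto simp: field_simps)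
        finally show "a t \<le> 2 * C * a u" by simp
      qed (use at in auto)
      also have "\<dots> = 2 * C * (u powr (- \<theta> - rexp q) * a u)" by simp
      finally have "ennreal (t powr (- \<theta> - rexp q) * a t) * k t
          \<le> ennreal (2 * C * (u powr (- \<theta> - rexp q) * a u)) * (2 * k u)"
        using quasi_concave_half[OF k u] by (intro mult_mono[OF ennreal_leI]) auto
      also have "\<dots> = ennreal (4 * C) * (wgt \<theta> q a u * k u)"
        unfolding four[symmetric] wgt_def
        using C(1) potter_pos[OF assms(3) u(1)] by (simp add: mult_ac ennreal_mult)
      finally show "ennreal (t powr (- \<theta> - rexp q) * a t) * k t
          \<le> ennreal (4 * C) * (wgt \<theta> q a u * k u)" .
    qed (use t assms in auto)
    also have "\<dots> = ennreal (4 * C) * Lnorm q {0<..<t} (\<lambda>u. wgt \<theta> q a u * k u)"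
      using assms m by (intro Lnorm_cmult_halfline) auto
    finally have le: "(ennreal (t powr (- \<theta> - rexp q) * a t) * k t) * ennreal ((t / 2) powr rexp q)
       \<le> ennreal (4 * C) * Lnorm q {0<..<t} (\<lambda>u. wgt \<theta> q a u * k u)" by simp
    have "t powr (- \<theta>) * a t = 2 powr rexp q * ((t powr (- \<theta> - rexp q) * a t) * (t / 2) powr rexp q)"
      using t by (simp add: powr_divide powr_diff)
    then have "ennreal (t powr (- \<theta>) * a t) * k t
        = ennreal (2 powr rexp q) * ((ennreal (t powr (- \<theta> - rexp q) * a t) * k t) * ennreal
        ((t / 2) powr rexp q))"
      using at by (simp add: ennreal_mult mult_ac)
    also have "\<dots> \<le> ennreal (2 powr rexp q) * (ennreal (4 * C) * Lnorm q {0<..<t}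
        (\<lambda>u. wgt \<theta> q a u * k u))"
      by (rule mult_left_mono[OF le]) simp
    also have "\<dots> = ennreal D * Lnorm q {0<..<t} (\<lambda>u. wgt \<theta> q a u * k u)"
      using C(1) by (simp add: D_def ennreal_mult mult_ac)
    finally show ?thesis .
  qed
  moreover have "0 < D" using C(1) by (simp add: D_def)
  ultimately show ?thesis by blast
qed

lemma le_Lnorm_wgt_Ioo:
  assumes "0 < q" "potter_bounds a"
  shows "\<exists>C>0. \<forall>t>0. ennreal (a t) \<le> ennreal C * Lnorm q {0<..<t} (wgt 0 q a)"
  using le_Lnorm_wgt_quasi_concave[of q 0 a] assms quasi_concave_one
  by (auto dest!: spec[of _ "\<lambda>_. 1"])

lemma le_Lnorm_wgt_Ioi:
  assumes "0 < q" "potter_bounds a"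
  shows "\<exists>C>0. \<forall>t>0. ennreal (a t) \<le> ennreal C * Lnorm q {t<..} (wgt 0 q a)"
proof -
  obtain C where C: "0 < C" "\<And>s t. 0 < s \<Longrightarrow> s \<le> t \<Longrightarrow> a s \<le> C * (t / s) powr 1 * a t"
    using potter_boundsE[OF assms(2), of 1] by (metis zero_less_one)
  define D where "D = 2 * C * 2 powr rexp q"
  have "ennreal (a t) \<le> ennreal D * Lnorm q {t<..} (wgt 0 q a)" if t: "0 < t" for t
  proof -
    have at: "0 < a t" using t assms by (simp add: potter_pos)
    have "ennreal ((2 * t) powr (- rexp q) * a t) * ennreal ((2 * t - t) powr rexp q)
       \<le> Lnorm q {t<..} (\<lambda>u. ennreal (2 * C) * wgt 0 q a u)"
    proof (rule Lnorm_ge_const)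
      fix u assume "t < u" "u < 2 * t"
      then have u: "0 < u" "t \<le> u" "u \<le> 2 * t" using t by auto
      have "(2 * t) powr (- rexp q) * a t \<le> u powr (- rexp q) * (2 * C * a u)"
      proof (intro mult_mono)
        show "(2 * t) powr (- rexp q) \<le> u powr (- rexp q)"
          using u by (intro powr_mono2') auto
        have "a t \<le> C * (u / t) * a u" using C(2)[OF t u(2)] u t by simp
        also have "\<dots> \<le> C * 2 * a u"
          using u t C potter_pos[OF assms(2) u(1)] by (intro mult_mono) (auto simp: field_simps)
        finally show "a t \<le> 2 * C * a u" by simp
      qed (use at in auto)
      then show "ennreal ((2 * t) powr (- rexp q) * a t) \<le> ennreal (2 * C) * wgt 0 q a u"
        using C(1) potter_pos[OF assms(2) u(1)]
            by (simp add: wgt_def mult_ac ennreal_leI flip: ennreal_mult)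
    qed (use t assms in auto)
    also have "\<dots> = ennreal (2 * C) * Lnorm q {t<..} (wgt 0 q a)"
      using assms t measurable_wgt by (intro Lnorm_cmult_halfline) auto
    finally have le: "ennreal ((2 * t) powr (- rexp q) * a t) * ennreal (t powr rexp q)
       \<le> ennreal (2 * C) * Lnorm q {t<..} (wgt 0 q a)" by simp
    have "a t = 2 powr rexp q * (((2 * t) powr (- rexp q) * a t) * t powr rexp q)"
      using t by (simp add: powr_mult powr_minus)
    then have "ennreal (a t) = ennreal (2 powr rexp q) * (ennreal ((2 * t) powr
        (- rexp q) * a t) * ennreal (t powr rexp q))"
      using at by (metis (no_types, lifting) ennreal_mult' ennreal_mult'' powr_ge_zero)
    also have "\<dots> \<le> ennreal (2 powr rexp q) * (ennreal (2 * C) * Lnorm q {t<..} (wgt 0 q a))"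
      by (rule mult_left_mono[OF le]) simp
    also have "\<dots> = ennreal D * Lnorm q {t<..} (wgt 0 q a)"
      using C(1) by (simp add: D_def ennreal_mult mult_ac)
    finally show ?thesis .
  qed
  moreover have "0 < D" using C(1) by (simp add: D_def)
  ultimately show ?thesis by blast
qed

text \<open>
  Going from \<open>t\<close> down to \<open>s\<close> adds only the norm over \<open>(s, t)\<close>. There \<open>a(u)\<close> is at most a multiple of
  \<open>(t / u) powr \<epsilon> * a(t)\<close>, whose norm is of order \<open>(t / s) powr \<epsilon> * a(t)\<close>, and \<open>a(t)\<close> is controlled by the norm
  over \<open>(t, 2t)\<close>. Together with the obvious monotonicity this is slow variation of the tail norm.
\<close>

lemma Lnorm_wgt_Ioi_quasi_antimono:
  assumes "0 < q" "potter_bounds a" "0 < \<epsilon>"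
  obtains C where "0 < C" "\<And>s t. 0 < s \<Longrightarrow> s \<le> t \<Longrightarrow>
      Lnorm q {s<..} (wgt 0 q a) \<le> ennreal (C * (t / s) powr \<epsilon>) * Lnorm q {t<..} (wgt 0 q a)"
proof -
  let ?B = "\<lambda>t. Lnorm q {t<..} (wgt 0 q a)"
  obtain C1 where C1: "0 < C1" "\<And>s t. 0 < s \<Longrightarrow> s \<le> t \<Longrightarrow> a s \<le> C1 * (t / s) powr \<epsilon> * a t"
    using potter_boundsE[OF assms(2,3)] by metis
  obtain C2 where C2: "0 < C2" "\<And>t. 0 < t \<Longrightarrow>
      Lnorm q {t<..} (\<lambda>u. ennreal (u powr (- \<epsilon> - rexp q))) \<le> ennreal (C2 * t powr (- \<epsilon>))"
    using Lnorm_powr_Ioi[OF assms(1,3)] by metis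
  obtain C3 where C3: "0 < C3" "\<And>t. 0 < t \<Longrightarrow> ennreal (a t) \<le> ennreal C3 * ?B t"
    using le_Lnorm_wgt_Ioi[OF assms(1,2)] by metis
  define D where "D = 2 powr rexp q"
  have D: "0 < D" by (simp add: D_def)
  show thesis
  proof (rule that)
    show "0 < D * (C1 * C2 * C3 + 1)" using D C1(1) C2(1) C3(1) by (simp add: add_pos_pos)
    fix s t :: real assume st: "0 < s" "s \<le> t"
    define Q where "Q = (t / s) powr \<epsilon>"
    have Q: "1 \<le> Q" using st assms(3) by (simp add: Q_def ge_one_powr_ge_zero)
    have t: "0 < t" using st by simp
    have at: "0 < a t" using potter_pos[OF assms(2) t] .
    have "Lnorm q {s<..<t} (wgt 0 q a)
        \<le> Lnorm q {s<..} (\<lambda>u. ennreal (C1 * t powr \<epsilon> * a t) * ennreal (u powr (- \<epsilon> - rexp q)))"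
    proof (rule Lnorm_mono_halfline)
      fix u assume "u \<in> {s<..<t}"
      then have u: "0 < u" "u \<le> t" using st by auto
      have "u powr (- rexp q) * a u \<le> u powr (- rexp q) * (C1 * (t / u) powr \<epsilon> * a t)"
        using C1(2)[OF u] by (intro mult_left_mono) auto
      also have "\<dots> = (C1 * t powr \<epsilon> * a t) * u powr (- \<epsilon> - rexp q)"
        using u t by (simp add: powr_divide powr_diff powr_minus field_simps)
      finally show "wgt 0 q a u \<le> ennreal (C1 * t powr \<epsilon> * a t) * ennreal (u powr (- \<epsilon> - rexp q))"
        using C1(1) at by (simp add: wgt_def ennreal_leI flip: ennreal_mult)
    qed (use st assms measurable_wgt in auto)
    also have "\<dots> \<le> ennreal (C1 * t powr \<epsilon> * a t) * ennreal (C2 * s powr (- \<epsilon>))"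
      using C2(2)[OF st(1)] assms st measurable_ennreal_powr
          by (subst Lnorm_cmult_halfline) (auto intro: mult_left_mono)
    also have "\<dots> = ennreal (C1 * C2 * Q) * ennreal (a t)"
      using C1(1) C2(1) st t at by (simp add: Q_def powr_divide powr_minus field_simps flip: ennreal_mult)
    also have "\<dots> \<le> ennreal (C1 * C2 * Q) * (ennreal C3 * ?B t)"
      by (intro mult_left_mono C3 t) simp
    also have "\<dots> = ennreal (C1 * C2 * C3 * Q) * ?B t"
      using C1(1) C2(1) C3(1) Q by (simp add: ennreal_mult mult_ac)
    finally have 1: "Lnorm q {s<..<t} (wgt 0 q a) \<le> ennreal (C1 * C2 * C3 * Q) * ?B t" .
    have 2: "?B t \<le> ennreal Q * ?B t"
      using mult_right_mono[of 1 "ennreal Q" "?B t"] Q by simp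
    have "?B s \<le> ennreal D * (Lnorm q {s<..<t} (wgt 0 q a) + ?B t)"
      unfolding D_def by (rule Lnorm_split[where t=t]) (use st assms measurable_wgt in auto)
    also have "\<dots> \<le> ennreal D * (ennreal (C1 * C2 * C3 * Q) * ?B t + ennreal Q * ?B t)"
      by (intro mult_left_mono add_mono 1 2) simp
    also have "\<dots> = ennreal (D * (C1 * C2 * C3 + 1) * Q) * ?B t"
      using C1(1) C2(1) C3(1) Q D by
          (simp add: ennreal_mult ennreal_plus distrib_right distrib_left mult_ac)
    finally show "?B s \<le> ennreal (D * (C1 * C2 * C3 + 1) * (t / s) powr \<epsilon>) * ?B t"
      by (simp add: Q_def)
  qed
qed

text \<open>
  The same argument for the norms over \<open>(0, t)\<close>.
\<close>

lemma Lnorm_wgt_Ioo_quasi_mono: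
  assumes "0 < q" "potter_bounds a" "0 < \<epsilon>"
  obtains C where "0 < C" "\<And>s t. 0 < s \<Longrightarrow> s \<le> t \<Longrightarrow>
      Lnorm q {0<..<t} (wgt 0 q a) \<le> ennreal (C * (t / s) powr \<epsilon>) * Lnorm q {0<..<s} (wgt 0 q a)"
proof -
  let ?A = "\<lambda>t. Lnorm q {0<..<t} (wgt 0 q a)"
  obtain C1 where C1: "0 < C1" "\<And>s t. 0 < s \<Longrightarrow> s \<le> t \<Longrightarrow> a t \<le> C1 * (t / s) powr \<epsilon> * a s"
    using potter_boundsE[OF assms(2,3)] by metis
  obtain C2 where C2: "0 < C2" "\<And>t. 0 < t \<Longrightarrow>
      Lnorm q {0<..<t} (\<lambda>u. ennreal (u powr (\<epsilon> - rexp q))) \<le> ennreal (C2 * t powr \<epsilon>)"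
    using Lnorm_powr_Ioo[OF assms(1,3)] by metis
  obtain C3 where C3: "0 < C3" "\<And>t. 0 < t \<Longrightarrow> ennreal (a t) \<le> ennreal C3 * ?A t"
    using le_Lnorm_wgt_Ioo[OF assms(1,2)] by metis
  define D where "D = 2 powr rexp q"
  have D: "0 < D" by (simp add: D_def)
  show thesis
  proof (rule that)
    show "0 < D * (1 + C1 * C2 * C3)" using D C1(1) C2(1) C3(1) by (simp add: add_pos_pos)
    fix s t :: real assume st: "0 < s" "s \<le> t"
    define Q where "Q = (t / s) powr \<epsilon>"
    have Q: "1 \<le> Q" using st assms(3) by (simp add: Q_def ge_one_powr_ge_zero)
    have t: "0 < t" using st by simp
    have as: "0 < a s" using potter_pos[OF assms(2) st(1)] .
    have "Lnorm q {s<..<t} (wgt 0 q a)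
        \<le> Lnorm q {0<..<t} (\<lambda>u. ennreal (C1 * s powr (- \<epsilon>) * a s) * ennreal (u powr (\<epsilon> - rexp q)))"
    proof (rule Lnorm_mono_halfline)
      fix u assume "u \<in> {s<..<t}"
      then have u: "0 < u" "s \<le> u" using st by auto
      have "u powr (- rexp q) * a u \<le> u powr (- rexp q) * (C1 * (u / s) powr \<epsilon> * a s)"
        using C1(2)[OF st(1) u(2)] by (intro mult_left_mono) auto
      also have "\<dots> = (C1 * s powr (- \<epsilon>) * a s) * u powr (\<epsilon> - rexp q)"
        using u st by (simp add: powr_divide powr_diff powr_minus field_simps)
      finally show "wgt 0 q a u \<le> ennreal (C1 * s powr (- \<epsilon>) * a s) * ennreal (u powr (\<epsilon> - rexp q))"
        using C1(1) as by (simp add: wgt_def ennreal_leI flip: ennreal_mult)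
    qed (use st assms measurable_wgt in auto)
    also have "\<dots> \<le> ennreal (C1 * s powr (- \<epsilon>) * a s) * ennreal (C2 * t powr \<epsilon>)"
      using C2(2)[OF t] assms st measurable_ennreal_powr
          by (subst Lnorm_cmult_halfline) (auto intro: mult_left_mono)
    also have "\<dots> = ennreal (C1 * C2 * Q) * ennreal (a s)"
      using C1(1) C2(1) st t as by (simp add: Q_def powr_divide powr_minus field_simps flip: ennreal_mult)
    also have "\<dots> \<le> ennreal (C1 * C2 * Q) * (ennreal C3 * ?A s)"
      by (intro mult_left_mono C3 st) simp
    also have "\<dots> = ennreal (C1 * C2 * C3 * Q) * ?A s"
      using C1(1) C2(1) C3(1) Q by (simp add: ennreal_mult mult_ac)
    finally have 1: "Lnorm q {s<..<t} (wgt 0 q a) \<le> ennreal (C1 * C2 * C3 * Q) * ?A s" .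
    have 2: "?A s \<le> ennreal Q * ?A s"
      using mult_right_mono[of 1 "ennreal Q" "?A s"] Q by simp
    have "?A t \<le> ennreal D * (?A s + Lnorm q {s<..<t} (wgt 0 q a))"
      unfolding D_def by (rule Lnorm_split[where t=s]) (use st assms measurable_wgt in auto)
    also have "\<dots> \<le> ennreal D * (ennreal Q * ?A s + ennreal (C1 * C2 * C3 * Q) * ?A s)"
      by (intro mult_left_mono add_mono 1 2) simp
    also have "\<dots> = ennreal (D * (1 + C1 * C2 * C3) * Q) * ?A s"
      using C1(1) C2(1) C3(1) Q D by
          (simp add: ennreal_mult ennreal_plus distrib_right distrib_left mult_ac)
    finally show "?A t \<le> ennreal (D * (1 + C1 * C2 * C3) * (t / s) powr \<epsilon>) * ?A s"
      by (simp add: Q_def)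
  qed
qed

section \<open>The K-functional of a quasi-normed couple\<close>

definition nonneg_norm :: "'v qspace \<Rightarrow> bool" where
  "nonneg_norm X \<longleftrightarrow> (\<forall>x\<in>qcarrier X. 0 \<le> qnorm X x)"

lemma quasi_normed_nonneg: "quasi_normed X \<Longrightarrow> nonneg_norm X"
  by (simp add: quasi_normed_def nonneg_norm_def)

lemma nonneg_LL_space: "nonneg_norm (LL_space A0 A1 \<theta> r b q a)"
  by (simp add: nonneg_norm_def LL_space_def)

lemma Kfun_le:
  assumes "nonneg_norm X0" "nonneg_norm X1" "0 \<le> t" "f0 \<in> qcarrier X0" "f1 \<in> qcarrier X1"
  shows "Kfun X0 X1 t (f0 + f1) \<le> qnorm X0 f0 + t * qnorm X1 f1"
  unfolding Kfun_def
  by (rule cInf_lower, use assms in blast, rule bdd_belowI[of _ 0])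
    (use assms in \<open>auto simp: nonneg_norm_def\<close>)

lemma Kfun_ge:
  assumes "f \<in> sum_space X0 X1"
    and "\<And>f0 f1. f0 \<in> qcarrier X0 \<Longrightarrow> f1 \<in> qcarrier X1 \<Longrightarrow> f = f0 + f1 \<Longrightarrow> c \<le> qnorm X0 f0 + t * qnorm X1 f1"
  shows "c \<le> Kfun X0 X1 t f"
  unfolding Kfun_def
  by (rule cInf_greatest) (use assms in \<open>auto simp: sum_space_def\<close>)

lemma Kfun_lessE:
  assumes "f \<in> sum_space X0 X1" "Kfun X0 X1 t f < x"
  obtains f0 f1 where "f0 \<in> qcarrier X0" "f1 \<in> qcarrier X1" "f = f0 + f1"
      "qnorm X0 f0 + t * qnorm X1 f1 < x"
proof -
  let ?S = "{qnorm X0 f0 + t * qnorm X1 f1 | f0 f1. f0 \<in> qcarrier X0 \<and> f1 \<in> qcarrier X1 \<and> f = f0 + f1}"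
  have "?S \<noteq> {}" using assms by (auto simp: sum_space_def)
  from cInf_lessD[OF this assms(2)[unfolded Kfun_def]] that show thesis by blast
qed

lemma Kfun_nonneg:
  assumes "nonneg_norm X0" "nonneg_norm X1" "0 \<le> t" "f \<in> sum_space X0 X1"
  shows "0 \<le> Kfun X0 X1 t f"
  by (rule Kfun_ge[OF assms(4)]) (use assms in \<open>auto simp: nonneg_norm_def\<close>)

lemma Kfun_mono:
  assumes X: "nonneg_norm X0" "nonneg_norm X1" and f: "f \<in> sum_space X0 X1" and u: "0 \<le> u" "u \<le> v"
  shows "Kfun X0 X1 u f \<le> Kfun X0 X1 v f"
proof (rule Kfun_ge[OF f])
  fix f0 f1 assume *: "f0 \<in> qcarrier X0" "f1 \<in> qcarrier X1" "f = f0 + f1"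
  have "Kfun X0 X1 u f \<le> qnorm X0 f0 + u * qnorm X1 f1"
    using Kfun_le[OF X u(1)] * by simp
  also have "\<dots> \<le> qnorm X0 f0 + v * qnorm X1 f1"
    using u X * by (auto simp: nonneg_norm_def intro: mult_right_mono)
  finally show "Kfun X0 X1 u f \<le> qnorm X0 f0 + v * qnorm X1 f1" .
qed

text \<open>
  The quotient \<open>K(u, f) / u\<close> is the infimum of the decreasing functions \<open>norm f0 / u + norm f1\<close>.
\<close>

lemma Kfun_div_antimono:
  assumes X: "nonneg_norm X0" "nonneg_norm X1" and f: "f \<in> sum_space X0 X1" and u: "0 < u" "u \<le> v"
  shows "u * Kfun X0 X1 v f \<le> v * Kfun X0 X1 u f"
proof -
  have "u * Kfun X0 X1 v f / v \<le> Kfun X0 X1 u f"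
  proof (rule Kfun_ge[OF f])
    fix f0 f1 assume *: "f0 \<in> qcarrier X0" "f1 \<in> qcarrier X1" "f = f0 + f1"
    have "u * Kfun X0 X1 v f \<le> u * (qnorm X0 f0 + v * qnorm X1 f1)"
      using Kfun_le[OF X, of v f0 f1] * u by (intro mult_left_mono) auto
    also have "\<dots> = u * qnorm X0 f0 + v * (u * qnorm X1 f1)" by (simp add: algebra_simps)
    also have "\<dots> \<le> v * qnorm X0 f0 + v * (u * qnorm X1 f1)"
      using u X * by (auto simp: nonneg_norm_def intro: mult_right_mono)
    finally show "u * Kfun X0 X1 v f / v \<le> qnorm X0 f0 + u * qnorm X1 f1"
      using u by (simp add: field_simps)
  qed
  with u show ?thesis by (simp add: field_simps)
qed

lemma quasi_concave_Kfun:
  assumes "nonneg_norm X0" "nonneg_norm X1" "f \<in> sum_space X0 X1"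
  shows "quasi_concave (\<lambda>u. ennreal (Kfun X0 X1 u f))"
  unfolding quasi_concave_def
proof (intro allI impI conjI)
  fix u v :: real assume uv: "0 < u" "u \<le> v"
  show "ennreal (Kfun X0 X1 u f) \<le> ennreal (Kfun X0 X1 v f)"
    using Kfun_mono[OF assms] uv by (simp add: ennreal_leI)
  show "ennreal u * ennreal (Kfun X0 X1 v f) \<le> ennreal v * ennreal (Kfun X0 X1 u f)"
    using Kfun_div_antimono[OF assms uv] Kfun_nonneg[OF assms(1,2) _ assms(3)] uv
    by (simp add: ennreal_leI flip: ennreal_mult)
qed

locale quasi_couple =
  fixes A0 A1 :: "'v::real_vector qspace"
  assumes A0: "quasi_normed A0" and A1: "quasi_normed A1"
begin

lemmas nonneg = quasi_normed_nonneg[OF A0] quasi_normed_nonneg[OF A1]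

lemma subspace: "subspace (qcarrier A0)" "subspace (qcarrier A1)"
  using A0 A1 by (simp_all add: quasi_normed_def)

lemma qnorm_zero: "qnorm A0 0 = 0" "qnorm A1 0 = 0"
  using A0 A1 subspace_0[OF subspace(1)] subspace_0[OF subspace(2)] by (simp_all add: quasi_normed_def)

lemma qnorm_uminus:
  "f \<in> qcarrier A0 \<Longrightarrow> qnorm A0 (- f) = qnorm A0 f"
  "f \<in> qcarrier A1 \<Longrightarrow> qnorm A1 (- f) = qnorm A1 f"
  using A0 A1 by (auto simp: quasi_normed_def dest!: bspec[of _ _ f] spec[of _ "-1::real"])

abbreviation K :: "real \<Rightarrow> 'v \<Rightarrow> real" where "K \<equiv> Kfun A0 A1"

lemma sum_spaceI: "f0 \<in> qcarrier A0 \<Longrightarrow> f1 \<in> qcarrier A1 \<Longrightarrow> f0 + f1 \<in> sum_space A0 A1"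
  by (auto simp: sum_space_def)

lemma carrier_sum_space: "f \<in> qcarrier A0 \<Longrightarrow> f \<in> sum_space A0 A1" "f \<in> qcarrier A1 \<Longrightarrow> f \<in> sum_space A0 A1"
  using sum_spaceI[of f 0] sum_spaceI[of 0 f] subspace_0[OF subspace(1)] subspace_0[OF subspace(2)]
      by simp_all

lemma sum_space_add:
  assumes "f \<in> sum_space A0 A1" "g \<in> sum_space A0 A1"
  shows "f + g \<in> sum_space A0 A1"
proof -
  obtain f0 f1 g0 g1 where "f0 \<in> qcarrier A0" "f1 \<in> qcarrier A1" "f = f0 + f1" "g0 \<in> qcarrier A0"
      "g1 \<in> qcarrier A1" "g = g0 + g1"
    using assms by (auto simp: sum_space_def)
  then show ?thesis
    using sum_spaceI[of "f0 + g0" "f1 + g1"] subspace_add[OF subspace(1)] subspace_add[OF subspace(2)]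
    by (simp add: add_ac)
qed

lemma K_le_qnorm:
  assumes "0 \<le> u"
  shows "f \<in> qcarrier A0 \<Longrightarrow> K u f \<le> qnorm A0 f" "f \<in> qcarrier A1 \<Longrightarrow> K u f \<le> u * qnorm A1 f"
  using Kfun_le[OF nonneg assms, of f 0] Kfun_le[OF nonneg assms, of 0 f] 
    subspace_0[OF subspace(1)] subspace_0[OF subspace(2)] by (simp_all add: qnorm_zero)

lemma K_zero: "0 \<le> u \<Longrightarrow> K u 0 = 0"
  using K_le_qnorm(1)[of u 0] Kfun_nonneg[OF nonneg, of u 0] subspace_0[OF subspace(1)] carrier_sum_space(1)[of 0]
  by (simp add: qnorm_zero)

text \<open>
  The infima over the decompositions of \<open>f\<close> and of \<open>g\<close> are taken one after the other, so that nearly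
  optimal decompositions are not needed.
\<close>

lemma K_quasi_triangle:
  obtains c where "1 \<le> c" "\<And>f g u. f \<in> sum_space A0 A1 \<Longrightarrow> g \<in> sum_space A0 A1 \<Longrightarrow> 0 < u \<Longrightarrow>
      K u (f + g) \<le> c * (K u f + K u g)"
proof -
  obtain c0 where c0: "1 \<le> c0" "\<And>x y. x\<in>qcarrier A0 \<Longrightarrow> y\<in>qcarrier A0 \<Longrightarrow>
      qnorm A0 (x + y) \<le> c0 * (qnorm A0 x + qnorm A0 y)"
    using A0 unfolding quasi_normed_def by auto
  obtain c1 where c1: "1 \<le> c1" "\<And>x y. x\<in>qcarrier A1 \<Longrightarrow> y\<in>qcarrier A1 \<Longrightarrow>
      qnorm A1 (x + y) \<le> c1 * (qnorm A1 x + qnorm A1 y)"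
    using A1 unfolding quasi_normed_def by auto
  define c where "c = max c0 c1"
  have c: "1 \<le> c" "c0 \<le> c" "c1 \<le> c" using c0 c1 by (auto simp: c_def)
  have "K u (f + g) \<le> c * (K u f + K u g)"
    if f: "f \<in> sum_space A0 A1" and g: "g \<in> sum_space A0 A1" and u: "0 < u" for f g u
  proof -
    have "K u (f + g) / c - K u f \<le> K u g"
    proof (rule Kfun_ge[OF g])
      fix g0 g1 assume g: "g0 \<in> qcarrier A0" "g1 \<in> qcarrier A1" "g = g0 + g1"
      have "K u (f + g) / c - (qnorm A0 g0 + u * qnorm A1 g1) \<le> K u f"
      proof (rule Kfun_ge[OF f])
        fix f0 f1 assume f: "f0 \<in> qcarrier A0" "f1 \<in> qcarrier A1" "f = f0 + f1"
        have n: "0 \<le> qnorm A0 f0" "0 \<le> qnorm A0 g0" "0 \<le> qnorm A1 f1" "0 \<le> qnorm A1 g1"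
          using nonneg f g by (auto simp: nonneg_norm_def)
        have fg: "f + g = (f0 + g0) + (f1 + g1)" using f g by (simp add: add_ac)
        have "K u (f + g) \<le> qnorm A0 (f0 + g0) + u * qnorm A1 (f1 + g1)"
          unfolding fg using Kfun_le[OF nonneg, of u "f0 + g0" "f1 + g1"] u f g
            subspace_add[OF subspace(1)] subspace_add[OF subspace(2)] by simp
        also have "\<dots> \<le> c * (qnorm A0 f0 + qnorm A0 g0) + u * (c * (qnorm A1 f1 + qnorm A1 g1))"
        proof (intro add_mono mult_left_mono)
          show "qnorm A0 (f0 + g0) \<le> c * (qnorm A0 f0 + qnorm A0 g0)"
            using c0(2)[of f0 g0] f g n c by (meson add_nonneg_nonneg mult_right_mono order_trans)
          show "qnorm A1 (f1 + g1) \<le> c * (qnorm A1 f1 + qnorm A1 g1)"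
            using c1(2)[of f1 g1] f g n c by (meson add_nonneg_nonneg mult_right_mono order_trans)
        qed (use u in auto)
        finally show "K u (f + g) / c - (qnorm A0 g0 + u * qnorm A1 g1) \<le> qnorm A0 f0 + u * qnorm A1 f1"
          using c by (simp add: field_simps)
      qed
      then show "K u (f + g) / c - K u f \<le> qnorm A0 g0 + u * qnorm A1 g1" by simp
    qed
    then show ?thesis using c by (simp add: field_simps)
  qed
  with c that show thesis by blast
qed

text \<open>
  Take a decomposition with \<open>norm f0 + t * norm f1 \<le> 2 * K(t, f)\<close>; this needs \<open>K(t, f) > 0\<close>. Its parts satisfy
  the trivial bounds \<open>K(u, f0) \<le> 2 * K(t, f)\<close> and \<open>K(u, f1) \<le> 2 * u * K(t, f) / t\<close>. On the other side of \<open>t\<close> the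
  quasi-triangle inequality turns the trivial bound for one part into a bound for the other part by
  \<open>K(u, f)\<close>.
\<close>

lemma near_optimal_decomposition:
  obtains c where "1 \<le> c"
    "\<And>f t. f \<in> sum_space A0 A1 \<Longrightarrow> 0 < t \<Longrightarrow> 0 < K t f \<Longrightarrow>
      \<exists>f0\<in>qcarrier A0. \<exists>f1\<in>qcarrier A1. f = f0 + f1 \<and>
        (\<forall>u>0. K u f0 \<le> c * K (min u t) f \<and> t * K u f1 \<le> c * (min u t * K (max u t) f))"
proof -
  obtain d where d: "1 \<le> d" "\<And>f g u. f \<in> sum_space A0 A1 \<Longrightarrow> g \<in> sum_space A0 A1 \<Longrightarrow> 0 < u \<Longrightarrow>
      K u (f + g) \<le> d * (K u f + K u g)"
    using K_quasi_triangle by blast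
  have "\<exists>f0\<in>qcarrier A0. \<exists>f1\<in>qcarrier A1. f = f0 + f1 \<and>
        (\<forall>u>0. K u f0 \<le> (3 * d) * K (min u t) f \<and> t * K u f1 \<le> (3 * d) * (min u t * K (max u t) f))"
    if f: "f \<in> sum_space A0 A1" and t: "0 < t" and K: "0 < K t f" for f t
  proof -
    obtain f0 f1 where f0: "f0 \<in> qcarrier A0" and f1: "f1 \<in> qcarrier A1" and eq: "f = f0 + f1"
      and less: "qnorm A0 f0 + t * qnorm A1 f1 < 2 * K t f"
      using Kfun_lessE[OF f, of t "2 * K t f"] K by auto
    have n: "0 \<le> qnorm A0 f0" "0 \<le> t * qnorm A1 f1"
      using nonneg f0 f1 t by (auto simp: nonneg_norm_def)
    have K0: "K u f0 \<le> 2 * K t f" if "0 < u" for u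
      using K_le_qnorm(1)[of u f0] f0 that less n by simp
    have K1: "t * K u f1 \<le> u * (2 * K t f)" "t * K u (- f1) \<le> u * (2 * K t f)" if "0 < u" for u
    proof -
      have neg: "- f1 \<in> qcarrier A1" using f1 subspace_neg[OF subspace(2)] by blast
      have "t * (u * qnorm A1 f1) \<le> u * (2 * K t f)"
        using less n that by (simp add: mult.left_commute mult_le_cancel_left_pos)
      moreover have "t * K u f1 \<le> t * (u * qnorm A1 f1)" "t * K u (- f1) \<le> t * (u * qnorm A1 f1)"
        using K_le_qnorm(2)[of u f1] K_le_qnorm(2)[of u "- f1"] f1 neg qnorm_uminus(2)[OF f1] that t
        by (auto intro!: mult_left_mono)
      ultimately show "t * K u f1 \<le> u * (2 * K t f)" "t * K u (- f1) \<le> u * (2 * K t f)" by linarith+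
    qed
    have in_sum: "f0 \<in> sum_space A0 A1" "- f0 \<in> sum_space A0 A1" "f1 \<in> sum_space A0 A1"
        "- f1 \<in> sum_space A0 A1"
      using f0 f1 subspace_neg[OF subspace(1)] subspace_neg[OF subspace(2)] carrier_sum_space by blast+
    have Kn: "0 \<le> K u f" if "0 < u" for u using Kfun_nonneg[OF nonneg _ f] that by simp
    have near: "K u f0 \<le> (3 * d) * K u f" if u: "0 < u" "u \<le> t" for u
    proof -
      have "K u (f + - f1) \<le> d * (K u f + K u (- f1))"
        using d(2) f in_sum u by blast
      moreover have "t * K u (- f1) \<le> t * (2 * K u f)"
        using K1(2)[OF u(1)] Kfun_div_antimono[OF nonneg f u] by simp
      then have "K u (- f1) \<le> 2 * K u f" using t by (simp only: mult_le_cancel_left_pos)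
      then have "d * (K u f + K u (- f1)) \<le> d * (K u f + 2 * K u f)"
        using d(1) by (intro mult_left_mono) auto
      moreover have "f + - f1 = f0" using eq by simp
      ultimately show ?thesis by (simp add: algebra_simps)
    qed
    have far: "K u f1 \<le> (3 * d) * K u f" if u: "t \<le> u" for u
    proof -
      have "K u (f + - f0) \<le> d * (K u f + K u (- f0))"
        using d(2) f in_sum u t by force
      moreover have "K u (- f0) \<le> 2 * K u f"
      proof -
        have "K u (- f0) \<le> qnorm A0 (- f0)"
          using K_le_qnorm(1)[of u "- f0"] u t f0 subspace_neg[OF subspace(1)] by simp
        also have "\<dots> \<le> 2 * K t f" using less n qnorm_uminus(1)[OF f0] by simp
        also have "\<dots> \<le> 2 * K u f" using Kfun_mono[OF nonneg f] t u by simp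
        finally show ?thesis .
      qed
      then have "d * (K u f + K u (- f0)) \<le> d * (K u f + 2 * K u f)"
        using d(1) by (intro mult_left_mono) auto
      moreover have "f + - f0 = f1" using eq by simp
      ultimately show ?thesis by (simp add: algebra_simps)
    qed
    have le: "2 * x \<le> (3 * d) * x" if "0 \<le> x" for x using d(1) that by (intro mult_right_mono) auto
    have K1': "t * K u f1 \<le> (3 * d) * (u * K t f)" if "0 < u" for u
    proof -
      have "t * K u f1 \<le> 2 * (u * K t f)" using K1(1)[OF that] by (simp add: mult_ac)
      also have "\<dots> \<le> (3 * d) * (u * K t f)" using that K by (intro le) simp
      finally show ?thesis .
    qed
    have K0': "K u f0 \<le> (3 * d) * K t f" if "t \<le> u" for u
      using K0[of u] le[of "K t f"] that K t by linarith
    have far': "t * K u f1 \<le> (3 * d) * (t * K u f)" if "t \<le> u" for u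
      using mult_left_mono[OF far[OF that], of t] t by (simp add: mult_ac)
    have "K u f0 \<le> (3 * d) * K (min u t) f
        \<and> t * K u f1 \<le> (3 * d) * (min u t * K (max u t) f)" if u: "0 < u" for u
    proof (cases "u \<le> t")
      case True
      then show ?thesis using near[OF u True] K1'[OF u] by (simp add: min_absorb1 max_absorb2)
    next
      case False
      then show ?thesis using K0'[of u] far'[of u] by (simp add: min_absorb2 max_absorb1)
    qed
    then show ?thesis using f0 f1 eq by blast
  qed
  moreover have "1 \<le> 3 * d" using d(1) by simp
  ultimately show thesis using that by blast
qed

end

section \<open>The norm of one limiting space as a functional of a quasi-concave function\<close>

text \<open>
  Norms of an arbitrary function \<open>k\<close> in place of \<open>K(\<cdot>, f)\<close>: \<open>E J k\<close> is the inner norm over \<open>J\<close>, and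
  \<open>nested J x k\<close> is the outer norm over \<open>s\<close> in \<open>J\<close> of the inner norms over \<open>(x, s)\<close>. The norm of the limiting
  space is \<open>nested {0<..} 0\<close>; the terms of the theorem are \<open>nested {0<..<t} 0\<close>, \<open>B t * E {0<..<t} k\<close> and
  \<open>nested {t<..} t\<close>.
\<close>

locale LL_weight =
  fixes \<theta> :: real and r :: ennreal and b :: "real \<Rightarrow> real" and q :: ennreal and a :: "real \<Rightarrow> real"
  assumes r: "0 < r" and q: "0 < q" and a: "potter_bounds a" and b: "potter_bounds b" and \<theta>: "0 < \<theta>"
begin

abbreviation E :: "real set \<Rightarrow> (real \<Rightarrow> ennreal) \<Rightarrow> ennreal" where
  "E J k \<equiv> Lnorm q J (\<lambda>u. wgt \<theta> q a u * k u)"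

abbreviation B :: "real \<Rightarrow> ennreal" where
  "B t \<equiv> Lnorm r {t<..} (wgt 0 r b)"

abbreviation nested :: "real set \<Rightarrow> real \<Rightarrow> (real \<Rightarrow> ennreal) \<Rightarrow> ennreal" where
  "nested J x k \<equiv> Lnorm r J (\<lambda>s. wgt 0 r b s * E {x<..<s} k)"

lemma measurable_b: "halfline_measurable (wgt 0 r b)"
  by (rule measurable_wgt[OF b])

lemma measurable_E: "halfline_measurable k \<Longrightarrow> halfline_measurable (\<lambda>u. wgt \<theta> q a u * k u)"
  by (intro borel_measurable_times_ennreal measurable_wgt a)

lemma measurable_nested:
  "halfline_measurable k \<Longrightarrow> 0 \<le> x \<Longrightarrow> halfline_measurable (\<lambda>s. wgt 0 r b s * E {x<..<s} k)"
  by (intro borel_measurable_times_ennreal measurable_b Lnorm_nested_measurable measurable_E)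

lemma E_scaled_mono:
  assumes "I \<subseteq> J" "J \<subseteq> {0<..}" "open I" "open J" "halfline_measurable k" "halfline_measurable l"
    and "\<And>u. u \<in> I \<Longrightarrow> d * k u \<le> c * l u"
  shows "d * E I k \<le> c * E J l"
  by (rule Lnorm_scaled_mono) (use assms q measurable_E in \<open>auto intro: scaled_mult_left\<close>)

lemma nested_scaled_mono:
  assumes "I \<subseteq> J" "J \<subseteq> {0<..}" "open I" "open J" "halfline_measurable k" "halfline_measurable l"
      "0 \<le> y" "y \<le> x"
    and "\<And>u s. s \<in> I \<Longrightarrow> x < u \<Longrightarrow> u < s \<Longrightarrow> d * k u \<le> c * l u"
  shows "d * nested I x k \<le> c * nested J y l"
proof (rule Lnorm_scaled_mono)
  fix s assume s: "s \<in> I"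
  show "d * (wgt 0 r b s * E {x<..<s} k) \<le> c * (wgt 0 r b s * E {y<..<s} l)"
    by (rule scaled_mult_left, rule E_scaled_mono) (use assms s in auto)
qed (use assms r measurable_nested in auto)

lemma E_add_le:
  obtains C where "C < \<infinity>" "\<And>J k l. open J \<Longrightarrow> J \<subseteq> {0<..} \<Longrightarrow> halfline_measurable k \<Longrightarrow> halfline_measurable l \<Longrightarrow>
    E J (\<lambda>u. k u + l u) \<le> C * (E J k + E J l)"
proof (rule that)
  show "ennreal (2 * 2 powr rexp q) < \<infinity>" by simp
  fix J :: "real set" and k l assume "open J" "J \<subseteq> {0<..}" "halfline_measurable k"
      "halfline_measurable l"
  then show "E J (\<lambda>u. k u + l u) \<le> ennreal (2 * 2 powr rexp q) * (E J k + E J l)"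
    unfolding distrib_left[of _ "k _"] by (intro Lnorm_add_le q measurable_E)
qed

lemma nested_add_le:
  obtains C where "C < \<infinity>" "\<And>J x k l. open J \<Longrightarrow> J \<subseteq> {0<..} \<Longrightarrow> halfline_measurable k \<Longrightarrow>
      halfline_measurable l \<Longrightarrow>
    0 \<le> x \<Longrightarrow> nested J x (\<lambda>u. k u + l u) \<le> C * (nested J x k + nested J x l)"
proof -
  obtain C where C: "C < \<infinity>" "\<And>J k l. open J \<Longrightarrow> J \<subseteq> {0<..} \<Longrightarrow> halfline_measurable k \<Longrightarrow>
      halfline_measurable l \<Longrightarrow>
    E J (\<lambda>u. k u + l u) \<le> C * (E J k + E J l)"
    using E_add_le by blast
  let ?D = "ennreal (2 * 2 powr rexp r)"
  show thesis
  proof (rule that)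
    show "C * ?D < \<infinity>" using C(1) by (simp add: ennreal_mult_less_top)
    fix J :: "real set" and x :: real and k l assume *: "open J" "J \<subseteq> {0<..}"
        "halfline_measurable k" "halfline_measurable l" "0 \<le> x"
    have m: "halfline_measurable (\<lambda>u. k u + l u)" using * by (intro borel_measurable_add)
    have "1 * nested J x (\<lambda>u. k u + l u)
        \<le> C * Lnorm r J (\<lambda>s. wgt 0 r b s * E {x<..<s} k + wgt 0 r b s * E {x<..<s} l)"
    proof (rule Lnorm_scaled_mono)
      fix s assume "s \<in> J"
      then have "E {x<..<s} (\<lambda>u. k u + l u) \<le> C * (E {x<..<s} k + E {x<..<s} l)"
        using * by (intro C) auto
      then show "1 * (wgt 0 r b s * E {x<..<s} (\<lambda>u. k u + l u))
          \<le> C * (wgt 0 r b s * E {x<..<s} k + wgt 0 r b s * E {x<..<s} l)"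
        unfolding distrib_left[symmetric] by (intro scaled_mult_left) simp
    qed (use * r m measurable_nested in \<open>auto intro!: borel_measurable_add\<close>)
    also have "\<dots> \<le> C * (?D * (nested J x k + nested J x l))"
      by (intro mult_left_mono Lnorm_add_le r measurable_nested) (use * in auto)
    finally show "nested J x (\<lambda>u. k u + l u) \<le> C * ?D * (nested J x k + nested J x l)"
      by (simp add: mult.assoc)
  qed
qed

lemma B_mult: "Lnorm r {t<..} (\<lambda>s. wgt 0 r b s * c) = B t * c" if "0 < t"
proof -
  have "Lnorm r {t<..} (\<lambda>s. c * wgt 0 r b s) = c * B t"
    by (rule Lnorm_cmult_halfline) (use that r measurable_b in auto)
  then show ?thesis by (simp add: mult.commute)
qed

text \<open>
  For \<open>s > t\<close> the inner norm over \<open>(0, s)\<close> contains the one over \<open>(0, t)\<close>, which is constant in \<open>s\<close>.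
\<close>

lemma B_E_le_total:
  assumes "0 < t" "halfline_measurable k"
  shows "B t * E {0<..<t} k \<le> nested {0<..} 0 k"
proof -
  have "B t * E {0<..<t} k = Lnorm r {t<..} (\<lambda>s. wgt 0 r b s * E {0<..<t} k)"
    by (rule B_mult[symmetric, OF assms(1)])
  also have "\<dots> \<le> nested {0<..} 0 k"
  proof (rule Lnorm_mono_halfline)
    fix s assume "s \<in> {t<..}"
    then show "wgt 0 r b s * E {0<..<t} k \<le> wgt 0 r b s * E {0<..<s} k"
      by (intro mult_left_mono Lnorm_mono_halfline measurable_E) (use assms in auto)
  qed (use assms in \<open>auto intro!: borel_measurable_times_ennreal measurable_b\<close>)
  finally show ?thesis .
qed

lemma nested_le_total:
  assumes "open J" "J \<subseteq> {0<..}" "halfline_measurable k" "0 \<le> x"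
  shows "nested J x k \<le> nested {0<..} 0 k"
  using nested_scaled_mono[of J "{0<..}" k k 0 x 1 1] assms by auto

text \<open>
  The outer norm is split at \<open>t\<close>; for \<open>s > t\<close> the inner norm is split there as well.
\<close>

lemma total_le:
  obtains C where "C < \<infinity>" "\<And>k t. halfline_measurable k \<Longrightarrow> 0 < t \<Longrightarrow>
    nested {0<..} 0 k \<le> C * (nested {0<..<t} 0 k + B t * E {0<..<t} k + nested {t<..} t k)"
proof -
  let ?D = "ennreal (2 powr rexp r)" and ?F = "ennreal (2 powr rexp q)"
      and ?G = "ennreal (2 * 2 powr rexp r)"
  show thesis
  proof (rule that)
    show "?D * (1 + ?F * ?G) < \<infinity>" by (simp add: ennreal_mult_less_top)
    fix k t assume k: "halfline_measurable k" and t: "0 < (t::real)"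
    let ?N = "nested {0<..<t} 0 k" and ?M = "B t * E {0<..<t} k + nested {t<..} t k"
    have split: "nested {0<..} 0 k \<le> ?D * (?N + nested {t<..} 0 k)"
      by (rule Lnorm_split[where t=t]) (use t r k measurable_nested in auto)
    have "1 * nested {t<..} 0 k \<le> ?F * Lnorm r {t<..} (\<lambda>s. wgt 0 r b s * E {0<..<t} k
        + wgt 0 r b s * E {t<..<s} k)"
    proof (rule Lnorm_scaled_mono)
      fix s assume s: "s \<in> {t<..}"
      have "E {0<..<s} k \<le> ?F * (E {0<..<t} k + E {t<..<s} k)"
        by (rule Lnorm_split[where t=t]) (use s t q k measurable_E in auto)
      then show "1 * (wgt 0 r b s * E {0<..<s} k)
          \<le> ?F * (wgt 0 r b s * E {0<..<t} k + wgt 0 r b s * E {t<..<s} k)"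
        unfolding distrib_left[symmetric] by (intro scaled_mult_left) simp
    qed (use t k r measurable_nested measurable_b in \<open>auto intro!: borel_measurable_add borel_measurable_times_ennreal\<close>)
    also have "\<dots> \<le> ?F * (?G * (Lnorm r {t<..} (\<lambda>s. wgt 0 r b s * E {0<..<t} k) + nested {t<..} t k))"
      by (intro mult_left_mono Lnorm_add_le r measurable_nested borel_measurable_times_ennreal measurable_b)
        (use t k in auto)
    also have "\<dots> = ?F * ?G * ?M"
      using t by (simp add: B_mult mult.assoc)
    finally have "nested {t<..} 0 k \<le> ?F * ?G * ?M" by simp
    then have "?D * (?N + nested {t<..} 0 k) \<le> ?D * (?N + ?F * ?G * ?M)"
      by (intro mult_left_mono add_left_mono) simp_all
    with split have "nested {0<..} 0 k \<le> ?D * (?N + ?F * ?G * ?M)"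
      by (rule order_trans)
    also have "\<dots> \<le> ?D * ((1 + ?F * ?G) * (?N + ?M))"
      by (intro mult_left_mono) (simp_all add: distrib_left distrib_right add_ac add_increasing add_increasing2)
    finally show "nested {0<..} 0 k \<le> ?D * (1 + ?F * ?G) * (?N + B t * E {0<..<t} k + nested {t<..} t k)"
      by (simp add: mult.assoc add.assoc)
  qed
qed

lemma E_lower:
  obtains C where "C < \<infinity>" "\<And>k t. quasi_concave k \<Longrightarrow> 0 < t \<Longrightarrow>
    ennreal (t powr (- \<theta>) * a t) * k t \<le> C * E {0<..<t} k"
  using le_Lnorm_wgt_quasi_concave[OF q _ a, of \<theta>] \<theta> ennreal_less_top
      by (metis infinity_ennreal_def less_imp_le)

text \<open>
  The norm of the first part of an optimal decomposition. Beyond \<open>t\<close> the function \<open>l\<close> is at most \<open>c * k(t)\<close>, so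
  its inner norm over \<open>(t, s)\<close> is of order \<open>t powr -\<theta> * a(t) * k(t)\<close>, uniformly in \<open>s\<close>; here \<open>\<theta> > 0\<close> is
  essential. By \<open>E_lower\<close> this is no more than the inner norm of \<open>k\<close> over \<open>(0, t)\<close>.
\<close>

lemma total_le_of_saturating:
  assumes "c < \<infinity>"
  obtains C where "C < \<infinity>" "\<And>k l t. quasi_concave k \<Longrightarrow> halfline_measurable l \<Longrightarrow> 0 < t \<Longrightarrow>
     (\<forall>u>0. l u \<le> c * k (min u t)) \<Longrightarrow>
     nested {0<..} 0 l \<le> C * (nested {0<..<t} 0 k + B t * E {0<..<t} k)"
proof -
  obtain C1 where C1: "C1 < \<infinity>" "\<And>k t. halfline_measurable k \<Longrightarrow> 0 < t \<Longrightarrow>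
    nested {0<..} 0 k \<le> C1 * (nested {0<..<t} 0 k + B t * E {0<..<t} k + nested {t<..} t k)"
    using total_le by blast
  obtain C2 where C2: "C2 < \<infinity>" "\<And>k t. quasi_concave k \<Longrightarrow> 0 < t \<Longrightarrow>
    ennreal (t powr (- \<theta>) * a t) * k t \<le> C2 * E {0<..<t} k"
    using E_lower by blast
  obtain C3 where C3: "0 < C3" "\<And>t. 0 < t \<Longrightarrow>
      Lnorm q {t<..} (wgt \<theta> q a) \<le> ennreal (C3 * t powr (- \<theta>) * a t)"
    using Lnorm_wgt_Ioi_le[OF q \<theta> a] by blast
  show thesis
  proof (rule that)
    show "C1 * (c + c * ennreal C3 * C2) < \<infinity>" using assms C1 C2 by (simp add: ennreal_mult_less_top)
    fix k l t assume k: "quasi_concave k" and l: "halfline_measurable l" and t: "0 < t"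
      and bound: "\<forall>u>0. l u \<le> c * k (min u t)"
    have le: "l u \<le> c * k u" if "0 < u" "u \<le> t" for u
      using bound[rule_format, of u] that by (simp add: min_absorb1)
    have le': "l u \<le> c * k t" if "t \<le> u" for u
      using bound[rule_format, of u] that t by (simp add: min_absorb2)
    note km = quasi_concave_measurable[OF k]
    let ?N = "nested {0<..<t} 0 k" and ?M = "B t * E {0<..<t} k"
    have sub: "{0<..<t} \<subseteq> {0<..}" by auto
    have 1: "nested {0<..<t} 0 l \<le> c * ?N"
      using nested_scaled_mono[of "{0<..<t}" "{0<..<t}" l k 0 0 1 c] km l le sub by simp
    have "E {0<..<t} l \<le> c * E {0<..<t} k"
      using E_scaled_mono[of "{0<..<t}" "{0<..<t}" l k 1 c] km l le sub by simp
    then have 2: "B t * E {0<..<t} l \<le> c * ?M"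
      using scaled_mult_left[of 1 _ c] by simp
    have inner: "E {t<..<s} l \<le> c * ennreal C3 * C2 * E {0<..<t} k" for s
    proof -
      have "1 * E {t<..<s} l \<le> (c * k t) * Lnorm q {t<..} (wgt \<theta> q a)"
      proof (rule Lnorm_scaled_mono)
        fix u assume "u \<in> {t<..<s}"
        then show "1 * (wgt \<theta> q a u * l u) \<le> (c * k t) * wgt \<theta> q a u"
          using mult_left_mono[OF le'[of u], of "wgt \<theta> q a u"] by (simp add: mult_ac)
      qed (use t q l a in \<open>auto intro!: measurable_E measurable_wgt\<close>)
      also have "\<dots> \<le> (c * k t) * ennreal (C3 * t powr (- \<theta>) * a t)"
        by (intro mult_left_mono C3 t) simp
      also have "\<dots> = c * ennreal C3 * (ennreal (t powr (- \<theta>) * a t) * k t)"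
        using C3(1) potter_pos[OF a t] by (simp add: ennreal_mult mult_ac)
      also have "\<dots> \<le> c * ennreal C3 * (C2 * E {0<..<t} k)"
        by (intro mult_left_mono C2 k t) simp
      finally show ?thesis by (simp add: mult.assoc)
    qed
    have "nested {t<..} t l \<le> Lnorm r {t<..} (\<lambda>s. wgt 0 r b s * (c * ennreal C3 * C2 * E {0<..<t} k))"
      by (rule Lnorm_mono_halfline) (use t l measurable_nested in \<open>auto intro!: mult_left_mono inner\<close>)
    also have "\<dots> = c * ennreal C3 * C2 * ?M"
      unfolding B_mult[OF t] by (simp add: mult_ac)
    finally have 3: "nested {t<..} t l \<le> c * ennreal C3 * C2 * ?M" .
    have "nested {0<..} 0 l \<le> C1 * (c * ?N + c * ?M + c * ennreal C3 * C2 * ?M)"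
      using C1(2)[OF l t] 1 2 3 by (meson add_mono mult_left_mono order_trans zero_le)
    also have "\<dots> \<le> C1 * ((c + c * ennreal C3 * C2) * (?N + ?M))"
      by (intro mult_left_mono) (simp_all add: distrib_left distrib_right add_ac add_increasing add_increasing2)
    finally show "nested {0<..} 0 l \<le> C1 * (c + c * ennreal C3 * C2) * (?N + ?M)"
      by (simp add: mult.assoc)
  qed
qed

lemma B_quasi_antimono:
  assumes "0 < \<epsilon>"
  obtains C where "C < \<infinity>" "\<And>s t. 0 < s \<Longrightarrow> s \<le> t \<Longrightarrow> B s \<le> C * ennreal ((t / s) powr \<epsilon>) * B t"
proof -
  obtain C where "0 < C" "\<And>s t. 0 < s \<Longrightarrow> s \<le> t \<Longrightarrow> B s \<le> ennreal (C * (t / s) powr \<epsilon>) * B t"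
    using Lnorm_wgt_Ioi_quasi_antimono[OF r b assms] by metis
  then show thesis by (intro that[of "ennreal C"]) (simp_all add: ennreal_mult)
qed

lemma B_mono: "0 < s \<Longrightarrow> s \<le> t \<Longrightarrow> B t \<le> B s"
  by (rule Lnorm_mono_halfline) (use measurable_b in auto)

lemma B_finite:
  assumes "B 1 < \<infinity>" "0 < t"
  shows "B t < \<infinity>"
proof (cases "1 \<le> t")
  case True
  then show ?thesis using B_mono[of 1 t] assms by (auto intro: le_less_trans)
next
  case False
  obtain C where "C < \<infinity>" "\<And>s t. 0 < s \<Longrightarrow> s \<le> t \<Longrightarrow> B s \<le> C * ennreal ((t / s) powr 1) * B t"
    using B_quasi_antimono[of 1] by auto
  with False assms have "B t \<le> C * ennreal ((1 / t) powr 1) * B 1" by (metis linear)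
  also have "\<dots> < \<infinity>" using assms(1) \<open>C < \<infinity>\<close> by (simp add: ennreal_mult_less_top)
  finally show ?thesis .
qed

lemma b_le_B:
  obtains C where "C < \<infinity>" "\<And>t. 0 < t \<Longrightarrow> ennreal (b t) \<le> C * B t"
  using le_Lnorm_wgt_Ioi[OF r b] ennreal_less_top by (metis infinity_ennreal_def)

lemma B_pos: "0 < t \<Longrightarrow> 0 < B t"
proof -
  assume t: "0 < t"
  obtain C where "C < \<infinity>" "\<And>t. 0 < t \<Longrightarrow> ennreal (b t) \<le> C * B t"
    using b_le_B by blast
  then have "ennreal (b t) \<le> C * B t" using t by simp
  moreover have "0 < ennreal (b t)" using potter_pos[OF b t] by simp
  ultimately show "0 < B t" by (metis mult_zero_right not_gr_zero leD)
qed

end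

section \<open>Two limiting spaces and their fundamental functions\<close>

lemma wgt_powr_mult:
  assumes "0 < u"
  shows "wgt \<alpha> q a u = ennreal (u powr (\<theta> - \<alpha>)) * wgt \<theta> q a u"
proof -
  have "u powr (- \<alpha> - rexp q) = u powr (\<theta> - \<alpha>) * u powr (- \<theta> - rexp q)"
    by (simp flip: powr_add)
  then have "wgt \<alpha> q a u = ennreal (u powr (\<theta> - \<alpha>) * (u powr (- \<theta> - rexp q) * a u))"
    by (simp add: wgt_def mult.assoc)
  then show ?thesis by (simp add: wgt_def ennreal_mult')
qed

text \<open>
  The space with \<open>\<theta> = 1\<close> is limiting at the endpoint: the integrals of its weight over \<open>(0, t)\<close> are not given
  by a power, which is why their finiteness is assumed and why \<open>\<chi>1\<close> is built from \<open>A\<close> and \<open>H\<close> below.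
\<close>

locale LL_pair =
  W0: LL_weight \<theta>0 r0 b0 q0 a0 + W1: LL_weight 1 r1 b1 q1 a1
  for \<theta>0 :: real and r0 q0 r1 q1 :: ennreal and b0 a0 b1 a1 :: "real \<Rightarrow> real" +
  assumes \<theta>0_less: "\<theta>0 < 1"
    and B0_1: "W0.B 1 < \<infinity>" and B1_1: "W1.B 1 < \<infinity>"
    and head1: "Lnorm r1 {0<..<1} (\<lambda>s. wgt 0 r1 b1 s * Lnorm q1 {0<..<s} (wgt 0 q1 a1)) < \<infinity>"
begin

abbreviation A :: "real \<Rightarrow> ennreal" where
  "A t \<equiv> Lnorm q1 {0<..<t} (wgt 0 q1 a1)"

abbreviation H :: "real \<Rightarrow> ennreal" where
  "H t \<equiv> Lnorm r1 {0<..<t} (\<lambda>s. wgt 0 r1 b1 s * A s)"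

abbreviation \<chi>0 :: "real \<Rightarrow> ennreal" where "\<chi>0 \<equiv> chi0 r0 b0 a0"
abbreviation \<chi>1 :: "real \<Rightarrow> ennreal" where "\<chi>1 \<equiv> chi1 r1 b1 q1 a1"
abbreviation \<rho> :: "real \<Rightarrow> real" where "\<rho> \<equiv> rho \<theta>0 r0 b0 a0 r1 b1 q1 a1"

lemma chi0_eq: "\<chi>0 t = ennreal (a0 t) * W0.B t"
  by (simp add: chi0_def)

lemma chi1_eq: "\<chi>1 t = H t + W1.B t * A t"
  by (simp add: chi1_def)

lemma measurable_a1: "halfline_measurable (wgt 0 q1 a1)"
  by (rule measurable_wgt[OF W1.a])

lemma measurable_bA: "halfline_measurable (\<lambda>s. wgt 0 r1 b1 s * A s)"
  by (intro borel_measurable_times_ennreal W1.measurable_b Lnorm_nested_measurable measurable_a1) simp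

lemma A_mono: "s \<le> t \<Longrightarrow> A s \<le> A t"
  by (rule Lnorm_mono_halfline) (use measurable_a1 in auto)

lemma A_quasi_mono:
  assumes "0 < \<epsilon>"
  obtains C where "C < \<infinity>" "\<And>s t. 0 < s \<Longrightarrow> s \<le> t \<Longrightarrow> A t \<le> C * ennreal ((t / s) powr \<epsilon>) * A s"
proof -
  obtain C where "0 < C" "\<And>s t. 0 < s \<Longrightarrow> s \<le> t \<Longrightarrow> A t \<le> ennreal (C * (t / s) powr \<epsilon>) * A s"
    using Lnorm_wgt_Ioo_quasi_mono[OF W1.q W1.a assms] by metis
  then show thesis by (intro that[of "ennreal C"]) (simp_all add: ennreal_mult)
qed

text \<open>
  If \<open>A (1/2)\<close> were infinite, so would be \<open>A s\<close> for \<open>1/2 < s < 1\<close>, and hence \<open>H 1\<close>. Slow variation carries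
  finiteness at one point to all others.
\<close>

lemma A_finite:
  assumes "0 < t"
  shows "A t < \<infinity>"
proof -
  have half: "A (1/2) < \<infinity>"
  proof (rule ccontr)
    assume "\<not> A (1/2) < \<infinity>"
    then have top: "A (1/2) = top" by (metis top.not_eq_extremum infinity_ennreal_def)
    have "top * ennreal ((1 - 1/2) powr rexp r1) \<le> H 1"
    proof (rule Lnorm_ge_const[OF W1.r])
      fix u :: real assume u: "1/2 < u" "u < 1"
      then have "A u = top" using A_mono[of "1/2" u] top by (simp add: top_unique)
      moreover have "0 < wgt 0 r1 b1 u"
        using u potter_pos[OF W1.b, of u] by (simp add: wgt_def)
      ultimately show "top \<le> wgt 0 r1 b1 u * A u" by (simp add: ennreal_mult_top)
    qed auto
    then show False using head1 by (simp add: ennreal_top_mult top_unique)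
  qed
  show ?thesis
  proof (cases "t \<le> 1/2")
    case True
    then show ?thesis using A_mono half by (meson le_less_trans)
  next
    case False
    obtain C where C: "C < \<infinity>" "\<And>s t. 0 < s \<Longrightarrow> s \<le> t \<Longrightarrow> A t \<le> C * ennreal ((t / s) powr 1) * A s"
      using A_quasi_mono[of 1] by auto
    have "A t \<le> C * ennreal ((t / (1/2)) powr 1) * A (1/2)" using False by (intro C(2)) auto
    also have "\<dots> < \<infinity>" using C(1) half by (simp add: ennreal_mult_less_top)
    finally show ?thesis .
  qed
qed

lemma H_split:
  assumes "0 < s" "s \<le> t"
  shows "H t \<le> ennreal (2 powr rexp r1) * (H s + W1.B s * A t)"
proof -
  have "H t \<le> ennreal (2 powr rexp r1) * (H s + Lnorm r1 {s<..<t} (\<lambda>s. wgt 0 r1 b1 s * A s))"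
    by (rule Lnorm_split[where t=s]) (use assms W1.r measurable_bA in auto)
  also have "\<dots> \<le> ennreal (2 powr rexp r1) * (H s + A t * W1.B s)"
  proof (intro mult_left_mono add_left_mono)
    have "1 * Lnorm r1 {s<..<t} (\<lambda>s. wgt 0 r1 b1 s * A s) \<le> A t * W1.B s"
    proof (rule Lnorm_scaled_mono)
      fix u assume "u \<in> {s<..<t}"
      then show "1 * (wgt 0 r1 b1 u * A u) \<le> A t * wgt 0 r1 b1 u"
        using A_mono[of u t] by (simp add: mult.commute mult_left_mono)
    qed (use assms W1.r measurable_bA W1.measurable_b in auto)
    then show "Lnorm r1 {s<..<t} (\<lambda>s. wgt 0 r1 b1 s * A s) \<le> A t * W1.B s" by simp
  qed simp
  finally show ?thesis by (simp add: mult.commute)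
qed

lemma chi1_finite:
  assumes "0 < t"
  shows "\<chi>1 t < \<infinity>"
proof -
  have "H t < \<infinity>"
  proof (cases "t \<le> 1")
    case True
    then have "H t \<le> H 1" by (intro Lnorm_mono_halfline) (use measurable_bA in auto)
    also have "\<dots> < \<infinity>" by (rule head1)
    finally show ?thesis .
  next
    case False
    then have "H t \<le> ennreal (2 powr rexp r1) * (H 1 + W1.B 1 * A t)" by (intro H_split) auto
    also have "\<dots> < \<infinity>" using head1 B1_1 A_finite[OF assms] by (simp add: ennreal_mult_less_top)
    finally show ?thesis .
  qed
  then show ?thesis
    using A_finite[OF assms] W1.B_finite[OF B1_1 assms] by (simp add: chi1_eq ennreal_mult_less_top)
qed

lemma a1_B_le_chi1:
  obtains C where "C < \<infinity>" "\<And>t. 0 < t \<Longrightarrow> ennreal (a1 t) * W1.B t \<le> C * \<chi>1 t"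
proof -
  obtain C where C: "0 < C" "\<And>t. 0 < t \<Longrightarrow> ennreal (a1 t) \<le> ennreal C * A t"
    using le_Lnorm_wgt_Ioo[OF W1.q W1.a] by blast
  show thesis
  proof (rule that)
    show "ennreal C < \<infinity>" by simp
    fix t :: real assume t: "0 < t"
    have "ennreal (a1 t) * W1.B t \<le> ennreal C * A t * W1.B t"
      by (rule mult_right_mono[OF C(2)[OF t]]) simp
    also have "\<dots> \<le> ennreal C * \<chi>1 t"
      unfolding chi1_eq mult.assoc by (intro mult_left_mono) (simp_all add: mult.commute add_increasing)
    finally show "ennreal (a1 t) * W1.B t \<le> ennreal C * \<chi>1 t" .
  qed
qed

lemma chi1_pos:
  assumes "0 < t"
  shows "0 < \<chi>1 t"
proof -
  obtain C where C: "C < \<infinity>" "ennreal (a1 t) * W1.B t \<le> C * \<chi>1 t"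
    using a1_B_le_chi1 assms by metis
  have "0 < ennreal (a1 t) * W1.B t"
    using assms W1.B_pos potter_pos[OF W1.a] by (simp add: ennreal_zero_less_mult_iff)
  with C(2) show ?thesis by (metis leD mult_zero_right not_gr_zero)
qed

lemma chi0_finite: "0 < t \<Longrightarrow> \<chi>0 t < \<infinity>"
  using W0.B_finite[OF B0_1] by (simp add: chi0_eq ennreal_mult_less_top)

lemma chi0_pos: "0 < t \<Longrightarrow> 0 < \<chi>0 t"
  using W0.B_pos potter_pos[OF W0.a] by (simp add: chi0_eq ennreal_zero_less_mult_iff)

lemma rho_chi1:
  assumes "0 < t"
  shows "ennreal (\<rho> t) * \<chi>1 t = ennreal (t powr (1 - \<theta>0)) * \<chi>0 t"
proof -
  have 0: "\<chi>0 t = ennreal (enn2real (\<chi>0 t))" and 1: "\<chi>1 t = ennreal (enn2real (\<chi>1 t))"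
    using chi0_finite[OF assms] chi1_finite[OF assms] by simp_all
  have pos: "0 < enn2real (\<chi>1 t)"
    using chi1_pos[OF assms] chi1_finite[OF assms] by (simp add: enn2real_positive_iff)
  have "ennreal (\<rho> t) * ennreal (enn2real (\<chi>1 t))
      = ennreal (t powr (1 - \<theta>0)) * ennreal (enn2real (\<chi>0 t))"
    using pos by (simp add: rho_def flip: ennreal_mult)
  then show ?thesis using 0 1 by simp
qed

lemma chi1_rho_mult: "0 < t \<Longrightarrow> \<chi>1 t * (ennreal (\<rho> t) * x) = ennreal (t powr (1 - \<theta>0)) * \<chi>0 t * x"
  unfolding rho_chi1[symmetric] by (simp add: mult_ac)

lemma rho_pos:
  assumes "0 < t"
  shows "0 < \<rho> t"
  using assms chi0_pos chi0_finite chi1_pos chi1_finite by (simp add: rho_def enn2real_positive_iff)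

text \<open>
  Both factors of \<open>\<chi>0\<close> vary slowly. The smaller argument is on the left because \<open>\<chi>0(t)\<close> will be replaced
  by \<open>\<chi>0(u)\<close> on \<open>u > t\<close>.
\<close>

lemma chi0_quasi_antimono:
  assumes "0 < \<epsilon>"
  obtains C where "C < \<infinity>" "\<And>t u. 0 < t \<Longrightarrow> t \<le> u \<Longrightarrow> \<chi>0 t \<le> C * ennreal ((u / t) powr \<epsilon>) * \<chi>0 u"
proof -
  have e2: "0 < \<epsilon> / 2" using assms by simp
  obtain C where C: "C < \<infinity>" "\<And>s t. 0 < s \<Longrightarrow> s \<le> t \<Longrightarrow> W0.B s \<le> C * ennreal ((t / s) powr (\<epsilon> / 2)) * W0.B t"
    using W0.B_quasi_antimono[OF e2] by blast
  obtain D where D: "0 < D" "\<And>s t. 0 < s \<Longrightarrow> s \<le> t \<Longrightarrow> a0 s \<le> D * (t / s) powr (\<epsilon> / 2) * a0 t"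
    using potter_boundsE[OF W0.a e2] by metis
  show thesis
  proof (rule that)
    show "ennreal D * C < \<infinity>" using C by (simp add: ennreal_mult_less_top)
    fix t u :: real assume tu: "0 < t" "t \<le> u"
    let ?Q = "(u / t) powr (\<epsilon> / 2)"
    have "\<chi>0 t \<le> ennreal (D * ?Q * a0 u) * (C * ennreal ?Q * W0.B u)"
      unfolding chi0_eq using C(2)[OF tu] D(2)[OF tu] by (intro mult_mono ennreal_leI) auto
    also have "\<dots> = ennreal D * C * (ennreal ?Q * ennreal ?Q) * \<chi>0 u"
      using D(1) tu potter_pos[OF W0.a, of u] by (simp add: chi0_eq ennreal_mult mult_ac)
    also have "ennreal ?Q * ennreal ?Q = ennreal ((u / t) powr \<epsilon>)"
      by (simp flip: ennreal_mult powr_add)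
    finally show "\<chi>0 t \<le> ennreal D * C * ennreal ((u / t) powr \<epsilon>) * \<chi>0 u" .
  qed
qed

text \<open>
  Passing from \<open>u\<close> up to \<open>t\<close>, the increment of \<open>H\<close> is at most \<open>B u * A t\<close>, and \<open>A\<close> grows more slowly than any
  power.
\<close>

lemma chi1_quasi_mono:
  assumes "0 < \<epsilon>"
  obtains C where "C < \<infinity>" "\<And>t u. 0 < u \<Longrightarrow> u \<le> t \<Longrightarrow> \<chi>1 t \<le> C * ennreal ((t / u) powr \<epsilon>) * \<chi>1 u"
proof -
  obtain C where C: "C < \<infinity>" "\<And>s t. 0 < s \<Longrightarrow> s \<le> t \<Longrightarrow> A t \<le> C * ennreal ((t / s) powr \<epsilon>) * A s"
    using A_quasi_mono[OF assms] by blast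
  let ?D = "ennreal (2 powr rexp r1)"
  show thesis
  proof (rule that)
    show "?D + (?D * C + C) < \<infinity>" using C(1) by (simp add: ennreal_mult_less_top)
    fix t u :: real assume u: "0 < u" "u \<le> t"
    let ?Q = "ennreal ((t / u) powr \<epsilon>)"
    have Q: "1 \<le> ?Q" using u assms by (simp add: ge_one_powr_ge_zero)
    have BA: "W1.B u * A t \<le> C * ?Q * (W1.B u * A u)"
      using mult_left_mono[OF C(2)[OF u], of "W1.B u"] by (simp add: mult_ac)
    have "H t \<le> ?D * (H u + W1.B u * A t)" by (rule H_split[OF u])
    also have "\<dots> \<le> ?D * (?Q * H u + C * ?Q * (W1.B u * A u))"
      using BA mult_right_mono[OF Q, of "H u"] by (intro mult_left_mono add_mono) auto
    finally have "\<chi>1 t \<le> ?D * (?Q * H u + C * ?Q * (W1.B u * A u)) + C * ?Q * (W1.B u * A u)"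
      unfolding chi1_eq
    proof (rule add_mono)
      have "W1.B t * A t \<le> W1.B u * A t" using W1.B_mono[OF u] by (rule mult_right_mono) simp
      then show "W1.B t * A t \<le> C * ?Q * (W1.B u * A u)" using BA by (rule order_trans)
    qed
    also have "\<dots> = ?Q * (?D * H u + (?D * C + C) * (W1.B u * A u))"
      by (simp add: distrib_left distrib_right mult_ac add_ac)
    also have "\<dots> \<le> ?Q * ((?D + (?D * C + C)) * (H u + W1.B u * A u))"
      by (intro mult_left_mono) (simp_all add: distrib_left distrib_right add_ac add_increasing add_increasing2)
    finally show "\<chi>1 t \<le> (?D + (?D * C + C)) * ?Q * \<chi>1 u"
      by (simp add: chi1_eq mult_ac)
  qed
qed

text \<open>
  The pointwise bound for elements of the first space: at each \<open>u\<close> the norm dominates \<open>B u\<close> times the inner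
  norm over \<open>(0, u)\<close>, which dominates \<open>u powr -\<theta>0 * a0(u) * k(u)\<close>.
\<close>

lemma chi0_le_total:
  obtains C where "C < \<infinity>" "\<And>k u. quasi_concave k \<Longrightarrow> 0 < u \<Longrightarrow>
    \<chi>0 u * k u \<le> C * ennreal (u powr \<theta>0) * W0.nested {0<..} 0 k"
proof -
  obtain C where C: "C < \<infinity>" "\<And>k t. quasi_concave k \<Longrightarrow> 0 < t \<Longrightarrow>
    ennreal (t powr (- \<theta>0) * a0 t) * k t \<le> C * W0.E {0<..<t} k"
    using W0.E_lower by blast
  show thesis
  proof (rule that[OF C(1)])
    fix k u assume k: "quasi_concave k" and u: "0 < (u::real)"
    have "a0 u = u powr \<theta>0 * (u powr (- \<theta>0) * a0 u)"
      using u by (simp add: powr_minus field_simps)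
    then have "\<chi>0 u * k u = ennreal (u powr \<theta>0) * W0.B u * (ennreal (u powr (- \<theta>0) * a0 u) * k u)"
      unfolding chi0_eq by (metis (no_types, lifting) ennreal_mult' mult.assoc mult.commute powr_ge_zero)
    also have "\<dots> \<le> ennreal (u powr \<theta>0) * W0.B u * (C * W0.E {0<..<u} k)"
      by (intro mult_left_mono C(2) k u) simp
    also have "\<dots> = C * ennreal (u powr \<theta>0) * (W0.B u * W0.E {0<..<u} k)" by (simp add: mult_ac)
    also have "\<dots> \<le> C * ennreal (u powr \<theta>0) * W0.nested {0<..} 0 k"
      by (intro mult_left_mono W0.B_E_le_total u quasi_concave_measurable k) simp
    finally show "\<chi>0 u * k u \<le> C * ennreal (u powr \<theta>0) * W0.nested {0<..} 0 k" .
  qed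
qed

lemma wgt_zero_eq: "0 < u \<Longrightarrow> wgt 0 q1 a1 u = ennreal u * wgt 1 q1 a1 u"
  using wgt_powr_mult[of u 0 q1 a1 1] by simp

text \<open>
  The pointwise bound for elements of the second space. As \<open>k(v) / v \<ge> k(u) / u\<close> for \<open>v \<le> u\<close>, the function \<open>k\<close>
  may be replaced by the linear function \<open>v * k(u) / u\<close> in the norm restricted to \<open>v < u\<close>, and the two
  parts of that restricted norm of the identity are the two summands of \<open>\<chi>1(u)\<close>.
\<close>

lemma chi1_le_total:
  assumes k: "quasi_concave k" and u: "0 < u"
  shows "\<chi>1 u * k u \<le> 2 * (ennreal u * W1.nested {0<..} 0 k)"
proof -
  note km = quasi_concave_measurable[OF k]
  have inner: "k u * A s \<le> ennreal u * W1.E {0<..<s} k" if "s \<le> u" for s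
  proof (rule Lnorm_scaled_mono)
    fix v assume "v \<in> {0<..<s}"
    then have v: "0 < v" "v \<le> u" using that by auto
    have "k u * wgt 0 q1 a1 v = wgt 1 q1 a1 v * (ennreal v * k u)"
      using v by (simp add: wgt_zero_eq mult_ac)
    also have "\<dots> \<le> wgt 1 q1 a1 v * (ennreal u * k v)"
      by (intro mult_left_mono quasi_concaveD(2)[OF k v]) simp
    finally show "k u * wgt 0 q1 a1 v \<le> ennreal u * (wgt 1 q1 a1 v * k v)" by (simp add: mult_ac)
  qed (use W1.q measurable_a1 W1.measurable_E[OF km] in auto)
  have "k u * H u \<le> ennreal u * W1.nested {0<..} 0 k"
    by (rule Lnorm_scaled_mono)
      (use u W1.r measurable_bA W1.measurable_nested[OF km] inner in \<open>auto intro!: scaled_mult_left\<close>)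
  moreover have "k u * (W1.B u * A u) \<le> ennreal u * W1.nested {0<..} 0 k"
  proof -
    have "k u * (W1.B u * A u) \<le> ennreal u * (W1.B u * W1.E {0<..<u} k)"
      by (rule scaled_mult_left[OF inner]) simp
    also have "\<dots> \<le> ennreal u * W1.nested {0<..} 0 k"
      by (intro mult_left_mono W1.B_E_le_total u km) simp
    finally show ?thesis .
  qed
  ultimately have "k u * H u + k u * (W1.B u * A u) \<le> 2 * (ennreal u * W1.nested {0<..} 0 k)"
    unfolding mult_2 by (rule add_mono)
  then show ?thesis by (simp add: chi1_eq distrib_left mult.commute)
qed

text \<open>
  A crossed term of the lower bound. For \<open>u > t\<close> the pointwise bound and slow variation of \<open>\<chi>0\<close> give
  \<open>\<chi>0(t) * k(u) \<le> C * t powr -\<epsilon> * u powr (\<theta>0 + \<epsilon>) * N\<close>, where \<open>N\<close> is the first norm of \<open>k\<close>. Since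
  \<open>\<theta>0 + \<epsilon> < 1\<close>, the inner norm over \<open>u > t\<close> converges and is of order \<open>t powr (\<theta>0 - 1) * a1(t)\<close>. The outer
  norm then contributes \<open>B t\<close>, and \<open>a1(t) * B t\<close> is dominated by \<open>\<chi>1(t)\<close>.
\<close>

lemma tail1_le_total0:
  obtains C where "C < \<infinity>" "\<And>k t. quasi_concave k \<Longrightarrow> 0 < t \<Longrightarrow>
    ennreal (\<rho> t) * W1.nested {t<..} t k \<le> C * W0.nested {0<..} 0 k"
proof -
  define \<epsilon> where "\<epsilon> = (1 - \<theta>0) / 2"
  have \<epsilon>: "0 < \<epsilon>" "0 < 1 - \<theta>0 - \<epsilon>" using \<theta>0_less by (simp_all add: \<epsilon>_def field_simps)
  obtain C1 where C1: "C1 < \<infinity>" "\<And>t u. 0 < t \<Longrightarrow> t \<le> u \<Longrightarrow> \<chi>0 t \<le> C1 * ennreal ((u / t) powr \<epsilon>) * \<chi>0 u"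
    using chi0_quasi_antimono[OF \<epsilon>(1)] by blast
  obtain C2 where C2: "C2 < \<infinity>" "\<And>k u. quasi_concave k \<Longrightarrow> 0 < u \<Longrightarrow>
    \<chi>0 u * k u \<le> C2 * ennreal (u powr \<theta>0) * W0.nested {0<..} 0 k"
    using chi0_le_total by blast
  obtain C3 where C3: "0 < C3" "\<And>t. 0 < t \<Longrightarrow>
      Lnorm q1 {t<..} (wgt (1 - \<theta>0 - \<epsilon>) q1 a1) \<le> ennreal (C3 * t powr (- (1 - \<theta>0 - \<epsilon>)) * a1 t)"
    using Lnorm_wgt_Ioi_le[OF W1.q \<epsilon>(2) W1.a] by blast
  obtain C4 where C4: "C4 < \<infinity>" "\<And>t. 0 < t \<Longrightarrow> ennreal (a1 t) * W1.B t \<le> C4 * \<chi>1 t"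
    using a1_B_le_chi1 by blast
  show thesis
  proof (rule that)
    show "C1 * C2 * ennreal C3 * C4 < \<infinity>" using C1 C2 C4 by (simp add: ennreal_mult_less_top)
    fix k t assume k: "quasi_concave k" and t: "0 < (t::real)"
    note km = quasi_concave_measurable[OF k]
    let ?N = "W0.nested {0<..} 0 k" and ?T = "W1.nested {t<..} t k"
    have k_le: "\<chi>0 t * k u \<le> C1 * C2 * ennreal (t powr (- \<epsilon>)) * ?N * ennreal (u powr (\<theta>0
        + \<epsilon>))" if u: "t < u" for u
    proof -
      have "\<chi>0 t * k u \<le> C1 * ennreal ((u / t) powr \<epsilon>) * \<chi>0 u * k u"
        by (rule mult_right_mono[OF C1(2)]) (use t u in auto)
      also have "\<dots> = C1 * ennreal ((u / t) powr \<epsilon>) * (\<chi>0 u * k u)" by (simp add: mult_ac)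
      also have "\<dots> \<le> C1 * ennreal ((u / t) powr \<epsilon>) * (C2 * ennreal (u powr \<theta>0) * ?N)"
        by (rule mult_left_mono[OF C2(2)]) (use t u k in auto)
      also have "(u / t) powr \<epsilon> = t powr (- \<epsilon>) * u powr \<epsilon>"
        using t u by (simp add: powr_divide powr_minus field_simps)
      finally show ?thesis
        by (simp add: powr_add ennreal_mult mult_ac)
    qed
    let ?Z = "C1 * C2 * ennreal C3 * (ennreal (t powr (\<theta>0 - 1)) * ennreal (a1 t)) * ?N"
    have inner: "\<chi>0 t * W1.E {t<..<s} k \<le> ?Z * 1" for s
    proof -
      have "\<chi>0 t * W1.E {t<..<s} k \<le> C1 * C2 * ennreal (t powr (- \<epsilon>)) * ?N * Lnorm q1 {t<..} (wgt
          (1 - \<theta>0 - \<epsilon>) q1 a1)"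
      proof (rule Lnorm_scaled_mono)
        fix u assume "u \<in> {t<..<s}"
        then have u: "t < u" by auto
        have "\<chi>0 t * (wgt 1 q1 a1 u * k u) = wgt 1 q1 a1 u * (\<chi>0 t * k u)" by (simp add: mult_ac)
        also have "\<dots> \<le> wgt 1 q1 a1 u * (C1 * C2 * ennreal (t powr (- \<epsilon>)) * ?N * ennreal (u powr (\<theta>0
            + \<epsilon>)))"
          by (rule mult_left_mono[OF k_le[OF u]]) simp
        also have "\<dots> = C1 * C2 * ennreal (t powr (- \<epsilon>)) * ?N * wgt (1 - \<theta>0 - \<epsilon>) q1 a1 u"
          using wgt_powr_mult[of u "1 - \<theta>0 - \<epsilon>" q1 a1 1] t u by (simp add: add_ac mult_ac)
        finally show "\<chi>0 t * (wgt 1 q1 a1 u * k u)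
            \<le> C1 * C2 * ennreal (t powr (- \<epsilon>)) * ?N * wgt (1 - \<theta>0 - \<epsilon>) q1 a1 u" .
      qed (use t W1.q W1.measurable_E[OF km] measurable_wgt[OF W1.a] in auto)
      also have "\<dots> \<le> C1 * C2 * ennreal (t powr (- \<epsilon>)) * ?N * ennreal (C3 * t powr (-
          (1 - \<theta>0 - \<epsilon>)) * a1 t)"
        by (intro mult_left_mono C3 t) simp
      also have "\<dots> = C1 * C2 * ennreal C3 * (ennreal (t powr (- \<epsilon>) * t powr (-
          (1 - \<theta>0 - \<epsilon>))) * ennreal (a1 t)) * ?N"
        using C3(1) potter_pos[OF W1.a t] by (simp add: ennreal_mult mult_ac)
      also have "t powr (- \<epsilon>) * t powr (- (1 - \<theta>0 - \<epsilon>)) = t powr (\<theta>0 - 1)"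
        by (simp flip: powr_add)
      finally show ?thesis by simp
    qed
    have "\<chi>0 t * ?T \<le> ?Z * W1.B t"
    proof (rule Lnorm_scaled_mono)
      fix s show "\<chi>0 t * (wgt 0 r1 b1 s * W1.E {t<..<s} k) \<le> ?Z * wgt 0 r1 b1 s"
        using scaled_mult_left[OF inner, of "wgt 0 r1 b1 s" s] by simp
    qed (use t W1.r W1.measurable_nested[OF km] W1.measurable_b in auto)
    also have "\<dots> = C1 * C2 * ennreal C3 * ennreal (t powr (\<theta>0 - 1)) * (ennreal (a1 t) * W1.B t) * ?N"
      by (simp add: mult_ac)
    also have "\<dots> \<le> C1 * C2 * ennreal C3 * ennreal (t powr (\<theta>0 - 1)) * (C4 * \<chi>1 t) * ?N"
      by (intro mult_left_mono mult_right_mono C4 t) simp_all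
    finally have "\<chi>0 t * ?T \<le> C1 * C2 * ennreal C3 * ennreal (t powr (\<theta>0 - 1)) * (C4 * \<chi>1 t) * ?N" .
    from mult_left_mono[OF this, of "ennreal (t powr (1 - \<theta>0))"]
    have "ennreal (t powr (1 - \<theta>0)) * \<chi>0 t * ?T
        \<le> ennreal (t powr (1 - \<theta>0)) * ennreal (t powr (\<theta>0 - 1)) *
        (C1 * C2 * ennreal C3 * C4 * \<chi>1 t * ?N)"
      by (simp add: mult_ac)
    also have "ennreal (t powr (1 - \<theta>0)) * ennreal (t powr (\<theta>0 - 1)) = 1"
      using t by (simp flip: ennreal_mult powr_add)
    finally have "\<chi>1 t * (ennreal (\<rho> t) * ?T) \<le> \<chi>1 t * (C1 * C2 * ennreal C3 * C4 * ?N)"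
      unfolding chi1_rho_mult[OF t] by (simp add: mult_ac)
    then show "ennreal (\<rho> t) * ?T \<le> C1 * C2 * ennreal C3 * C4 * ?N"
      using chi1_pos[OF t] chi1_finite[OF t] by (subst (asm) ennreal_mult_le_mult_iff) auto
  qed
qed

text \<open>
  The other crossed terms. For \<open>u < t\<close> the pointwise bound and slow variation of \<open>\<chi>1\<close> give
  \<open>\<chi>1(t) * k(u) \<le> C * t powr \<epsilon> * u powr (1 - \<epsilon>) * N\<close>, where \<open>N\<close> is the second norm of \<open>k\<close>. Since
  \<open>1 - \<epsilon> > \<theta>0\<close>, both the inner and the outer norm are integrals of a positive power \<open>\<gamma>\<close> times a slowly
  varying function, and are evaluated at their upper end.
\<close>

lemma head0_le_total1:
  obtains C where "C < \<infinity>" "\<And>k t. quasi_concave k \<Longrightarrow> 0 < t \<Longrightarrow>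
    W0.nested {0<..<t} 0 k + W0.B t * W0.E {0<..<t} k \<le> C * (ennreal (\<rho> t) * W1.nested {0<..} 0 k)"
proof -
  define \<epsilon> where "\<epsilon> = (1 - \<theta>0) / 2"
  define \<gamma> where "\<gamma> = 1 - \<theta>0 - \<epsilon>"
  have \<epsilon>: "0 < \<epsilon>" "0 < \<gamma>" using \<theta>0_less by (simp_all add: \<epsilon>_def \<gamma>_def field_simps)
  obtain C1 where C1: "C1 < \<infinity>" "\<And>t u. 0 < u \<Longrightarrow> u \<le> t \<Longrightarrow> \<chi>1 t \<le> C1 * ennreal ((t / u) powr \<epsilon>) * \<chi>1 u"
    using chi1_quasi_mono[OF \<epsilon>(1)] by blast
  obtain C3 where C3: "0 < C3" "\<And>t. 0 < t \<Longrightarrow>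
      Lnorm q0 {0<..<t} (wgt (- \<gamma>) q0 a0) \<le> ennreal (C3 * t powr \<gamma> * a0 t)"
    using Lnorm_wgt_Ioo_le[OF W0.q \<epsilon>(2) W0.a] by blast
  have ba: "potter_bounds (\<lambda>t. b0 t * a0 t)" by (intro potter_mult W0.a W0.b)
  obtain C5 where C5: "0 < C5" "\<And>t. 0 < t \<Longrightarrow>
      Lnorm r0 {0<..<t} (wgt (- \<gamma>) r0 (\<lambda>t. b0 t * a0 t)) \<le> ennreal (C5 * t powr \<gamma> * (b0 t * a0 t))"
    using Lnorm_wgt_Ioo_le[OF W0.r \<epsilon>(2) ba] by blast
  obtain C6 where C6: "C6 < \<infinity>" "\<And>t. 0 < t \<Longrightarrow> ennreal (b0 t) \<le> C6 * W0.B t"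
    using W0.b_le_B by blast
  define D where "D = 2 * C1 * ennreal C3"
  show thesis
  proof (rule that)
    show "D * ennreal C5 * C6 + D < \<infinity>" using C1 C6 by (simp add: D_def ennreal_mult_less_top)
    fix k t assume k: "quasi_concave k" and t: "0 < (t::real)"
    note km = quasi_concave_measurable[OF k]
    let ?N = "W1.nested {0<..} 0 k"
    let ?S = "ennreal (t powr \<epsilon>)"
    have k_le: "\<chi>1 t * k u \<le> 2 * C1 * ?S * ?N * ennreal (u powr (1 - \<epsilon>))" if u: "0 < u" "u \<le> t" for u
    proof -
      have "\<chi>1 t * k u \<le> C1 * ennreal ((t / u) powr \<epsilon>) * \<chi>1 u * k u"
        by (rule mult_right_mono[OF C1(2)[OF u]]) simp
      also have "\<dots> = C1 * ennreal ((t / u) powr \<epsilon>) * (\<chi>1 u * k u)" by (simp add: mult_ac)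
      also have "\<dots> \<le> C1 * ennreal ((t / u) powr \<epsilon>) * (2 * (ennreal u * ?N))"
        by (rule mult_left_mono[OF chi1_le_total[OF k u(1)]]) simp
      also have "\<dots> = 2 * C1 * ?N * ennreal ((t / u) powr \<epsilon> * u)"
        using u by (simp add: ennreal_mult mult_ac)
      also have "(t / u) powr \<epsilon> * u = t powr \<epsilon> * u powr (1 - \<epsilon>)"
        using t u by (simp add: powr_divide powr_diff)
      finally show ?thesis
        by (simp add: ennreal_mult mult_ac)
    qed
    have inner: "\<chi>1 t * W0.E {0<..<s} k \<le> D * ?S * ?N * ennreal (s powr \<gamma> * a0 s)" if s: "0 < s"
        "s \<le> t" for s
    proof -
      have "\<chi>1 t * W0.E {0<..<s} k \<le> 2 * C1 * ?S * ?N * Lnorm q0 {0<..<s} (wgt (- \<gamma>) q0 a0)"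
      proof (rule Lnorm_scaled_mono)
        fix u assume "u \<in> {0<..<s}"
        then have u: "0 < u" "u \<le> t" using s by auto
        have "\<chi>1 t * (wgt \<theta>0 q0 a0 u * k u) = wgt \<theta>0 q0 a0 u * (\<chi>1 t * k u)" by (simp add: mult_ac)
        also have "\<dots> \<le> wgt \<theta>0 q0 a0 u * (2 * C1 * ?S * ?N * ennreal (u powr (1 - \<epsilon>)))"
          by (rule mult_left_mono[OF k_le[OF u]]) simp
        also have "\<dots> = 2 * C1 * ?S * ?N * wgt (- \<gamma>) q0 a0 u"
          using wgt_powr_mult[of u "- \<gamma>" q0 a0 \<theta>0] u by (simp add: \<gamma>_def mult_ac)
        finally show "\<chi>1 t * (wgt \<theta>0 q0 a0 u * k u) \<le> 2 * C1 * ?S * ?N * wgt (- \<gamma>) q0 a0 u" .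
      qed (use s W0.q W0.measurable_E[OF km] measurable_wgt[OF W0.a] in auto)
      also have "\<dots> \<le> 2 * C1 * ?S * ?N * ennreal (C3 * s powr \<gamma> * a0 s)"
        by (intro mult_left_mono C3 s) simp
      also have "\<dots> = D * ?S * ?N * ennreal (s powr \<gamma> * a0 s)"
        using C3(1) potter_pos[OF W0.a s(1)] by (simp add: D_def ennreal_mult mult_ac)
      finally show ?thesis .
    qed
    have St: "?S * ennreal (t powr \<gamma>) = ennreal (t powr (1 - \<theta>0))"
      by (simp add: \<gamma>_def flip: ennreal_mult powr_add)
    have a0t: "0 \<le> a0 t" "0 \<le> b0 t" using potter_pos[OF W0.a t] potter_pos[OF W0.b t] by simp_all
    have "\<chi>1 t * W0.nested {0<..<t} 0 k
        \<le> D * ?S * ?N * Lnorm r0 {0<..<t} (wgt (- \<gamma>) r0 (\<lambda>t. b0 t * a0 t))"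
    proof (rule Lnorm_scaled_mono)
      fix s assume "s \<in> {0<..<t}"
      then have s: "0 < s" "s \<le> t" by auto
      have pos: "0 < a0 s" "0 < b0 s" using s potter_pos[OF W0.a] potter_pos[OF W0.b] by simp_all
      have "wgt 0 r0 b0 s * ennreal (s powr \<gamma> * a0 s)
          = ennreal ((s powr \<gamma> * s powr (- rexp r0)) * (b0 s * a0 s))"
        using pos by (simp add: wgt_def mult_ac flip: ennreal_mult)
      also have "\<dots> = wgt (- \<gamma>) r0 (\<lambda>t. b0 t * a0 t) s"
        by (simp add: wgt_def flip: powr_add)
      finally have w: "wgt (- \<gamma>) r0 (\<lambda>t. b0 t * a0 t) s
          = wgt 0 r0 b0 s * ennreal (s powr \<gamma> * a0 s)" by simp
      show "\<chi>1 t * (wgt 0 r0 b0 s * W0.E {0<..<s} k) \<le> D * ?S * ?N * wgt (- \<gamma>) r0 (\<lambda>t. b0 t * a0 t) s"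
        unfolding w by (rule scaled_mult_left[OF inner[OF s]])
    qed (use t W0.r W0.measurable_nested[OF km] measurable_wgt[OF ba] in auto)
    also have "\<dots> \<le> D * ?S * ?N * ennreal (C5 * t powr \<gamma> * (b0 t * a0 t))"
      by (intro mult_left_mono C5 t) simp
    also have "\<dots> = D * ennreal C5 * (?S * ennreal (t powr \<gamma>)) * ?N * ennreal (a0 t) * ennreal (b0 t)"
      using C5(1) a0t by (simp add: ennreal_mult mult_ac)
    also have "\<dots> \<le> D * ennreal C5 * (?S * ennreal (t powr \<gamma>)) * ?N * ennreal (a0 t) * (C6 * W0.B t)"
      by (intro mult_left_mono C6 t) simp
    also have "\<dots> = D * ennreal C5 * C6 * (ennreal (t powr (1 - \<theta>0)) * \<chi>0 t * ?N)"
      unfolding St chi0_eq by (simp add: mult_ac)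
    finally have 1: "\<chi>1 t * W0.nested {0<..<t} 0 k
        \<le> D * ennreal C5 * C6 * (ennreal (t powr (1 - \<theta>0)) * \<chi>0 t * ?N)" .
    have "\<chi>1 t * (W0.B t * W0.E {0<..<t} k) \<le> D * ?S * ?N * (W0.B t * ennreal (t powr \<gamma> * a0 t))"
      by (rule scaled_mult_left[OF inner]) (use t in auto)
    also have "\<dots> = D * (?S * ennreal (t powr \<gamma>) * \<chi>0 t * ?N)"
      using a0t by (simp add: chi0_eq ennreal_mult mult_ac)
    finally have 2: "\<chi>1 t * (W0.B t * W0.E {0<..<t} k) \<le> D * (ennreal (t powr (1 - \<theta>0)) * \<chi>0 t * ?N)"
      by (simp only: St)
    have "\<chi>1 t * ((D * ennreal C5 * C6 + D) * (ennreal (\<rho> t) * ?N))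
        = (D * ennreal C5 * C6 + D) * (\<chi>1 t * (ennreal (\<rho> t) * ?N))"
      by (simp only: mult.left_commute)
    also have "\<dots> = D * ennreal C5 * C6 * (ennreal (t powr (1 - \<theta>0)) * \<chi>0 t * ?N)
        + D * (ennreal (t powr (1 - \<theta>0)) * \<chi>0 t * ?N)"
      unfolding chi1_rho_mult[OF t] by (rule distrib_right)
    finally have "\<chi>1 t * (W0.nested {0<..<t} 0 k + W0.B t * W0.E {0<..<t} k)
        \<le> \<chi>1 t * ((D * ennreal C5 * C6 + D) * (ennreal (\<rho> t) * ?N))"
      using add_mono[OF 1 2] by (simp only: distrib_left)
    then show "W0.nested {0<..<t} 0 k + W0.B t * W0.E {0<..<t} k
        \<le> (D * ennreal C5 * C6 + D) * (ennreal (\<rho> t) * ?N)"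
      using chi1_pos[OF t] chi1_finite[OF t] by (subst (asm) ennreal_mult_le_mult_iff) auto
  qed
qed

end

section \<open>The K-functional of the couple of limiting spaces\<close>

context LL_pair
begin

text \<open>
  The right-hand side of the theorem with \<open>k\<close> in place of \<open>K(\<cdot>, f)\<close>.
\<close>

definition K_estimate :: "(real \<Rightarrow> ennreal) \<Rightarrow> real \<Rightarrow> ennreal" where
  "K_estimate k t = W0.nested {0<..<t} 0 k + W0.B t * W0.E {0<..<t} k
      + ennreal (\<rho> t) * W1.nested {t<..} t k"

text \<open>
  The norm of the second part of an optimal decomposition. The hypothesis says that \<open>l(u)\<close> is at most
  \<open>c * u * k(t) / t\<close> up to \<open>t\<close> and at most \<open>c * k(u)\<close> beyond. In the space with \<open>\<theta> = 1\<close> the linear piece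
  contributes \<open>k(t) / t\<close> times \<open>\<chi>1(t)\<close>, by the definition of \<open>\<chi>1\<close>.
\<close>

lemma total1_le_of_linear_start:
  assumes "c < \<infinity>"
  obtains C where "C < \<infinity>" "\<And>k l t. quasi_concave k \<Longrightarrow> halfline_measurable l \<Longrightarrow> 0 < t \<Longrightarrow>
     (\<forall>u>0. ennreal t * l u \<le> c * (ennreal (min u t) * k (max u t))) \<Longrightarrow>
     ennreal t * W1.nested {0<..} 0 l \<le> C * (k t * \<chi>1 t + ennreal t * W1.nested {t<..} t k)"
proof -
  obtain C1 where C1: "C1 < \<infinity>" "\<And>k t. halfline_measurable k \<Longrightarrow> 0 < t \<Longrightarrow>
    W1.nested {0<..} 0 k \<le> C1 * (W1.nested {0<..<t} 0 k + W1.B t * W1.E {0<..<t} k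
        + W1.nested {t<..} t k)"
    using W1.total_le by blast
  show thesis
  proof (rule that)
    show "C1 * c < \<infinity>" using assms C1 by (simp add: ennreal_mult_less_top)
    fix k l t assume k: "quasi_concave k" and l: "halfline_measurable l" and t: "0 < t"
      and bound: "\<forall>u>0. ennreal t * l u \<le> c * (ennreal (min u t) * k (max u t))"
    have le1: "ennreal t * l u \<le> c * (ennreal u * k t)" if "0 < u" "u \<le> t" for u
      using bound[rule_format, of u] that by (simp add: min_absorb1 max_absorb2)
    have le2: "l u \<le> c * k u" if "t \<le> u" for u
    proof -
      have "ennreal t * l u \<le> ennreal t * (c * k u)"
        using bound[rule_format, of u] that t by (simp add: min_absorb2 max_absorb1 mult_ac)
      then show ?thesis using t by (subst (asm) ennreal_mult_le_mult_iff) auto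
    qed
    note km = quasi_concave_measurable[OF k]
    have inner: "ennreal t * W1.E {0<..<s} l \<le> (c * k t) * A s" if "s \<le> t" for s
    proof (rule Lnorm_scaled_mono)
      fix u assume "u \<in> {0<..<s}"
      then have u: "0 < u" "u \<le> t" using that by auto
      have "ennreal t * (wgt 1 q1 a1 u * l u) \<le> c * (wgt 1 q1 a1 u * (ennreal u * k t))"
        by (rule scaled_mult_left[OF le1[OF u]])
      also have "\<dots> = (c * k t) * wgt 0 q1 a1 u"
        using u by (simp add: wgt_zero_eq mult_ac)
      finally show "ennreal t * (wgt 1 q1 a1 u * l u) \<le> (c * k t) * wgt 0 q1 a1 u" .
    qed (use W1.q measurable_a1 W1.measurable_E[OF l] in auto)
    have 1: "ennreal t * W1.nested {0<..<t} 0 l \<le> (c * k t) * H t"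
      by (rule Lnorm_scaled_mono)
        (use t W1.r measurable_bA W1.measurable_nested[OF l] inner in \<open>auto intro!: scaled_mult_left\<close>)
    have 2: "ennreal t * (W1.B t * W1.E {0<..<t} l) \<le> (c * k t) * (W1.B t * A t)"
      by (rule scaled_mult_left[OF inner]) simp
    have "1 * W1.nested {t<..} t l \<le> c * W1.nested {t<..} t k"
      by (rule W1.nested_scaled_mono) (use t km l le2 in auto)
    then have 3: "ennreal t * W1.nested {t<..} t l \<le> c * (ennreal t * W1.nested {t<..} t k)"
      using scaled_mult_left[of 1 _ c _ "ennreal t"] by simp
    have "ennreal t * W1.nested {0<..} 0 l
       \<le> ennreal t * (C1 * (W1.nested {0<..<t} 0 l + W1.B t * W1.E {0<..<t} l + W1.nested {t<..} t l))"
      by (rule mult_left_mono[OF C1(2)[OF l t]]) simp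
    also have "\<dots> = C1 * (ennreal t * W1.nested {0<..<t} 0 l
        + ennreal t * (W1.B t * W1.E {0<..<t} l) + ennreal t * W1.nested {t<..} t l)"
      by (simp only: distrib_left mult.left_commute)
    also have "\<dots> \<le> C1 * ((c * k t) * H t + (c * k t) * (W1.B t * A t)
        + c * (ennreal t * W1.nested {t<..} t k))"
      by (intro mult_left_mono add_mono 1 2 3) simp
    also have "\<dots> = C1 * c * (k t * \<chi>1 t + ennreal t * W1.nested {t<..} t k)"
      by (simp only: chi1_eq distrib_left mult.assoc)
    finally show "ennreal t * W1.nested {0<..} 0 l
        \<le> C1 * c * (k t * \<chi>1 t + ennreal t * W1.nested {t<..} t k)" .
  qed
qed

text \<open>
  The upper bound. Multiplied by \<open>\<rho>(t)\<close>, the contribution of the linear piece becomes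
  \<open>t powr -\<theta>0 * \<chi>0(t) * k(t)\<close>, and this is absorbed by the second term of the estimate, by
  \<open>W0.E_lower\<close>.
\<close>

lemma totals_le_K_estimate:
  assumes "c < \<infinity>"
  obtains C where "C < \<infinity>" "\<And>k k0 k1 t. quasi_concave k \<Longrightarrow> halfline_measurable k0 \<Longrightarrow>
      halfline_measurable k1 \<Longrightarrow> 0 < t \<Longrightarrow>
     (\<forall>u>0. k0 u \<le> c * k (min u t)) \<Longrightarrow>
     (\<forall>u>0. ennreal t * k1 u \<le> c * (ennreal (min u t) * k (max u t))) \<Longrightarrow>
     W0.nested {0<..} 0 k0 + ennreal (\<rho> t) * W1.nested {0<..} 0 k1 \<le> C * K_estimate k t"
proof -
  obtain C0 where C0: "C0 < \<infinity>" "\<And>k l t. quasi_concave k \<Longrightarrow> halfline_measurable l \<Longrightarrow> 0 < t \<Longrightarrow>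
     (\<forall>u>0. l u \<le> c * k (min u t)) \<Longrightarrow>
     W0.nested {0<..} 0 l \<le> C0 * (W0.nested {0<..<t} 0 k + W0.B t * W0.E {0<..<t} k)"
    using W0.total_le_of_saturating[OF assms] by blast
  obtain C1 where C1: "C1 < \<infinity>" "\<And>k l t. quasi_concave k \<Longrightarrow> halfline_measurable l \<Longrightarrow> 0 < t \<Longrightarrow>
     (\<forall>u>0. ennreal t * l u \<le> c * (ennreal (min u t) * k (max u t))) \<Longrightarrow>
     ennreal t * W1.nested {0<..} 0 l \<le> C1 * (k t * \<chi>1 t + ennreal t * W1.nested {t<..} t k)"
    using total1_le_of_linear_start[OF assms] by blast
  obtain C2 where C2: "C2 < \<infinity>" "\<And>k t. quasi_concave k \<Longrightarrow> 0 < t \<Longrightarrow>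
    ennreal (t powr (- \<theta>0) * a0 t) * k t \<le> C2 * W0.E {0<..<t} k"
    using W0.E_lower by blast
  show thesis
  proof (rule that)
    show "C0 + C1 * (C2 + 1) < \<infinity>" using C0(1) C1(1) C2(1) by (simp add: ennreal_mult_less_top)
    fix k k0 k1 t assume k: "quasi_concave k" and k0: "halfline_measurable k0"
        and k1: "halfline_measurable k1" and t: "0 < t"
      and le0: "\<forall>u>0. k0 u \<le> c * k (min u t)"
      and le1: "\<forall>u>0. ennreal t * k1 u \<le> c * (ennreal (min u t) * k (max u t))"
    let ?M = "W0.B t * W0.E {0<..<t} k" and ?T = "ennreal (\<rho> t) * W1.nested {t<..} t k"
    let ?R = "ennreal (\<rho> t) * W1.nested {0<..} 0 k1"
    have a0t: "0 \<le> a0 t" using potter_pos[OF W0.a t] by simp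
    have "t powr (1 - \<theta>0) = t * t powr (- \<theta>0)" using t by (simp add: powr_diff powr_minus field_simps)
    then have "ennreal (t powr (1 - \<theta>0)) * \<chi>0 t * k t
        = ennreal t * (W0.B t * (ennreal (t powr (- \<theta>0) * a0 t) * k t))"
      using t a0t by (simp add: chi0_eq ennreal_mult mult_ac)
    also have "\<dots> \<le> ennreal t * (W0.B t * (C2 * W0.E {0<..<t} k))"
      by (intro mult_left_mono C2 k t) simp_all
    finally have chi: "\<chi>1 t * (ennreal (\<rho> t) * k t) \<le> ennreal t * (C2 * ?M)"
      unfolding chi1_rho_mult[OF t] by (simp only: mult_ac)
    have "ennreal t * ?R = ennreal (\<rho> t) * (ennreal t * W1.nested {0<..} 0 k1)"
      by (simp only: mult.left_commute)
    also have "\<dots> \<le> ennreal (\<rho> t) * (C1 * (k t * \<chi>1 t + ennreal t * W1.nested {t<..} t k))"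
      by (rule mult_left_mono[OF C1(2)[OF k k1 t le1]]) simp_all
    also have "\<dots> = C1 * (\<chi>1 t * (ennreal (\<rho> t) * k t) + ennreal t * ?T)"
      by (simp only: distrib_left mult_ac)
    also have "\<dots> \<le> C1 * (ennreal t * (C2 * ?M) + ennreal t * ?T)"
      by (intro mult_left_mono add_mono chi) simp_all
    also have "\<dots> = ennreal t * (C1 * (C2 * ?M + ?T))"
      by (simp only: distrib_left mult.left_commute)
    finally have "?R \<le> C1 * (C2 * ?M + ?T)"
      using t by (subst (asm) ennreal_mult_le_mult_iff) auto
    also have "\<dots> \<le> C1 * ((C2 + 1) * K_estimate k t)"
      unfolding K_estimate_def by (intro mult_left_mono)
          (simp_all add: distrib_left distrib_right add_ac add_increasing add_increasing2)
    finally have R: "?R \<le> C1 * (C2 + 1) * K_estimate k t" by (simp only: mult.assoc)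
    have "W0.nested {0<..} 0 k0 \<le> C0 * (W0.nested {0<..<t} 0 k + ?M)"
      by (rule C0(2)[OF k k0 t le0])
    also have "\<dots> \<le> C0 * K_estimate k t"
      unfolding K_estimate_def by (intro mult_left_mono) simp_all
    finally show "W0.nested {0<..} 0 k0 + ?R \<le> (C0 + C1 * (C2 + 1)) * K_estimate k t"
      using R unfolding distrib_right[of C0] by (rule add_mono)
  qed
qed

lemma K_estimate_mono:
  assumes "halfline_measurable k" "halfline_measurable l" "0 < t" "\<And>u. 0 < u \<Longrightarrow> k u \<le> c * l u"
  shows "K_estimate k t \<le> c * K_estimate l t"
proof -
  have sub: "{0<..<t} \<subseteq> {0<..}" by auto
  have "1 * W0.nested {0<..<t} 0 k \<le> c * W0.nested {0<..<t} 0 l"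
    by (rule W0.nested_scaled_mono) (use assms sub in auto)
  moreover have "1 * W0.E {0<..<t} k \<le> c * W0.E {0<..<t} l"
    by (rule W0.E_scaled_mono) (use assms sub in auto)
  then have "1 * (W0.B t * W0.E {0<..<t} k) \<le> c * (W0.B t * W0.E {0<..<t} l)"
    by (rule scaled_mult_left)
  moreover have "1 * W1.nested {t<..} t k \<le> c * W1.nested {t<..} t l"
    by (rule W1.nested_scaled_mono) (use assms in auto)
  then have "1 * (ennreal (\<rho> t) * W1.nested {t<..} t k) \<le> c * (ennreal (\<rho> t) * W1.nested {t<..} t l)"
    by (rule scaled_mult_left)
  ultimately show ?thesis
    unfolding K_estimate_def distrib_left by (simp add: add_mono)
qed

lemma K_estimate_add:
  obtains C where "C < \<infinity>" "\<And>k l t. halfline_measurable k \<Longrightarrow> halfline_measurable l \<Longrightarrow> 0 < t \<Longrightarrow>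
    K_estimate (\<lambda>u. k u + l u) t \<le> C * (K_estimate k t + K_estimate l t)"
proof -
  obtain C0 where C0: "C0 < \<infinity>" "\<And>J k l. open J \<Longrightarrow> J \<subseteq> {0<..} \<Longrightarrow> halfline_measurable k \<Longrightarrow>
      halfline_measurable l \<Longrightarrow>
    W0.E J (\<lambda>u. k u + l u) \<le> C0 * (W0.E J k + W0.E J l)"
    using W0.E_add_le by blast
  obtain C1 where C1: "C1 < \<infinity>" "\<And>J x k l. open J \<Longrightarrow> J \<subseteq> {0<..} \<Longrightarrow> halfline_measurable k \<Longrightarrow>
      halfline_measurable l \<Longrightarrow>
    0 \<le> x \<Longrightarrow> W0.nested J x (\<lambda>u. k u + l u) \<le> C1 * (W0.nested J x k + W0.nested J x l)"
    using W0.nested_add_le by blast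
  obtain C2 where C2: "C2 < \<infinity>" "\<And>J x k l. open J \<Longrightarrow> J \<subseteq> {0<..} \<Longrightarrow> halfline_measurable k \<Longrightarrow>
      halfline_measurable l \<Longrightarrow>
    0 \<le> x \<Longrightarrow> W1.nested J x (\<lambda>u. k u + l u) \<le> C2 * (W1.nested J x k + W1.nested J x l)"
    using W1.nested_add_le by blast
  let ?C = "C1 + C0 + C2"
  have C: "C1 \<le> ?C" "C0 \<le> ?C" "C2 \<le> ?C" by (simp_all add: add_increasing add_increasing2)
  show thesis
  proof (rule that)
    show "?C < \<infinity>" using C0(1) C1(1) C2(1) by simp
    fix k l t assume k: "halfline_measurable k" and l: "halfline_measurable l" and t: "0 < (t::real)"
    have sub: "{0<..<t} \<subseteq> {0<..}" "{t<..} \<subseteq> {0<..}" using t by auto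
    have "1 * W0.nested {0<..<t} 0 (\<lambda>u. k u + l u)
        \<le> ?C * (W0.nested {0<..<t} 0 k + W0.nested {0<..<t} 0 l)"
      using C1(2)[OF _ sub(1) k l, of 0] mult_right_mono[OF C(1)] by (auto intro: order_trans)
    moreover have "1 * W0.E {0<..<t} (\<lambda>u. k u + l u) \<le> ?C * (W0.E {0<..<t} k + W0.E {0<..<t} l)"
      using C0(2)[OF _ sub(1) k l] mult_right_mono[OF C(2)] by (auto intro: order_trans)
    then have "1 * (W0.B t * W0.E {0<..<t} (\<lambda>u. k u + l u))
        \<le> ?C * (W0.B t * (W0.E {0<..<t} k + W0.E {0<..<t} l))"
      by (rule scaled_mult_left)
    moreover have "1 * W1.nested {t<..} t (\<lambda>u. k u + l u)
        \<le> ?C * (W1.nested {t<..} t k + W1.nested {t<..} t l)"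
      using C2(2)[OF _ sub(2) k l, of t] mult_right_mono[OF C(3)] t by (auto intro: order_trans)
    then have "1 * (ennreal (\<rho> t) * W1.nested {t<..} t (\<lambda>u. k u + l u))
        \<le> ?C * (ennreal (\<rho> t) * (W1.nested {t<..} t k + W1.nested {t<..} t l))"
      by (rule scaled_mult_left)
    ultimately have "K_estimate (\<lambda>u. k u + l u) t
        \<le> ?C * (W0.nested {0<..<t} 0 k + W0.nested {0<..<t} 0 l)
       + ?C * (W0.B t * (W0.E {0<..<t} k + W0.E {0<..<t} l))
           + ?C * (ennreal (\<rho> t) * (W1.nested {t<..} t k + W1.nested {t<..} t l))"
      unfolding K_estimate_def mult_1 by (intro add_mono)
    also have "\<dots> = ?C * (K_estimate k t + K_estimate l t)"
      unfolding K_estimate_def by (simp only: distrib_left add_ac)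
    finally show "K_estimate (\<lambda>u. k u + l u) t \<le> ?C * (K_estimate k t + K_estimate l t)" .
  qed
qed

text \<open>
  The lower bound, for any decomposition: quasi-subadditivity separates \<open>k0\<close> and \<open>k1\<close>, after which each term is
  either a part of the matching norm or one of the crossed terms.
\<close>

lemma K_estimate_le_totals:
  assumes "c < \<infinity>"
  obtains C where "C < \<infinity>" "\<And>k k0 k1 t. halfline_measurable k \<Longrightarrow> quasi_concave k0 \<Longrightarrow>
      quasi_concave k1 \<Longrightarrow> 0 < t \<Longrightarrow>
     (\<forall>u>0. k u \<le> c * (k0 u + k1 u)) \<Longrightarrow>
     K_estimate k t \<le> C * (W0.nested {0<..} 0 k0 + ennreal (\<rho> t) * W1.nested {0<..} 0 k1)"
proof -
  obtain C1 where C1: "C1 < \<infinity>" "\<And>k l t. halfline_measurable k \<Longrightarrow> halfline_measurable l \<Longrightarrow> 0 < t \<Longrightarrow>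
    K_estimate (\<lambda>u. k u + l u) t \<le> C1 * (K_estimate k t + K_estimate l t)"
    using K_estimate_add by blast
  obtain C2 where C2: "C2 < \<infinity>" "\<And>k t. quasi_concave k \<Longrightarrow> 0 < t \<Longrightarrow>
    ennreal (\<rho> t) * W1.nested {t<..} t k \<le> C2 * W0.nested {0<..} 0 k"
    using tail1_le_total0 by blast
  obtain C3 where C3: "C3 < \<infinity>" "\<And>k t. quasi_concave k \<Longrightarrow> 0 < t \<Longrightarrow>
    W0.nested {0<..<t} 0 k + W0.B t * W0.E {0<..<t} k \<le> C3 * (ennreal (\<rho> t) * W1.nested {0<..} 0 k)"
    using head0_le_total1 by blast
  let ?C = "(2 + C2) + (C3 + 1)"
  show thesis
  proof (rule that)
    show "c * (C1 * ?C) < \<infinity>" using assms C1(1) C2(1) C3(1) by (simp add: ennreal_mult_less_top)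
    fix k k0 k1 t assume k: "halfline_measurable k" and k0: "quasi_concave k0"
        and k1: "quasi_concave k1" and t: "0 < (t::real)"
      and le: "\<forall>u>0. k u \<le> c * (k0 u + k1 u)"
    note m0 = quasi_concave_measurable[OF k0] and m1 = quasi_concave_measurable[OF k1]
    let ?N0 = "W0.nested {0<..} 0 k0" and ?N1 = "ennreal (\<rho> t) * W1.nested {0<..} 0 k1"
    have sub: "{0<..<t} \<subseteq> {0<..}" "{t<..} \<subseteq> {0<..}" using t by auto
    have "K_estimate k0 t \<le> ?N0 + ?N0 + C2 * ?N0"
      unfolding K_estimate_def
      by (intro add_mono W0.nested_le_total W0.B_E_le_total C2 k0 m0 t sub) simp_all
    also have "\<dots> = (2 + C2) * ?N0" by (simp only: distrib_right mult_2)
    finally have 0: "K_estimate k0 t \<le> (2 + C2) * ?N0" .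
    have "ennreal (\<rho> t) * W1.nested {t<..} t k1 \<le> ?N1"
      using t by (intro mult_left_mono W1.nested_le_total m1 sub) simp_all
    then have "K_estimate k1 t \<le> C3 * ?N1 + ?N1"
      unfolding K_estimate_def by (intro add_mono C3 k1 t)
    also have "\<dots> = (C3 + 1) * ?N1" by (simp only: distrib_right mult_1)
    finally have 1: "K_estimate k1 t \<le> (C3 + 1) * ?N1" .
    have "K_estimate k t \<le> c * K_estimate (\<lambda>u. k0 u + k1 u) t"
      by (intro K_estimate_mono k t le[rule_format] borel_measurable_add m0 m1)
    also have "\<dots> \<le> c * (C1 * (K_estimate k0 t + K_estimate k1 t))"
      by (intro mult_left_mono C1 m0 m1 t) simp
    also have "\<dots> \<le> c * (C1 * ((2 + C2) * ?N0 + (C3 + 1) * ?N1))"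
      by (intro mult_left_mono add_mono 0 1) simp_all
    also have "\<dots> \<le> c * (C1 * (?C * ?N0 + ?C * ?N1))"
      by (intro mult_left_mono add_mono mult_right_mono add_increasing add_increasing2 order_refl zero_le)
    finally show "K_estimate k t \<le> c * (C1 * ?C) * (?N0 + ?N1)"
      by (simp only: mult.assoc distrib_left[of ?C])
  qed
qed

end

theorem theorem33:
  fixes A0 A1 :: "'v::{real_vector, topological_ab_group_add, t2_space} qspace"
    and \<theta>0 :: real
    and q0 r0 q1 r1 :: ennreal
    and a0 b0 a1 b1 :: "real \<Rightarrow> real"
  assumes "quasi_banach A0" and "quasi_banach A1"
    and "compatible_couple A0 A1"
    and "qcarrier A0 \<inter> qcarrier A1 \<noteq> {0}"
    and "0 < q1" and "0 < r1"
    and "slowly_varying a1" and "slowly_varying b1"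
    and "Lnorm r1 {1<..} (wgt 0 r1 b1) < \<infinity>"
    and "Lnorm r1 {0<..<1} (\<lambda>s. wgt 0 r1 b1 s * Lnorm q1 {0<..<s} (wgt 0 q1 a1)) < \<infinity>"
    and "0 < \<theta>0" and "\<theta>0 < 1"
    and "0 < q0" and "0 < r0"
    and "slowly_varying a0" and "slowly_varying b0"
    and "Lnorm r0 {1<..} (wgt 0 r0 b0) < \<infinity>"
    and "qcarrier (LL_space A0 A1 \<theta>0 r0 b0 q0 a0) \<noteq> {0}"
    and "qcarrier (LL_space A0 A1 1 r1 b1 q1 a1) \<noteq> {0}"
  shows "\<exists>C::real. C > 0 \<and>
    (\<forall>f \<in> sum_space (LL_space A0 A1 \<theta>0 r0 b0 q0 a0) (LL_space A0 A1 1 r1 b1 q1 a1). \<forall>t>0.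
      let \<rho> = rho \<theta>0 r0 b0 a0 r1 b1 q1 a1;
          lhs = ennreal (Kfun (LL_space A0 A1 \<theta>0 r0 b0 q0 a0) (LL_space A0 A1 1 r1 b1 q1 a1) (\<rho> t) f);
          rhs =
            Lnorm r0 {0<..<t} (\<lambda>s. wgt 0 r0 b0 s *
              Lnorm q0 {0<..<s} (\<lambda>u. wgt \<theta>0 q0 a0 u * ennreal (Kfun A0 A1 u f)))
            + Lnorm r0 {t<..} (wgt 0 r0 b0) *
              Lnorm q0 {0<..<t} (\<lambda>u. wgt \<theta>0 q0 a0 u * ennreal (Kfun A0 A1 u f))
            + ennreal (\<rho> t) *
              Lnorm r1 {t<..} (\<lambda>s. wgt 0 r1 b1 s *
                Lnorm q1 {t<..<s} (\<lambda>u. wgt 1 q1 a1 u * ennreal (Kfun A0 A1 u f)))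
      in ennreal (inverse C) * rhs \<le> lhs \<and> lhs \<le> ennreal C * rhs)"
proof -
  interpret quasi_couple A0 A1
    using assms(1,2) by unfold_locales (simp_all add: quasi_banach_def)
  interpret LL_pair \<theta>0 r0 q0 r1 q1 b0 a0 b1 a1
    using assms by unfold_locales (simp_all add: slowly_varying_imp_potter)
  define X0 where "X0 = LL_space A0 A1 \<theta>0 r0 b0 q0 a0"
  define X1 where "X1 = LL_space A0 A1 1 r1 b1 q1 a1"
  define k where "k f u = ennreal (K u f)" for f u
  have X: "nonneg_norm X0" "nonneg_norm X1" by (simp_all add: X0_def X1_def nonneg_LL_space)
  have carrier0: "f \<in> qcarrier X0 \<longleftrightarrow> f \<in> sum_space A0 A1 \<and> W0.nested {0<..} 0 (k f) < \<infinity>"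
    and norm0: "qnorm X0 f = enn2real (W0.nested {0<..} 0 (k f))"
    and carrier1: "f \<in> qcarrier X1 \<longleftrightarrow> f \<in> sum_space A0 A1 \<and> W1.nested {0<..} 0 (k f) < \<infinity>"
    and norm1: "qnorm X1 f = enn2real (W1.nested {0<..} 0 (k f))" for f
    by (auto simp: X0_def X1_def LL_space_def LL_norm_def k_def)
  have conc: "quasi_concave (k f)" if "f \<in> sum_space A0 A1" for f
    using quasi_concave_Kfun[OF nonneg that] by (simp add: k_def[abs_def])
  note meas = quasi_concave_measurable[OF conc]
  have sum_norms: "W0.nested {0<..} 0 (k f0) + ennreal (\<rho> t) * W1.nested {0<..} 0 (k f1)
      = ennreal (qnorm X0 f0 + \<rho> t * qnorm X1 f1)"
    if "f0 \<in> qcarrier X0" "f1 \<in> qcarrier X1" "0 < t" for f0 f1 t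
    using that rho_pos[of t] by (simp add: carrier0 carrier1 norm0 norm1 ennreal_mult)
  have zero: "W0.nested {0<..} 0 (k f) = 0" "W1.nested {0<..} 0 (k f) = 0"
    if f: "f \<in> sum_space A0 A1" and z: "\<And>u. 0 < u \<Longrightarrow> K u f = 0" for f
  proof -
    have kz: "k f u = 0" if "0 < u" for u using z[OF that] by (simp add: k_def)
    have "1 * W0.nested {0<..} 0 (k f) \<le> 0 * W0.nested {0<..} 0 (k f)"
      by (rule W0.nested_scaled_mono) (use meas[OF f] kz in auto)
    then show "W0.nested {0<..} 0 (k f) = 0" by simp
    have "1 * W1.nested {0<..} 0 (k f) \<le> 0 * W1.nested {0<..} 0 (k f)"
      by (rule W1.nested_scaled_mono) (use meas[OF f] kz in auto)
    then show "W1.nested {0<..} 0 (k f) = 0" by simp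
  qed
  obtain c where c: "1 \<le> c" "\<And>f g u. f \<in> sum_space A0 A1 \<Longrightarrow> g \<in> sum_space A0 A1 \<Longrightarrow> 0 < u \<Longrightarrow>
      K u (f + g) \<le> c * (K u f + K u g)"
    using K_quasi_triangle by blast
  obtain d where d: "1 \<le> d"
    "\<And>f t. f \<in> sum_space A0 A1 \<Longrightarrow> 0 < t \<Longrightarrow> 0 < K t f \<Longrightarrow>
      \<exists>f0\<in>qcarrier A0. \<exists>f1\<in>qcarrier A1. f = f0 + f1 \<and>
        (\<forall>u>0. K u f0 \<le> d * K (min u t) f \<and> t * K u f1 \<le> d * (min u t * K (max u t) f))"
    using near_optimal_decomposition by blast
  have cd: "ennreal c < \<infinity>" "ennreal d < \<infinity>" by simp_all
  obtain Cl where Cl: "Cl < \<infinity>" "\<And>k k0 k1 t. halfline_measurable k \<Longrightarrow> quasi_concave k0 \<Longrightarrow>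
      quasi_concave k1 \<Longrightarrow> 0 < t \<Longrightarrow>
     (\<forall>u>0. k u \<le> ennreal c * (k0 u + k1 u)) \<Longrightarrow>
     K_estimate k t \<le> Cl * (W0.nested {0<..} 0 k0 + ennreal (\<rho> t) * W1.nested {0<..} 0 k1)"
    using K_estimate_le_totals[OF cd(1)] by blast
  obtain Cu where Cu: "Cu < \<infinity>" "\<And>k k0 k1 t. quasi_concave k \<Longrightarrow> halfline_measurable k0 \<Longrightarrow>
      halfline_measurable k1 \<Longrightarrow> 0 < t \<Longrightarrow>
     (\<forall>u>0. k0 u \<le> ennreal d * k (min u t)) \<Longrightarrow>
     (\<forall>u>0. ennreal t * k1 u \<le> ennreal d * (ennreal (min u t) * k (max u t))) \<Longrightarrow>
     W0.nested {0<..} 0 k0 + ennreal (\<rho> t) * W1.nested {0<..} 0 k1 \<le> Cu * K_estimate k t"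
    using totals_le_K_estimate[OF cd(2)] by blast
  define C where "C = enn2real Cl + enn2real Cu + 1"
  have C: "0 < C" by (simp add: C_def add_nonneg_pos)
  have "ennreal (enn2real Cl) \<le> ennreal C" "ennreal (enn2real Cu) \<le> ennreal C"
    by (simp_all add: C_def ennreal_leI)
  then have ClC: "Cl \<le> ennreal C" and CuC: "Cu \<le> ennreal C"
    using Cl(1) Cu(1) by simp_all
  have inSum: "f0 + f1 \<in> sum_space A0 A1" if "f0 \<in> qcarrier X0" "f1 \<in> qcarrier X1" for f0 f1
    using that sum_space_add by (auto simp: carrier0 carrier1)
  have main: "ennreal (inverse C) * K_estimate (k f) t \<le> ennreal (Kfun X0 X1 (\<rho> t) f) \<and>
      ennreal (Kfun X0 X1 (\<rho> t) f) \<le> ennreal C * K_estimate (k f) t"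
    if f: "f \<in> sum_space X0 X1" and t: "0 < t" for f t
  proof
    have fA: "f \<in> sum_space A0 A1" using f inSum unfolding sum_space_def[of X0] by auto
    have \<rho>: "0 < \<rho> t" by (rule rho_pos[OF t])
    have Kn: "0 \<le> K u g" if "g \<in> sum_space A0 A1" "0 < u" for u g
      using Kfun_nonneg[OF nonneg _ that(1)] that(2) by simp
    have low: "ennreal (inverse C) * K_estimate (k f) t \<le> ennreal (qnorm X0 f0 + \<rho> t * qnorm X1 f1)"
      if f0: "f0 \<in> qcarrier X0" and f1: "f1 \<in> qcarrier X1" and eq: "f = f0 + f1" for f0 f1
    proof -
      have s: "f0 \<in> sum_space A0 A1" "f1 \<in> sum_space A0 A1" using f0 f1 by (auto simp: carrier0 carrier1)
      have "K_estimate (k f) t \<le> Cl * (W0.nested {0<..} 0 (k f0)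
          + ennreal (\<rho> t) * W1.nested {0<..} 0 (k f1))"
      proof (rule Cl(2)[OF meas[OF fA] conc[OF s(1)] conc[OF s(2)] t]; intro allI impI)
        fix u :: real assume u: "0 < u"
        show "k f u \<le> ennreal c * (k f0 u + k f1 u)"
          using c(2)[OF s u] c(1) Kn[OF s(1) u] Kn[OF s(2) u] unfolding k_def eq
          by (simp add: ennreal_leI flip: ennreal_plus ennreal_mult)
      qed
      also have "\<dots> \<le> ennreal C * ennreal (qnorm X0 f0 + \<rho> t * qnorm X1 f1)"
        unfolding sum_norms[OF f0 f1 t] by (rule mult_right_mono[OF ClC]) simp
      finally have "ennreal (inverse C) * K_estimate (k f) t
          \<le> ennreal (inverse C) * (ennreal C * ennreal (qnorm X0 f0 + \<rho> t * qnorm X1 f1))"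
        by (rule mult_left_mono) simp
      also have "\<dots> = ennreal (qnorm X0 f0 + \<rho> t * qnorm X1 f1)"
        using C by (simp flip: mult.assoc ennreal_mult)
      finally show ?thesis .
    qed
    \<comment> \<open>The infimum defining the K-functional is real, so the left-hand side has to be known to be finite first.\<close>
    show "ennreal (inverse C) * K_estimate (k f) t \<le> ennreal (Kfun X0 X1 (\<rho> t) f)"
    proof (cases "ennreal (inverse C) * K_estimate (k f) t")
      case (real y)
      have "y \<le> Kfun X0 X1 (\<rho> t) f"
      proof (rule Kfun_ge[OF f])
        fix f0 f1 assume *: "f0 \<in> qcarrier X0" "f1 \<in> qcarrier X1" "f = f0 + f1"
        have "0 \<le> qnorm X0 f0 + \<rho> t * qnorm X1 f1"
          using \<rho> by (simp add: norm0 norm1)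
        then show "y \<le> qnorm X0 f0 + \<rho> t * qnorm X1 f1"
          using low[OF *] real by (simp add: ennreal_le_iff)
      qed
      then show ?thesis using real by (simp add: ennreal_leI)
    next
      case top
      obtain f0 f1 where "f0 \<in> qcarrier X0" "f1 \<in> qcarrier X1" "f = f0 + f1"
        using f by (auto simp: sum_space_def)
      from low[OF this] top show ?thesis by (simp add: top_unique)
    qed
    show "ennreal (Kfun X0 X1 (\<rho> t) f) \<le> ennreal C * K_estimate (k f) t"
    proof (cases "K t f = 0")
      \<comment> \<open>No nearly optimal decomposition is available here, but then both sides vanish.\<close>
      case True
      have K0: "K u f = 0" if u: "0 < u" for u
      proof (cases "u \<le> t")
        case le: True
        then have "K u f \<le> K t f" using Kfun_mono[OF nonneg fA, of u t] u by simp
        then show ?thesis using True Kn[OF fA u] by simp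
      next
        case False
        then have "t * K u f \<le> u * K t f" using Kfun_div_antimono[OF nonneg fA t, of u] by simp
        then have "K u f \<le> 0" using True t by (simp add: mult_le_0_iff)
        then show ?thesis using Kn[OF fA u] by simp
      qed
      have zs: "0 \<in> sum_space A0 A1" using carrier_sum_space(1) subspace_0[OF subspace(1)] by blast
      have z0: "W0.nested {0<..} 0 (k f) = 0" using zero(1)[OF fA K0] .
      have z1: "W1.nested {0<..} 0 (k 0) = 0" using zero(2)[OF zs] K_zero by simp
      have "f \<in> qcarrier X0" "0 \<in> qcarrier X1"
        using fA zs z0 z1 by (simp_all add: carrier0 carrier1)
      then have "Kfun X0 X1 (\<rho> t) (f + 0) \<le> qnorm X0 f + \<rho> t * qnorm X1 0"
        using Kfun_le[OF X] \<rho> by (meson less_imp_le)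
      then have "Kfun X0 X1 (\<rho> t) f \<le> 0"
        by (simp add: norm0 norm1 z0 z1)
      then show ?thesis by (simp add: ennreal_neg)
    next
      case False
      then have Kpos: "0 < K t f" using Kn[OF fA t] by simp
      obtain f0 f1 where f0: "f0 \<in> qcarrier A0" and f1: "f1 \<in> qcarrier A1" and eq: "f = f0 + f1"
        and near: "\<And>u. 0 < u \<Longrightarrow> K u f0 \<le> d * K (min u t) f"
          "\<And>u. 0 < u \<Longrightarrow> t * K u f1 \<le> d * (min u t * K (max u t) f)"
        using d(2)[OF fA t Kpos] by blast
      have s: "f0 \<in> sum_space A0 A1" "f1 \<in> sum_space A0 A1" using f0 f1 carrier_sum_space by blast+
      have le: "W0.nested {0<..} 0 (k f0) + ennreal (\<rho> t) * W1.nested {0<..} 0 (k f1)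
          \<le> Cu * K_estimate (k f) t"
      proof (rule Cu(2)[OF conc[OF fA] meas[OF s(1)] meas[OF s(2)] t]; intro allI impI)
        fix u :: real assume u: "0 < u"
        then have mn: "0 < min u t" "0 < max u t" using t by auto
        show "k f0 u \<le> ennreal d * k f (min u t)"
          using near(1)[OF u] d(1) Kn[OF fA mn(1)] unfolding k_def
          by (simp add: ennreal_leI flip: ennreal_mult)
        show "ennreal t * k f1 u \<le> ennreal d * (ennreal (min u t) * k f (max u t))"
          using near(2)[OF u] d(1) Kn[OF fA mn(2)] Kn[OF s(2) u] t mn(1) unfolding k_def
          by (simp add: ennreal_leI flip: ennreal_mult)
      qed
      also have "\<dots> \<le> ennreal C * K_estimate (k f) t"
        by (rule mult_right_mono[OF CuC]) simp
      finally have le: "W0.nested {0<..} 0 (k f0) + ennreal (\<rho> t) * W1.nested {0<..} 0 (k f1)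
          \<le> ennreal C * K_estimate (k f) t" .
      show ?thesis
      proof (cases "ennreal C * K_estimate (k f) t < \<infinity>")
        case True
        have fin: "W0.nested {0<..} 0 (k f0) + ennreal (\<rho> t) * W1.nested {0<..} 0 (k f1) < \<infinity>"
          using le True by (rule le_less_trans)
        then have "W0.nested {0<..} 0 (k f0) < \<infinity>"
            "ennreal (\<rho> t) * W1.nested {0<..} 0 (k f1) < \<infinity>" by simp_all
        then have X0: "f0 \<in> qcarrier X0" and X1: "f1 \<in> qcarrier X1"
          using s \<rho> by (auto simp: carrier0 carrier1 ennreal_mult_less_top)
        have "Kfun X0 X1 (\<rho> t) f \<le> qnorm X0 f0 + \<rho> t * qnorm X1 f1"
          unfolding eq using Kfun_le[OF X _ X0 X1] \<rho> by simp
        then have "ennreal (Kfun X0 X1 (\<rho> t) f)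
            \<le> W0.nested {0<..} 0 (k f0) + ennreal (\<rho> t) * W1.nested {0<..} 0 (k f1)"
          unfolding sum_norms[OF X0 X1 t] by (rule ennreal_leI)
        also note le
        finally show ?thesis .
      next
        case False
        then have "ennreal C * K_estimate (k f) t
            = top" by (metis top.not_eq_extremum infinity_ennreal_def)
        then show ?thesis by simp
      qed
    qed
  qed
  show ?thesis
    using C main unfolding X0_def X1_def Let_def K_estimate_def k_def by blast
qed

end
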